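(* Consider the linear-quadratic optimal control problem $$\min_{\{x_k\},\{u_k\}}\ \sum_{k=0}^{N-1}g_k(x_k,u_k)+g_N(x_N)\quad\text{s.t. } x_{k+1}=f_k(x_k,u_k)\ (\lambda_k),\ k\in\{0,\dots,N-1\},\quad x_0=\bar x_0\ (\lambda_{-1}),$$ with $$g_k(x_k,u_k)=\begin{pmatrix} x_k \\ u_k \end{pmatrix}^T H_k\begin{pmatrix} x_k \\ u_k \end{pmatrix}+\begin{pmatrix} r_k \\ s_k \end{pmatrix}^T\begin{pmatrix} x_k \\ u_k \end{pmatrix},\quad H_k=\begin{pmatrix} Q_k & S_k^T \\ S_k & R_k \end{pmatrix},\quad g_N(x_N)=x_N^TQ_Nx_N+r_N^Tx_N,$$ and $f_k(x_k,u_k)=A_kx_k+B_ku_k+v_k$. Suppose the uniform SOSC, boundedness and controllability conditions (a)–(c) of the context hold for $\{H_k,A_k,B_k\}$. Then there exist parameters $\bar\mu,\bar\tau>0$ such that if the penalty parameter satisfies $\mu\ge\bar\mu$ and the overlap size satisfies $\tau\ge\bar\tau$, then for any initial point $w^{(0)}$ the iterates of the overlapping Schwarz decomposition algorithm (defined in the context) converge linearly to the unique global primal-dual solution $w^\star$ of the problem: $$\|w^{(\ell)}-w^\star\|_w\le\alpha^\ell\|w^{(0)}-w^\star\|_w,\qquad \ell=0,1,2,\dots,$$ where $\alpha=2\Upsilon\rho^\tau$ is independent of $N$; here $\Upsilon>0$ and $\rho\in(0,1)$ are the constants of the stagewise estimate recalled in the context.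
   Context: **Setting.** $[n]=\{0,\dots,n\}$; $a\vee b=\max(a,b)$, $a\wedge b=\min(a,b)$; $\|\cdot\|$ is the Euclidean/spectral norm. $x_k\in\mathbb{R}^{n_x}$, $u_k\in\mathbb{R}^{n_u}$, $\lambda_k\in\mathbb{R}^{n_x}$; $Q_k,R_k$ symmetric. $z_k=(x_k;u_k)$, $z_N=x_N$, $w_k=(x_k;u_k;\lambda_k)$ for $k\in[N-1]$, $w_N=x_N$, $w_{-1}=\lambda_{-1}$, $w=w_{-1:N}=(w_{-1};\dots;w_N)$. Multipliers enter the Lagrangian as $\lambda_k^T(x_{k+1}-f_k)$ and $\lambda_{-1}^T(x_0-\bar x_0)$ added to the objective. **Conditions.** There are constants $\gamma_H,\gamma_C,t>0$ and $\Upsilon_{\text{upper}}$, independent of $N$, such that, with $H_N=Q_N$: (a) $Z^THZ\succeq\gamma_HI$, where $H=\mathrm{diag}(H_0,\dots,H_N)$ and the columns of $Z$ form an orthonormal basis of the null space of the constraint Jacobian (the $z=(z_0;\dots;z_N)$ with $x_0=0$ and $x_{k+1}=A_kx_k+B_ku_k$ for $k\in[N-1]$); (b) $\|H_k\|\vee\|A_k\|\vee\|B_k\|\le\Upsilon_{\text{upper}}$ for $k\in[N-1]$ and $\|H_N\|\le\Upsilon_{\text{upper}}$; (c) for every $k\in[N-t]$ there is $t_k\in[1,t]$ with $\Xi_{k,t_k}\Xi_{k,t_k}^T\succeq\gamma_CI$, where $\Xi_{k,s}=\big(B_{k+s-1}\ \ A_{k+s-1}B_{k+s-2}\ \cdots\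 A_{k+s-1}\cdots A_{k+1}B_k\big)$. **Decomposition.** $0=m_0<m_1<\dots<m_T=N$; overlap size $\tau$; $n_i^1=(m_i-\tau)\vee0$, $n_i^2=(m_{i+1}+\tau)\wedge N$ for $i\in[T-1]$. Put $w_{[i]}=(\lambda_{n_i^1-1};w_{n_i^1:n_i^2-1};x_{n_i^2})$ and $w_{[-i]}=(x_{n_i^1};w_{n_i^2})$ (with $w_{[-(T-1)]}=x_{n_{T-1}^1}$). Put $w_{(i)}=w_{m_i:m_{i+1}-1}$, except that $w_{(0)}$ also includes stage $-1$ and $w_{(T-1)}$ also includes stage $N$. $T_k$ extracts from a vector of the form $w_{[i]}$ its stage-$k$ part, and $T_{(i)}$ extracts the stages in $w_{(i)}$. For boundary data $\bar w_{[-i]}=(\bar x_{n_i^1};\bar w_{n_i^2})$, $\bar w_{n_i^2}=(\bar x_{n_i^2};\bar u_{n_i^2};\bar\lambda_{n_i^2})$, and a penalty parameter $\mu$ (set uniformly over all subproblems), the subproblem $\mathcal P_i(\bar w_{[-i]})$ is $$\min\ \sum_{k=n_i^1}^{n_i^2-1}g_k(x_k,u_k)+\tilde g_{n_i^2}(x_{n_i^2};\bar w_{n_i^2})\quad\text{s.t. }x_{k+1}=f_k(x_k,u_k)\ (\lambda_k),\ n_i^1\le k\le n_i^2-1,\quad x_{n_i^1}=\bar x_{n_i^1}\ (\lambda_{n_i^1-1}),$$ where $\tilde g_{n_i^2}(x;\bar w_{n_i^2})=g_{n_i^2}(x,\bar u_{n_i^2})-\bar\lambda_{n_i^2}^Tf_{n_i^2}(x,\bar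 u_{n_i^2})+\frac\mu2\|x-\bar x_{n_i^2}\|^2$ for $i\in[T-2]$, and $\tilde g_N(x)=g_N(x)$ for $i=T-1$. **Norm.** $\|\cdot\|_w$ is the maximum, over all stages and over the state, control and dual components present, of the Euclidean norms of those components (e.g. $\|w\|_w=\max_{-1\le k\le N}\|w_k\|_w$ with $\|w_k\|_w=\|x_k\|\vee\|u_k\|\vee\|\lambda_k\|$). **Subproblem solutions and stagewise estimate.** $w^\dagger_{[i]}(w_{[-i]})$ denotes the primal-dual solution of $\mathcal P_i(w_{[-i]})$; for $\mu$ at least a threshold depending only on $(\Upsilon_{\text{upper}},\gamma_C,t)$ it exists, is unique and global for any boundary data. There are constants $\Upsilon>0$, $\rho\in(0,1)$, independent of $N$ and $i$, such that for any boundary data and all $k\in[n_i^1-1,n_i^2]$, $$\|T_k\{w^\dagger_{[i]}(\bar w_{[-i]})-w^\star_{[i]}\}\|_w\le\Upsilon\big\{\rho^{k-n_i^1}\|\bar x_{n_i^1}-x^\star_{n_i^1}\|+\rho^{n_i^2-k}\|\bar w_{n_i^2}-w^\star_{n_i^2}\|_w\big\}$$ (no second term for $i=T-1$). These are the $\Upsilon,\rho$ of the claim. **Overlapping Schwarz decomposition algorithm.** Given $w^{(0)}$, whose initial-state component matches the given initial state ($x_0^{(0)}=\bar x_0$), for $\ell=0,1,\dots$ and all $i\in[T-1]$ (in parallel) set $w^{(\ell+1)}_{(i)}=T_{(i)}\big(w^\dagger_{[i]}(w^{(\ell)}_{[-i]})\big)$; then $w^{(\ell+1)}=(w^{(\e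ll+1)}_{(0)};\dots;w^{(\ell+1)}_{(T-1)})$.
   Formalization: The overlap threshold and the constants Υ, ρ may depend on the penalty μ (no μ-independent threshold gives α<1), and any subproblem whose horizon is cut off at N keeps the terminal cost g_N, since the adjusted cost there would need the undefined g_N(x,u) and f_N. *)

theory Defs
  imports "HOL-Analysis.Analysis"
begin

text \<open>
  Stages are integers, so that the stage \<open>-1\<close> (which carries only the multiplier of the initial
  condition) is available. States, controls and multipliers are total functions of the stage;
  every notion below only looks at their values on the stages that are present in the problem
  at hand.
\<close>

section \<open>Optimal control problems and their primal-dual solutions\<close>

record ('nx, 'nu) pd_vec =
  st :: "int \<Rightarrow> real ^ 'nx"
  ct :: "int \<Rightarrow> real ^ 'nu"
  mult :: "int \<Rightarrow> real ^ 'nx"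

record ('nx, 'nu) ocp =
  first_stage :: int
  last_stage :: int
  running :: "int \<Rightarrow> real ^ 'nx \<Rightarrow> real ^ 'nu \<Rightarrow> real"
  terminal :: "real ^ 'nx \<Rightarrow> real"
  dynamics :: "int \<Rightarrow> real ^ 'nx \<Rightarrow> real ^ 'nu \<Rightarrow> real ^ 'nx"
  initial :: "real ^ 'nx"

definition objective ::
  "('nx::finite, 'nu::finite) ocp \<Rightarrow> (int \<Rightarrow> real ^ 'nx) \<Rightarrow> (int \<Rightarrow> real ^ 'nu) \<Rightarrow> real" where
  "objective P x u =
     (\<Sum>k\<in>{first_stage P..<last_stage P}. running P k (x k) (u k)) + terminal P (x (last_stage P))"

definition feasible ::
  "('nx::finite, 'nu::finite) ocp \<Rightarrow> (int \<Rightarrow> real ^ 'nx) \<Rightarrow> (int \<Rightarrow> real ^ 'nu) \<Rightarrow> bool" where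
  "feasible P x u \<longleftrightarrow>
     x (first_stage P) = initial P \<and>
     (\<forall>k\<in>{first_stage P..<last_stage P}. x (k + 1) = dynamics P k (x k) (u k))"

definition global_minimizer ::
  "('nx::finite, 'nu::finite) ocp \<Rightarrow> (int \<Rightarrow> real ^ 'nx) \<Rightarrow> (int \<Rightarrow> real ^ 'nu) \<Rightarrow> bool" where
  "global_minimizer P x u \<longleftrightarrow>
     feasible P x u \<and> (\<forall>y v. feasible P y v \<longrightarrow> objective P x u \<le> objective P y v)"

definition lagrangian ::
  "('nx::finite, 'nu::finite) ocp \<Rightarrow>
   (int \<Rightarrow> real ^ 'nx) \<Rightarrow> (int \<Rightarrow> real ^ 'nu) \<Rightarrow> (int \<Rightarrow> real ^ 'nx) \<Rightarrow> real" where
  "lagrangian P x u l =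
     objective P x u
     + (\<Sum>k\<in>{first_stage P..<last_stage P}. l k \<bullet> (x (k + 1) - dynamics P k (x k) (u k)))
     + l (first_stage P - 1) \<bullet> (x (first_stage P) - initial P)"

definition stationary :: "('nx::finite, 'nu::finite) ocp \<Rightarrow> ('nx, 'nu) pd_vec \<Rightarrow> bool" where
  "stationary P w \<longleftrightarrow>
     (\<forall>k\<in>{first_stage P..last_stage P}.
        ((\<lambda>\<xi>. lagrangian P ((st w)(k := \<xi>)) (ct w) (mult w)) has_derivative (\<lambda>_. 0))
          (at (st w k))) \<and>
     (\<forall>k\<in>{first_stage P..<last_stage P}.
        ((\<lambda>\<eta>. lagrangian P (st w) ((ct w)(k := \<eta>)) (mult w)) has_derivative (\<lambda>_. 0))
          (at (ct w k)))"

definition kkt_point :: "('nx::finite, 'nu::finite) ocp \<Rightarrow> ('nx, 'nu) pd_vec \<Rightarrow> bool" where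
  "kkt_point P w \<longleftrightarrow> feasible P (st w) (ct w) \<and> stationary P w"

definition pd_solution :: "('nx::finite, 'nu::finite) ocp \<Rightarrow> ('nx, 'nu) pd_vec \<Rightarrow> bool" where
  "pd_solution P w \<longleftrightarrow> kkt_point P w \<and> global_minimizer P (st w) (ct w)"

text \<open>
  Equality and norm of the stage-\<open>k\<close> parts, for the horizon \<open>a..b\<close> and \<open>a - 1 \<le> k \<le> b\<close>: stage
  \<open>a - 1\<close> consists of a multiplier only, stage \<open>b\<close> of a state only, and all other stages of
  state, control and multiplier.
\<close>

definition stage_eq ::
  "int \<Rightarrow> int \<Rightarrow> int \<Rightarrow> ('nx::finite, 'nu::finite) pd_vec \<Rightarrow> ('nx, 'nu) pd_vec \<Rightarrow> bool" where
  "stage_eq a b k w w' \<longleftrightarrow>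
     (a \<le> k \<longrightarrow> st w k = st w' k) \<and>
     (a \<le> k \<and> k < b \<longrightarrow> ct w k = ct w' k) \<and>
     (k < b \<longrightarrow> mult w k = mult w' k)"

definition stage_norm :: "int \<Rightarrow> int \<Rightarrow> int \<Rightarrow> ('nx::finite, 'nu::finite) pd_vec \<Rightarrow> real" where
  "stage_norm a b k w =
     (if k < a then norm (mult w k)
      else if k < b then max (norm (st w k)) (max (norm (ct w k)) (norm (mult w k)))
      else norm (st w k))"

definition w_norm :: "int \<Rightarrow> int \<Rightarrow> ('nx::finite, 'nu::finite) pd_vec \<Rightarrow> real" where
  "w_norm a b w = Max ((\<lambda>k. stage_norm a b k w) ` {a - 1..b})"

definition pd_diff ::
  "('nx::finite, 'nu::finite) pd_vec \<Rightarrow> ('nx, 'nu) pd_vec \<Rightarrow> ('nx, 'nu) pd_vec" where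
  "pd_diff w w' =
     \<lparr>st = (\<lambda>k. st w k - st w' k), ct = (\<lambda>k. ct w k - ct w' k), mult = (\<lambda>k. mult w k - mult w' k)\<rparr>"

definition unique_global_pd_solution ::
  "('nx::finite, 'nu::finite) ocp \<Rightarrow> ('nx, 'nu) pd_vec \<Rightarrow> bool" where
  "unique_global_pd_solution P w \<longleftrightarrow>
     pd_solution P w \<and>
     (\<forall>w'. kkt_point P w' \<longrightarrow>
        (\<forall>k\<in>{first_stage P - 1..last_stage P}. stage_eq (first_stage P) (last_stage P) k w' w))"


section \<open>The linear-quadratic problem\<close>

record ('nx, 'nu) lq_data =
  Qm :: "int \<Rightarrow> real ^ 'nx ^ 'nx"
  Sm :: "int \<Rightarrow> real ^ 'nx ^ 'nu"
  Rm :: "int \<Rightarrow> real ^ 'nu ^ 'nu"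
  rv :: "int \<Rightarrow> real ^ 'nx"
  sv :: "int \<Rightarrow> real ^ 'nu"
  Am :: "int \<Rightarrow> real ^ 'nx ^ 'nx"
  Bm :: "int \<Rightarrow> real ^ 'nu ^ 'nx"
  vv :: "int \<Rightarrow> real ^ 'nx"
  xinit :: "real ^ 'nx"

text \<open>The block matrix \<open>H\<^sub>k\<close>, acting on pairs \<open>(x, u)\<close>; the norm of the product type is Euclidean.\<close>

definition hess ::
  "('nx::finite, 'nu::finite) lq_data \<Rightarrow> int \<Rightarrow>
   (real ^ 'nx) \<times> (real ^ 'nu) \<Rightarrow> (real ^ 'nx) \<times> (real ^ 'nu)" where
  "hess p k z =
     (Qm p k *v fst z + transpose (Sm p k) *v snd z, Sm p k *v fst z + Rm p k *v snd z)"

definition lq_cost ::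
  "('nx::finite, 'nu::finite) lq_data \<Rightarrow> int \<Rightarrow> real ^ 'nx \<Rightarrow> real ^ 'nu \<Rightarrow> real" where
  "lq_cost p k x u = (x, u) \<bullet> hess p k (x, u) + (rv p k, sv p k) \<bullet> (x, u)"

definition lq_terminal :: "('nx::finite, 'nu::finite) lq_data \<Rightarrow> int \<Rightarrow> real ^ 'nx \<Rightarrow> real" where
  "lq_terminal p N x = x \<bullet> (Qm p N *v x) + rv p N \<bullet> x"

definition lq_dyn ::
  "('nx::finite, 'nu::finite) lq_data \<Rightarrow> int \<Rightarrow> real ^ 'nx \<Rightarrow> real ^ 'nu \<Rightarrow> real ^ 'nx" where
  "lq_dyn p k x u = Am p k *v x + Bm p k *v u + vv p k"

definition full_problem :: "('nx::finite, 'nu::finite) lq_data \<Rightarrow> int \<Rightarrow> ('nx, 'nu) ocp" where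
  "full_problem p N =
     \<lparr>first_stage = 0, last_stage = N, running = lq_cost p, terminal = lq_terminal p N,
      dynamics = lq_dyn p, initial = xinit p\<rparr>"


section \<open>Uniform second-order sufficiency, boundedness and controllability\<close>

definition null_traj ::
  "('nx::finite, 'nu::finite) lq_data \<Rightarrow> int \<Rightarrow> (int \<Rightarrow> real ^ 'nx) \<times> (int \<Rightarrow> real ^ 'nu) \<Rightarrow> bool" where
  "null_traj p N z \<longleftrightarrow>
     fst z 0 = 0 \<and> (\<forall>k\<in>{0..<N}. fst z (k + 1) = Am p k *v fst z k + Bm p k *v snd z k)"

text \<open>\<open>z\<^sup>T z'\<close> and \<open>z\<^sup>T H z'\<close> for the stacked vectors \<open>z = (x\<^sub>0; u\<^sub>0; \<dots>; x\<^sub>N)\<close>.\<close>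

definition traj_inner ::
  "int \<Rightarrow> (int \<Rightarrow> real ^ 'nx::finite) \<times> (int \<Rightarrow> real ^ 'nu::finite) \<Rightarrow>
   (int \<Rightarrow> real ^ 'nx) \<times> (int \<Rightarrow> real ^ 'nu) \<Rightarrow> real" where
  "traj_inner N z z' =
     (\<Sum>k\<in>{0..<N}. (fst z k, snd z k) \<bullet> (fst z' k, snd z' k)) + fst z N \<bullet> fst z' N"

definition traj_hess ::
  "('nx::finite, 'nu::finite) lq_data \<Rightarrow> int \<Rightarrow> (int \<Rightarrow> real ^ 'nx) \<times> (int \<Rightarrow> real ^ 'nu) \<Rightarrow>
   (int \<Rightarrow> real ^ 'nx) \<times> (int \<Rightarrow> real ^ 'nu) \<Rightarrow> real" where
  "traj_hess p N z z' =
     (\<Sum>k\<in>{0..<N}. (fst z k, snd z k) \<bullet> hess p k (fst z' k, snd z' k))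
     + fst z N \<bullet> (Qm p N *v fst z' N)"

text \<open>\<open>Z 0, \<dots>, Z (d - 1)\<close> are the columns of a matrix \<open>Z\<close> whose columns form an orthonormal basis
  of the null space of the constraint Jacobian.\<close>

definition orthonormal_null_basis ::
  "('nx::finite, 'nu::finite) lq_data \<Rightarrow> int \<Rightarrow> nat \<Rightarrow>
   (nat \<Rightarrow> (int \<Rightarrow> real ^ 'nx) \<times> (int \<Rightarrow> real ^ 'nu)) \<Rightarrow> bool" where
  "orthonormal_null_basis p N d Z \<longleftrightarrow>
     (\<forall>i<d. null_traj p N (Z i)) \<and>
     (\<forall>i<d. \<forall>j<d. traj_inner N (Z i) (Z j) = (if i = j then 1 else 0)) \<and>
     (\<forall>z. null_traj p N z \<longrightarrow>
        (\<exists>c. (\<forall>k\<in>{0..N}. fst z k = (\<Sum>j<d. c j *\<^sub>R fst (Z j) k)) \<and>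
             (\<forall>k\<in>{0..<N}. snd z k = (\<Sum>j<d. c j *\<^sub>R snd (Z j) k))))"

text \<open>The entries of \<open>Z\<^sup>T H Z\<close> are \<open>traj_hess p N (Z i) (Z j)\<close>.\<close>

definition uniform_sosc :: "('nx::finite, 'nu::finite) lq_data \<Rightarrow> int \<Rightarrow> real \<Rightarrow> bool" where
  "uniform_sosc p N \<gamma> \<longleftrightarrow>
     (\<exists>d Z. orthonormal_null_basis p N d Z \<and>
        (\<forall>c :: nat \<Rightarrow> real.
           \<gamma> * (\<Sum>i<d. (c i)\<^sup>2) \<le> (\<Sum>i<d. \<Sum>j<d. c i * traj_hess p N (Z i) (Z j) * c j)))"

definition uniform_bound :: "('nx::finite, 'nu::finite) lq_data \<Rightarrow> int \<Rightarrow> real \<Rightarrow> bool" where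
  "uniform_bound p N C \<longleftrightarrow>
     (\<forall>k\<in>{0..<N}.
        max (onorm (hess p k)) (max (onorm ((*v) (Am p k))) (onorm ((*v) (Bm p k)))) \<le> C) \<and>
     onorm ((*v) (Qm p N)) \<le> C"

definition psd :: "real ^ 'n::finite ^ 'n \<Rightarrow> bool" where
  "psd M \<longleftrightarrow> transpose M = M \<and> (\<forall>v. 0 \<le> v \<bullet> (M *v v))"

text \<open>\<open>transition p k s\<close> is \<open>A\<^bsub>k+s-1\<^esub> \<cdots> A\<^sub>k\<close>.\<close>

primrec transition ::
  "('nx::finite, 'nu::finite) lq_data \<Rightarrow> int \<Rightarrow> nat \<Rightarrow> real ^ 'nx ^ 'nx" where
  "transition p k 0 = mat 1"
| "transition p k (Suc s) = Am p (k + int s) ** transition p k s"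

text \<open>The blocks \<open>A\<^bsub>k+s-1\<^esub> \<cdots> A\<^bsub>k+s-j\<^esub> B\<^bsub>k+s-1-j\<^esub>\<close>, \<open>j < s\<close>, of the controllability matrix \<open>\<Xi>\<close>,
  and \<open>\<Xi> \<Xi>\<^sup>T\<close> computed blockwise.\<close>

definition ctrb_block ::
  "('nx::finite, 'nu::finite) lq_data \<Rightarrow> int \<Rightarrow> nat \<Rightarrow> nat \<Rightarrow> real ^ 'nu ^ 'nx" where
  "ctrb_block p k s j =
     transition p (k + int s - int j) j ** Bm p (k + int s - 1 - int j)"

definition ctrb_gram ::
  "('nx::finite, 'nu::finite) lq_data \<Rightarrow> int \<Rightarrow> nat \<Rightarrow> real ^ 'nx ^ 'nx" where
  "ctrb_gram p k s = (\<Sum>j<s. ctrb_block p k s j ** transpose (ctrb_block p k s j))"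

definition uniform_controllability ::
  "('nx::finite, 'nu::finite) lq_data \<Rightarrow> int \<Rightarrow> nat \<Rightarrow> real \<Rightarrow> bool" where
  "uniform_controllability p N t \<gamma> \<longleftrightarrow>
     (\<forall>k\<in>{0..N - int t}. \<exists>s\<in>{1..t}. psd (ctrb_gram p k s - \<gamma> *\<^sub>R mat 1))"

definition lq_conditions ::
  "('nx::finite, 'nu::finite) lq_data \<Rightarrow> int \<Rightarrow> real \<Rightarrow> real \<Rightarrow> nat \<Rightarrow> real \<Rightarrow> bool" where
  "lq_conditions p N \<gamma>H \<gamma>C t \<Upsilon>upper \<longleftrightarrow>
     (\<forall>k\<in>{0..N}. transpose (Qm p k) = Qm p k) \<and>
     (\<forall>k\<in>{0..<N}. transpose (Rm p k) = Rm p k) \<and>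
     uniform_sosc p N \<gamma>H \<and> uniform_bound p N \<Upsilon>upper \<and> uniform_controllability p N t \<gamma>C"


section \<open>The overlapping Schwarz decomposition\<close>

definition decomposition :: "int \<Rightarrow> nat \<Rightarrow> (nat \<Rightarrow> int) \<Rightarrow> bool" where
  "decomposition N T m \<longleftrightarrow> 1 \<le> T \<and> m 0 = 0 \<and> m T = N \<and> (\<forall>i<T. m i < m (Suc i))"

definition n1 :: "(nat \<Rightarrow> int) \<Rightarrow> nat \<Rightarrow> nat \<Rightarrow> int" where
  "n1 m \<tau> i = max (m i - int \<tau>) 0"

definition n2 :: "int \<Rightarrow> (nat \<Rightarrow> int) \<Rightarrow> nat \<Rightarrow> nat \<Rightarrow> int" where
  "n2 N m \<tau> i = min (m (Suc i) + int \<tau>) N"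

text \<open>
  The adjusted terminal cost. A subproblem whose horizon ends at \<open>N\<close> keeps the original terminal
  cost \<open>g\<^sub>N\<close>; besides the last subproblem this concerns the subproblems whose horizon is cut off
  at \<open>N\<close>. The boundary data are read off a full primal-dual vector \<open>wb\<close>.
\<close>

definition sub_terminal ::
  "('nx::finite, 'nu::finite) lq_data \<Rightarrow> int \<Rightarrow> real \<Rightarrow> int \<Rightarrow> ('nx, 'nu) pd_vec \<Rightarrow> real ^ 'nx \<Rightarrow> real" where
  "sub_terminal p N \<mu> n wb x =
     (if n = N then lq_terminal p N x
      else lq_cost p n x (ct wb n) - mult wb n \<bullet> lq_dyn p n x (ct wb n)
           + \<mu> / 2 * (norm (x - st wb n))\<^sup>2)"

definition subproblem ::
  "('nx::finite, 'nu::finite) lq_data \<Rightarrow> int \<Rightarrow> (nat \<Rightarrow> int) \<Rightarrow> nat \<Rightarrow> real \<Rightarrow> nat \<Rightarrow>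
   ('nx, 'nu) pd_vec \<Rightarrow> ('nx, 'nu) ocp" where
  "subproblem p N m \<tau> \<mu> i wb =
     \<lparr>first_stage = n1 m \<tau> i, last_stage = n2 N m \<tau> i, running = lq_cost p,
      terminal = sub_terminal p N \<mu> (n2 N m \<tau> i) wb, dynamics = lq_dyn p,
      initial = st wb (n1 m \<tau> i)\<rparr>"

text \<open>The stagewise estimate relative to a primal-dual vector \<open>ws\<close>. For \<open>k = n1 - 1\<close> the first
  exponent is \<open>-1\<close>. If the horizon ends at \<open>N\<close> there are no terminal boundary data.\<close>

definition stagewise_estimate ::
  "('nx::finite, 'nu::finite) lq_data \<Rightarrow> int \<Rightarrow> nat \<Rightarrow> (nat \<Rightarrow> int) \<Rightarrow> nat \<Rightarrow> real \<Rightarrow>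
   real \<Rightarrow> real \<Rightarrow> ('nx, 'nu) pd_vec \<Rightarrow> bool" where
  "stagewise_estimate p N T m \<tau> \<mu> \<Upsilon> \<rho> ws \<longleftrightarrow>
     (\<forall>i<T. \<forall>wb y. pd_solution (subproblem p N m \<tau> \<mu> i wb) y \<longrightarrow>
        (let a = n1 m \<tau> i; b = n2 N m \<tau> i in
         \<forall>k\<in>{a - 1..b}.
           stage_norm a b k (pd_diff y ws)
             \<le> \<Upsilon> * (\<rho> powi (k - a) * norm (st wb a - st ws a)
                      + (if b = N then 0
                         else \<rho> powi (b - k) * stage_norm 0 N b (pd_diff wb ws)))))"

definition own_stages :: "int \<Rightarrow> nat \<Rightarrow> (nat \<Rightarrow> int) \<Rightarrow> nat \<Rightarrow> int set" where
  "own_stages N T m i =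
     {m i..<m (Suc i)} \<union> (if i = 0 then {-1} else {}) \<union> (if i = T - 1 then {N} else {})"

definition schwarz_iterates ::
  "('nx::finite, 'nu::finite) lq_data \<Rightarrow> int \<Rightarrow> nat \<Rightarrow> (nat \<Rightarrow> int) \<Rightarrow> nat \<Rightarrow> real \<Rightarrow>
   (nat \<Rightarrow> ('nx, 'nu) pd_vec) \<Rightarrow> bool" where
  "schwarz_iterates p N T m \<tau> \<mu> w \<longleftrightarrow>
     st (w 0) 0 = xinit p \<and>
     (\<forall>l. \<forall>i<T. \<exists>y. pd_solution (subproblem p N m \<tau> \<mu> i (w l)) y \<and>
        (\<forall>k\<in>own_stages N T m i. stage_eq 0 N k (w (Suc l)) y))"

end

theory Submission
  imports Defs
begin

text \<open>
  By controllability every state can be steered to rest within \<open>t\<close> stages at a cost comparable to its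
  squared norm (near the end of the horizon, where this is not available, at most \<open>t\<close> uncontrolled
  stages remain). Extending a trajectory of a subproblem in this way to the full horizon shows that, for
  \<open>\<mu>\<close> large, the subproblems inherit the second-order condition with the same constant. Existence of
  solutions follows from the Riccati recursion, uniqueness from the sensitivity estimate.

  The difference of two solutions satisfies the homogeneous optimality system, forced by the initial state
  or by the terminal data. With initial forcing only, testing the system with the difference between the
  solution and a steering trajectory from stage \<open>j\<close> gives \<open>E\<^sub>j \<le> const \<cdot> \<parallel>x\<^sub>j\<parallel>\<^sup>2 \<le> const \<cdot> (E\<^sub>j - E\<^bsub>j+1\<^esub>)\<close>
  for the tail energy \<open>E\<^sub>j\<close>. With terminal forcing only, testing with the solution truncated by steering to
  rest gives \<open>F\<^sub>j \<le> const \<cdot> (F\<^bsub>j+t\<^esub> - F\<^sub>j)\<close> for the energy \<open>F\<^sub>j\<close> up to stage \<open>j\<close>. Both energies therefore decay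
  geometrically, and the multiplier \<open>\<lambda>\<^bsub>j-1\<^esub>\<close> is bounded by testing with a trajectory starting at \<open>\<lambda>\<^bsub>j-1\<^esub>\<close>.
  The own stages of a subproblem are \<open>\<tau>\<close> away from both ends of its horizon, so each Schwarz sweep
  contracts the error by \<open>2 \<Upsilon> \<rho>\<^sup>\<tau>\<close>.
\<close>

section \<open>Trajectories, quadratic forms and summation by parts\<close>

text \<open>Stage costs may be indefinite: positivity is available only for a whole trajectory that
  starts at zero and runs to the end of its window. The form on part of a window bounds nothing by
  itself, so every energy estimate must first produce an admissible trajectory; steering serves to
  correct either end, and all tests go through the single identity \<open>adjoint_weak_form\<close>.
  The two energies lose mass at different speeds. The tail bound involves one state, which leaves
  the tail after one stage; truncation spends t stages on reaching rest. Hence one decay is per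
  stage and the other per t stages. A common \<rho> serves both, and its square appears because
  energies are squared norms. N enters no constant: the steering cost \<open>K\<close> comes from at
  most t stages of bounded dynamics, and later constants are built from \<open>K\<close>, C, \<mu>,
  \<gamma> and t. The exact solution can be compared with subproblem solutions because its
  restriction to a window solves the subproblem with exact boundary data
  (\<open>full_kkt_window\<close>).\<close>

lemma sum_int_split:
  fixes f :: "int \<Rightarrow> 'b::comm_monoid_add"
  assumes "a \<le> j" "j \<le> b"
  shows "sum f {a..<b} = sum f {a..<j} + sum f {j..<b}"
proof -
  have "{a..<b} = {a..<j} \<union> {j..<b}" using assms by auto
  then show ?thesis by (simp add: sum.union_disjoint)
qed

lemma sum_int_first:
  fixes f :: "int \<Rightarrow> 'b::comm_monoid_add"
  assumes "a < b"
  shows "sum f {a..<b} = f a + sum f {a + 1..<b}"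
proof -
  have "{a..<a + 1} = {a}" by auto
  with sum_int_split[of a "a + 1" b f] assms show ?thesis by simp
qed

lemma sum_int_last:
  fixes f :: "int \<Rightarrow> 'b::comm_monoid_add"
  assumes "a \<le> b"
  shows "sum f {a..<b + 1} = sum f {a..<b} + f b"
proof -
  have "{b..<b + 1} = {b}" by auto
  with sum_int_split[of a b "b + 1" f] assms show ?thesis by simp
qed

lemma inner_transpose:
  fixes A :: "real ^ 'n::finite ^ 'm::finite"
  shows "(transpose A *v x) \<bullet> y = x \<bullet> (A *v y)"
  by (simp add: transpose_matrix_vector dot_lmul_matrix)

lemma inner_symmetric_matrix:
  fixes A :: "real ^ 'n::finite ^ 'n"
  assumes "transpose A = A"
  shows "(A *v x) \<bullet> y = x \<bullet> (A *v y)"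
  using inner_transpose[of A x y] assms by simp

lemma norm_Pair_sq: "(norm (x, u))\<^sup>2 = (norm x)\<^sup>2 + (norm u)\<^sup>2"
  by (simp add: norm_Pair)

lemma hess_add: "hess p k (x + y, u + v) = hess p k (x, u) + hess p k (y, v)"
  by (simp add: hess_def matrix_vector_right_distrib)

lemma hess_diff: "hess p k (x - y, u - v) = hess p k (x, u) - hess p k (y, v)"
  by (simp add: hess_def matrix_vector_mult_diff_distrib)

lemma hess_zero [simp]: "hess p k 0 = 0"
  by (simp add: hess_def zero_prod_def)

lemma hess_scaleR: "hess p k (c *\<^sub>R x, c *\<^sub>R u) = c *\<^sub>R hess p k (x, u)"
  by (simp add: hess_def matrix_vector_mult_scaleR scaleR_right_distrib)

lemma linear_hess: "linear (hess p k)"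
proof (rule linearI)
  fix z z' show "hess p k (z + z') = hess p k z + hess p k z'"
    using hess_add[of p k "fst z" "fst z'" "snd z" "snd z'"] by (simp flip: plus_prod_def)
next
  fix c z show "hess p k (c *\<^sub>R z) = c *\<^sub>R hess p k z"
    using hess_scaleR[of p k c "fst z" "snd z"] by (simp flip: scaleR_prod_def)
qed

section \<open>Symmetric data and self-adjoint maps\<close>

definition sym_data :: "('nx::finite, 'nu::finite) lq_data \<Rightarrow> int \<Rightarrow> int \<Rightarrow> bool" where
  "sym_data p a b \<longleftrightarrow>
     (\<forall>k\<in>{a..<b}. transpose (Qm p k) = Qm p k \<and> transpose (Rm p k) = Rm p k)"

text \<open>Hessians of terminal costs are kept as functions, so that \<open>Qm\<close>, its
  penalised variant and the Riccati iterates are treated alike; linearity is a consequence.\<close>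

definition self_adjoint :: "('a::real_inner \<Rightarrow> 'a) \<Rightarrow> bool" where
  "self_adjoint M \<longleftrightarrow> (\<forall>x y. M x \<bullet> y = x \<bullet> M y)"

lemma self_adjointD: "self_adjoint M \<Longrightarrow> M x \<bullet> y = x \<bullet> M y"
  by (simp add: self_adjoint_def)

lemma self_adjoint_linear:
  assumes "self_adjoint M" shows "linear M"
proof (rule linearI)
  fix x y
  have "(M (x + y) - (M x + M y)) \<bullet> z = 0" for z
    by (simp add: self_adjointD[OF assms] inner_diff_left inner_add_left)
  then have "M (x + y) - (M x + M y) = 0" by (metis inner_eq_zero_iff)
  then show "M (x + y) = M x + M y" by simp
next
  fix c :: real and x
  have "(M (c *\<^sub>R x) - c *\<^sub>R M x) \<bullet> z = 0" for z
    by (simp add: self_adjointD[OF assms] inner_diff_left)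
  then have "M (c *\<^sub>R x) - c *\<^sub>R M x = 0" by (metis inner_eq_zero_iff)
  then show "M (c *\<^sub>R x) = c *\<^sub>R M x" by simp
qed

lemma hess_self_adjoint:
  assumes "transpose (Qm p k) = Qm p k" "transpose (Rm p k) = Rm p k"
  shows "self_adjoint (hess p k)"
  unfolding self_adjoint_def
proof (intro allI)
  fix y z :: "(real ^ 'a) \<times> (real ^ 'b)"
  have S: "(transpose (Sm p k) *v u) \<bullet> x = u \<bullet> (Sm p k *v x)" for u x by (rule inner_transpose)
  have S': "x \<bullet> (transpose (Sm p k) *v u) = (Sm p k *v x) \<bullet> u" for u x
    using S by (metis inner_commute)
  show "hess p k y \<bullet> z = y \<bullet> hess p k z"
    unfolding hess_def inner_prod_def fst_conv snd_conv inner_add_left inner_add_right S S'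
      inner_symmetric_matrix[OF assms(1)] inner_symmetric_matrix[OF assms(2)]
    by simp
qed

section \<open>Homogeneous trajectories, energies and the adjoint system\<close>

definition traj ::
  "('nx::finite, 'nu::finite) lq_data \<Rightarrow> int \<Rightarrow> int \<Rightarrow> (int \<Rightarrow> real ^ 'nx) \<Rightarrow> (int \<Rightarrow> real ^ 'nu) \<Rightarrow> bool"
  where "traj p a b x u \<longleftrightarrow> (\<forall>k\<in>{a..<b}. x (k + 1) = Am p k *v x k + Bm p k *v u k)"

definition energy :: "int \<Rightarrow> int \<Rightarrow> (int \<Rightarrow> real ^ 'nx::finite) \<Rightarrow> (int \<Rightarrow> real ^ 'nu::finite) \<Rightarrow> real"
  where "energy a b x u = (\<Sum>k\<in>{a..<b}. (norm (x k))\<^sup>2 + (norm (u k))\<^sup>2)"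

definition run_form ::
  "('nx::finite, 'nu::finite) lq_data \<Rightarrow> int \<Rightarrow> int \<Rightarrow> (int \<Rightarrow> real ^ 'nx) \<Rightarrow> (int \<Rightarrow> real ^ 'nu) \<Rightarrow>
   (int \<Rightarrow> real ^ 'nx) \<Rightarrow> (int \<Rightarrow> real ^ 'nu) \<Rightarrow> real"
  where "run_form p a b x u y v = (\<Sum>k\<in>{a..<b}. hess p k (x k, u k) \<bullet> (y k, v k))"

text \<open>The second-order condition in basis-free form: a lower bound on the reduced Hessian over
  the null space of the constraint Jacobian of the window. The form carries the full Hessian,
  without a factor 1/2, matching the costs; gradients therefore carry a factor 2.\<close>

definition coercive ::
  "('nx::finite, 'nu::finite) lq_data \<Rightarrow> int \<Rightarrow> int \<Rightarrow> (real ^ 'nx \<Rightarrow> real ^ 'nx) \<Rightarrow> real \<Rightarrow> bool" where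
  "coercive p a b M \<gamma> \<longleftrightarrow>
     (\<forall>x u. x a = 0 \<longrightarrow> traj p a b x u \<longrightarrow>
        \<gamma> * (energy a b x u + (norm (x b))\<^sup>2) \<le> run_form p a b x u x u + M (x b) \<bullet> x b)"

text \<open>Vanishing of the gradient of the Lagrangian of a problem on the stages \<open>a..b\<close> with linear
  running costs \<open>r, s\<close> and terminal cost \<open>x\<^sup>T M x + c\<^sup>T x\<close>.\<close>

definition adjoint_eqs ::
  "('nx::finite, 'nu::finite) lq_data \<Rightarrow> int \<Rightarrow> int \<Rightarrow> (int \<Rightarrow> real ^ 'nx) \<Rightarrow> (int \<Rightarrow> real ^ 'nu) \<Rightarrow>
   (real ^ 'nx \<Rightarrow> real ^ 'nx) \<Rightarrow> real ^ 'nx \<Rightarrow>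
   (int \<Rightarrow> real ^ 'nx) \<Rightarrow> (int \<Rightarrow> real ^ 'nu) \<Rightarrow> (int \<Rightarrow> real ^ 'nx) \<Rightarrow> bool" where
  "adjoint_eqs p a b r s M c x u l \<longleftrightarrow>
     (\<forall>k\<in>{a..<b}.
        2 *\<^sub>R fst (hess p k (x k, u k)) + r k + l (k - 1) - transpose (Am p k) *v l k = 0 \<and>
        2 *\<^sub>R snd (hess p k (x k, u k)) + s k - transpose (Bm p k) *v l k = 0) \<and>
     2 *\<^sub>R M (x b) + c + l (b - 1) = 0"

lemma traj_mono: "traj p a b x u \<Longrightarrow> a \<le> i \<Longrightarrow> j \<le> b \<Longrightarrow> traj p i j x u"
  by (simp add: traj_def)

lemma traj_diff: "traj p a b x u \<Longrightarrow> traj p a b y v \<Longrightarrow> traj p a b (\<lambda>k. x k - y k) (\<lambda>k. u k - v k)"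
  by (simp add: traj_def matrix_vector_mult_diff_distrib algebra_simps)

lemma adjoint_eqs_mono: "adjoint_eqs p a b r s M c x u l \<Longrightarrow> a \<le> j \<Longrightarrow> adjoint_eqs p j b r s M c x u l"
  by (simp add: adjoint_eqs_def)

lemma adjoint_eqs_diff:
  assumes "linear M" "adjoint_eqs p a b r s M c x u l" "adjoint_eqs p a b r s M c' x' u' l'"
  shows "adjoint_eqs p a b (\<lambda>_. 0) (\<lambda>_. 0) M (c - c')
    (\<lambda>k. x k - x' k) (\<lambda>k. u k - u' k) (\<lambda>k. l k - l' k)"
  unfolding adjoint_eqs_def
proof (intro conjI ballI)
  fix k assume k: "k \<in> {a..<b}"
  have e: "2 *\<^sub>R fst (hess p k (x k, u k)) + r k + l (k - 1) - transpose (Am p k) *v l k = 0"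
    "2 *\<^sub>R fst (hess p k (x' k, u' k)) + r k + l' (k - 1) - transpose (Am p k) *v l' k = 0"
    "2 *\<^sub>R snd (hess p k (x k, u k)) + s k - transpose (Bm p k) *v l k = 0"
    "2 *\<^sub>R snd (hess p k (x' k, u' k)) + s k - transpose (Bm p k) *v l' k = 0"
    using assms(2,3) k unfolding adjoint_eqs_def by blast+
  from arg_cong2[where f = "(-)", OF e(1,2)]
  show "2 *\<^sub>R fst (hess p k (x k - x' k, u k - u' k)) + 0 + (l (k - 1) - l' (k - 1))
      - transpose (Am p k) *v (l k - l' k) = 0"
    by (simp add: hess_diff matrix_vector_mult_diff_distrib algebra_simps)
  from arg_cong2[where f = "(-)", OF e(3,4)]
  show "2 *\<^sub>R snd (hess p k (x k - x' k, u k - u' k)) + 0 - transpose (Bm p k) *v (l k - l' k) = 0"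
    by (simp add: hess_diff matrix_vector_mult_diff_distrib algebra_simps)
next
  have "2 *\<^sub>R M (x b) + c + l (b - 1) = 0" "2 *\<^sub>R M (x' b) + c' + l' (b - 1) = 0"
    using assms(2,3) unfolding adjoint_eqs_def by blast+
  from arg_cong2[where f = "(-)", OF this]
  show "2 *\<^sub>R M (x b - x' b) + (c - c') + (l (b - 1) - l' (b - 1)) = 0"
    by (simp add: linear_diff[OF assms(1)] algebra_simps)
qed

lemma energy_nonneg: "0 \<le> energy a b x u"
  by (auto simp: energy_def intro!: sum_nonneg)

lemma energy_split: "a \<le> j \<Longrightarrow> j \<le> b \<Longrightarrow> energy a b x u = energy a j x u + energy j b x u"
  unfolding energy_def by (rule sum_int_split)

lemma energy_first: "a < b \<Longrightarrow> energy a b x u = (norm (x a))\<^sup>2 + (norm (u a))\<^sup>2 + energy (a + 1) b x u"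
  unfolding energy_def by (subst sum_int_first) auto

lemma energy_last: "a \<le> b \<Longrightarrow> energy a (b + 1) x u = energy a b x u + ((norm (x b))\<^sup>2 + (norm (u b))\<^sup>2)"
  unfolding energy_def by (rule sum_int_last)

lemma energy_ge:
  assumes "k \<in> {a..<b}" shows "(norm (x k))\<^sup>2 + (norm (u k))\<^sup>2 \<le> energy a b x u"
  unfolding energy_def by (rule member_le_sum[OF assms]) auto

lemma energy_mono:
  assumes "a \<le> i" "j \<le> b" shows "energy i j x u \<le> energy a b x u"
  unfolding energy_def using assms by (intro sum_mono2) auto

lemma energy_cong:
  assumes "\<And>k. k \<in> {a..<b} \<Longrightarrow> x k = y k" "\<And>k. k \<in> {a..<b} \<Longrightarrow> u k = v k"
  shows "energy a b x u = energy a b y v"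
  unfolding energy_def using assms by simp

lemma run_form_split: "a \<le> j \<Longrightarrow> j \<le> b \<Longrightarrow>
    run_form p a b x u y v = run_form p a j x u y v + run_form p j b x u y v"
  unfolding run_form_def by (rule sum_int_split)

lemma run_form_cong:
  assumes "\<And>k. k \<in> {a..<b} \<Longrightarrow> hess p k (x k, u k) \<bullet> (y k, v k) = hess p k (x' k, u' k) \<bullet> (y' k, v' k)"
  shows "run_form p a b x u y v = run_form p a b x' u' y' v'"
  unfolding run_form_def using assms by simp

lemma run_form_diff_left: "run_form p a b (\<lambda>k. x k - x' k) (\<lambda>k. u k - u' k) y v
   = run_form p a b x u y v - run_form p a b x' u' y v"
  by (simp add: run_form_def hess_diff inner_diff_left sum_subtractf)

lemma run_form_zero:
  assumes "\<And>k. k \<in> {a..<b} \<Longrightarrow> x k = 0 \<and> u k = 0 \<or> y k = 0 \<and> v k = 0"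
  shows "run_form p a b x u y v = 0"
  unfolding run_form_def
proof (rule sum.neutral, rule ballI)
  fix k assume "k \<in> {a..<b}"
  from assms[OF this] show "hess p k (x k, u k) \<bullet> (y k, v k) = 0"
    by (auto simp flip: zero_prod_def)
qed

text \<open>A trajectory that is zero at \<open>j\<close> extends to the left by rest, which adds
  neither energy nor cost.\<close>

lemma coercive_mono:
  assumes "coercive p a b M \<gamma>" "a \<le> j" "j \<le> b" "0 \<le> \<gamma>"
  shows "coercive p j b M \<gamma>"
  unfolding coercive_def
proof (intro allI impI)
  fix x u assume x: "x j = 0" "traj p j b x u"
  define y where "y k = (if k < j then 0 else x k)" for k
  define v where "v k = (if k < j then 0 else u k)" for k
  have "traj p a b y v"
    unfolding traj_def
  proof
    fix k assume k: "k \<in> {a..<b}"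
    consider "k + 1 < j" | "k + 1 = j" | "j \<le> k" by linarith
    then show "y (k + 1) = Am p k *v y k + Bm p k *v v k"
      using x k by cases (auto simp: y_def v_def traj_def)
  qed
  moreover have "y a = 0" using x assms by (auto simp: y_def)
  ultimately have *: "\<gamma> * (energy a b y v + (norm (y b))\<^sup>2) \<le> run_form p a b y v y v + M (y b) \<bullet> y b"
    using assms(1) unfolding coercive_def by blast
  have "energy a b y v = energy a j y v + energy j b y v"
    using assms by (intro energy_split) auto
  also have "energy j b y v = energy j b x u"
    by (intro energy_cong) (auto simp: y_def v_def)
  finally have 1: "energy j b x u \<le> energy a b y v" using energy_nonneg[of a j y v] by linarith
  have "run_form p a b y v y v = run_form p a j y v y v + run_form p j b y v y v"
    using assms by (intro run_form_split) auto
  also have "run_form p a j y v y v = 0"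
    by (intro run_form_zero) (auto simp: y_def v_def)
  also have "run_form p j b y v y v = run_form p j b x u x u"
    by (intro run_form_cong) (auto simp: y_def v_def)
  finally have 2: "run_form p a b y v y v = run_form p j b x u x u" by simp
  have 3: "y b = x b" using assms by (simp add: y_def)
  have "\<gamma> * (energy j b x u + (norm (x b))\<^sup>2) \<le> \<gamma> * (energy a b y v + (norm (y b))\<^sup>2)"
    using 1 3 assms(4) by (intro mult_left_mono) auto
  with * 2 3 show "\<gamma> * (energy j b x u + (norm (x b))\<^sup>2) \<le> run_form p j b x u x u + M (x b) \<bullet> x b"
    by simp
qed

text \<open>Summation by parts. Pairing the equations of stage \<open>k\<close> with
  \<open>(y k, v k)\<close> turns the transposed matrices into
  \<open>l k \<bullet> y (k + 1)\<close>, which cancels against the multiplier term of the next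
  stage; only the term at \<open>j\<close> survives. The initial value of \<open>y\<close> is free:
  zero isolates the form, a prescribed value isolates a multiplier.\<close>

lemma adjoint_weak_form:
  assumes "j \<le> b" "adjoint_eqs p j b r s M c x u l" "traj p j b y v"
  shows "2 * (run_form p j b x u y v + M (x b) \<bullet> y b) + (\<Sum>k\<in>{j..<b}. r k \<bullet> y k + s k \<bullet> v k)
     + c \<bullet> y b + l (j - 1) \<bullet> y j = 0"
  using assms
proof (induction j rule: int_le_induct)
  case base
  then have "(2 *\<^sub>R M (x b) + c + l (b - 1)) \<bullet> y b = 0" by (simp add: adjoint_eqs_def)
  then show ?case by (simp add: run_form_def inner_add_left)
next
  case (step i)
  let ?k = "i - 1"
  have k: "?k \<in> {?k..<b}" using step.hyps by auto
  have IH: "2 * (run_form p i b x u y v + M (x b) \<bullet> y b) + (\<Sum>k\<in>{i..<b}. r k \<bullet> y k + s k \<bullet> v k)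
     + c \<bullet> y b + l ?k \<bullet> y i = 0"
    using step.prems by (intro step.IH) (auto intro: adjoint_eqs_mono traj_mono)
  have "2 *\<^sub>R fst (hess p ?k (x ?k, u ?k)) + r ?k + l (?k - 1) = transpose (Am p ?k) *v l ?k"
    using step.prems(1) k unfolding adjoint_eqs_def by fastforce
  then have 1: "2 * (fst (hess p ?k (x ?k, u ?k)) \<bullet> y ?k) + r ?k \<bullet> y ?k + l (?k - 1) \<bullet> y ?k
      = l ?k \<bullet> (Am p ?k *v y ?k)"
    by (metis inner_add_left inner_scaleR_left inner_transpose)
  have "2 *\<^sub>R snd (hess p ?k (x ?k, u ?k)) + s ?k = transpose (Bm p ?k) *v l ?k"
    using step.prems(1) k unfolding adjoint_eqs_def by fastforce
  then have 2: "2 * (snd (hess p ?k (x ?k, u ?k)) \<bullet> v ?k) + s ?k \<bullet> v ?k = l ?k \<bullet> (Bm p ?k *v v ?k)"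
    by (metis inner_add_left inner_scaleR_left inner_transpose)
  have "y (?k + 1) = Am p ?k *v y ?k + Bm p ?k *v v ?k"
    using step.prems(2) k unfolding traj_def by blast
  then have 3: "y i = Am p ?k *v y ?k + Bm p ?k *v v ?k" by simp
  have 4: "run_form p ?k b x u y v = hess p ?k (x ?k, u ?k) \<bullet> (y ?k, v ?k) + run_form p i b x u y v"
    unfolding run_form_def using step.hyps by (subst sum_int_first) auto
  have 5: "(\<Sum>k\<in>{?k..<b}. r k \<bullet> y k + s k \<bullet> v k)
      = r ?k \<bullet> y ?k + s ?k \<bullet> v ?k + (\<Sum>k\<in>{i..<b}. r k \<bullet> y k + s k \<bullet> v k)"
    using step.hyps by (subst sum_int_first) auto
  show ?case
    unfolding 4 5 using IH 1 2 unfolding 3 by (simp add: inner_prod_def inner_add_right)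
qed

section \<open>First-order conditions and global optimality\<close>

text \<open>Common shape of the full problem and of all subproblems, so that optimality is analysed
  once.\<close>

definition lq_ocp ::
  "('nx::finite, 'nu::finite) lq_data \<Rightarrow> int \<Rightarrow> int \<Rightarrow> (real ^ 'nx \<Rightarrow> real) \<Rightarrow> real ^ 'nx \<Rightarrow> ('nx, 'nu) ocp"
  where "lq_ocp p a b \<tau> e = \<lparr>first_stage = a, last_stage = b, running = lq_cost p,
    terminal = \<tau>, dynamics = lq_dyn p, initial = e\<rparr>"

lemma lq_ocp_sel [simp]:
  "first_stage (lq_ocp p a b \<tau> e) = a" "last_stage (lq_ocp p a b \<tau> e) = b"
  "running (lq_ocp p a b \<tau> e) = lq_cost p" "terminal (lq_ocp p a b \<tau> e) = \<tau>"
  "dynamics (lq_ocp p a b \<tau> e) = lq_dyn p" "initial (lq_ocp p a b \<tau> e) = e"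
  by (simp_all add: lq_ocp_def)

definition quad :: "(real ^ 'n::finite \<Rightarrow> real ^ 'n) \<Rightarrow> real ^ 'n \<Rightarrow> real \<Rightarrow> real ^ 'n \<Rightarrow> real" where
  "quad M c d x = M x \<bullet> x + c \<bullet> x + d"

section \<open>Second-order expansions and derivatives of the Lagrangian\<close>

lemma lq_cost_expand:
  assumes "self_adjoint (hess p k)"
  shows "lq_cost p k (x + y) (u + v) = lq_cost p k x u + 2 * (hess p k (x, u) \<bullet> (y, v))
    + (rv p k \<bullet> y + sv p k \<bullet> v) + hess p k (y, v) \<bullet> (y, v)"
proof -
  have "(x, u) \<bullet> hess p k (y, v) = hess p k (x, u) \<bullet> (y, v)"
    using self_adjointD[OF assms] by metis
  moreover have "(y, v) \<bullet> hess p k z = hess p k z \<bullet> (y, v)" for z by (rule inner_commute)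
  moreover have "(x + y, u + v) = (x, u) + (y, v)" by simp
  ultimately show ?thesis
    unfolding lq_cost_def hess_add
    by (simp only: inner_add_left inner_add_right) (simp add: inner_prod_def)
qed

lemma quad_expand:
  assumes "self_adjoint M"
  shows "quad M c d (x + y) = quad M c d x + (2 *\<^sub>R M x + c) \<bullet> y + M y \<bullet> y"
proof -
  have "M y \<bullet> x = M x \<bullet> y" using self_adjointD[OF assms] by (metis inner_commute)
  then show ?thesis
    by (simp add: quad_def linear_add[OF self_adjoint_linear[OF assms]] inner_add_left inner_add_right)
qed

lemma has_derivative_of_expansion:
  fixes f :: "'a::euclidean_space \<Rightarrow> real"
  assumes "\<And>h. f (x + h) = f x + g \<bullet> h + L h \<bullet> h" "linear L"
  shows "(f has_derivative (\<lambda>h. g \<bullet> h)) (at x)"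
proof -
  have bl: "bounded_linear L" using assms(2) by (rule linear_linear[THEN iffD2])
  have f: "f = (\<lambda>y. f x + g \<bullet> (y - x) + L (y - x) \<bullet> (y - x))"
  proof
    fix y show "f y = f x + g \<bullet> (y - x) + L (y - x) \<bullet> (y - x)"
      using assms(1)[of "y - x"] by (simp only: add_diff_cancel_left' diff_add_cancel add.commute[of x])
  qed
  have "((\<lambda>y. f x + g \<bullet> (y - x) + L (y - x) \<bullet> (y - x)) has_derivative (\<lambda>h. g \<bullet> h)) (at x)"
    by (auto intro!: derivative_eq_intros bounded_linear.has_derivative[OF bl]
        simp: linear_0[OF assms(2)])
  then show ?thesis by (subst f)
qed

lemma lq_cost_derivative_state:
  assumes "self_adjoint (hess p k)"
  shows "((\<lambda>x. lq_cost p k x u) has_derivative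
     (\<lambda>h. (2 *\<^sub>R fst (hess p k (x, u)) + rv p k) \<bullet> h)) (at x)"
proof (rule has_derivative_of_expansion[where L = "\<lambda>h. fst (hess p k (h, 0))"])
  show "linear (\<lambda>h. fst (hess p k (h, 0)))"
    by (rule linearI) (simp_all add: hess_def matrix_vector_right_distrib matrix_vector_mult_scaleR)
  show "lq_cost p k (x + h) u = lq_cost p k x u + (2 *\<^sub>R fst (hess p k (x, u)) + rv p k) \<bullet> h
      + fst (hess p k (h, 0)) \<bullet> h" for h
    using lq_cost_expand[OF assms, of x h u 0] by (simp add: inner_prod_def inner_add_left)
qed

lemma lq_cost_derivative_control:
  assumes "self_adjoint (hess p k)"
  shows "((\<lambda>u. lq_cost p k x u) has_derivative
     (\<lambda>h. (2 *\<^sub>R snd (hess p k (x, u)) + sv p k) \<bullet> h)) (at u)"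
proof (rule has_derivative_of_expansion[where L = "\<lambda>h. snd (hess p k (0, h))"])
  show "linear (\<lambda>h. snd (hess p k (0, h)))"
    by (rule linearI) (simp_all add: hess_def matrix_vector_right_distrib matrix_vector_mult_scaleR)
  show "lq_cost p k x (u + h) = lq_cost p k x u + (2 *\<^sub>R snd (hess p k (x, u)) + sv p k) \<bullet> h
      + snd (hess p k (0, h)) \<bullet> h" for h
    using lq_cost_expand[OF assms, of x 0 u h] by (simp add: inner_prod_def inner_add_left)
qed

lemma lagrangian_derivative_control:
  assumes "self_adjoint (hess p k)" "k \<in> {a..<b}"
  shows "((\<lambda>\<eta>. lagrangian (lq_ocp p a b \<tau> e) x (u(k := \<eta>)) l) has_derivative
     (\<lambda>h. (2 *\<^sub>R snd (hess p k (x k, u k)) + sv p k - transpose (Bm p k) *v l k) \<bullet> h)) (at (u k))"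
proof -
  let ?G = "2 *\<^sub>R snd (hess p k (x k, u k)) + sv p k"
  have 1: "((\<lambda>\<eta>. lq_cost p j (x j) ((u(k := \<eta>)) j)) has_derivative
      (\<lambda>h. if j = k then ?G \<bullet> h else 0)) (at (u k))" for j
    using lq_cost_derivative_control[OF assms(1)] by (cases "j = k") auto
  have 2: "((\<lambda>\<eta>. l j \<bullet> (x (j + 1) - lq_dyn p j (x j) ((u(k := \<eta>)) j))) has_derivative
      (\<lambda>h. if j = k then - (l k \<bullet> (Bm p k *v h)) else 0)) (at (u k))" for j
    unfolding lq_dyn_def
    by (cases "j = k")
      (auto intro!: derivative_eq_intros bounded_linear.has_derivative[OF matrix_vector_mul_bounded_linear])
  have "((\<lambda>\<eta>. lagrangian (lq_ocp p a b \<tau> e) x (u(k := \<eta>)) l) has_derivative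
     (\<lambda>h. (\<Sum>j\<in>{a..<b}. if j = k then ?G \<bullet> h else 0) + 0
        + (\<Sum>j\<in>{a..<b}. if j = k then - (l k \<bullet> (Bm p k *v h)) else 0) + 0)) (at (u k))"
    unfolding lagrangian_def objective_def lq_ocp_sel
    by (intro has_derivative_add has_derivative_sum 1 2 has_derivative_const)
  moreover have "(\<lambda>h. (\<Sum>j\<in>{a..<b}. if j = k then ?G \<bullet> h else 0) + 0
        + (\<Sum>j\<in>{a..<b}. if j = k then - (l k \<bullet> (Bm p k *v h)) else 0) + 0)
      = (\<lambda>h. (?G - transpose (Bm p k) *v l k) \<bullet> h)"
    unfolding sum.delta[OF finite_atLeastLessThan_int] using assms(2)
    by (simp add: inner_diff_left inner_transpose del: transpose_matrix_vector)
  ultimately show ?thesis by simp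
qed

text \<open>The state \<open>x k\<close> occurs in its own cost, as the successor in constraint
  \<open>k - 1\<close>, and as an argument of the dynamics at \<open>k\<close>. At
  \<open>k = a\<close> the initial condition takes over the role of the preceding constraint;
  numbering its multiplier \<open>a - 1\<close> makes the formula uniform.\<close>

lemma lagrangian_derivative_state:
  assumes "\<And>j. j \<in> {a..<b} \<Longrightarrow> self_adjoint (hess p j)" "self_adjoint M" "k \<in> {a..b}"
  shows "((\<lambda>\<xi>. lagrangian (lq_ocp p a b (quad M c d) e) (x(k := \<xi>)) u l) has_derivative
     (\<lambda>h. (l (k - 1) + (if k < b then 2 *\<^sub>R fst (hess p k (x k, u k)) + rv p k - transpose (Am p k) *v l k
         else 2 *\<^sub>R M (x k) + c)) \<bullet> h)) (at (x k))"
proof -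
  let ?G = "2 *\<^sub>R fst (hess p k (x k, u k)) + rv p k"
  let ?F = "2 *\<^sub>R M (x k) + c"
  have 1: "((\<lambda>\<xi>. lq_cost p j ((x(k := \<xi>)) j) (u j)) has_derivative
      (\<lambda>h. if j = k then ?G \<bullet> h else 0)) (at (x k))" if "j \<in> {a..<b}" for j
    using lq_cost_derivative_state[OF assms(1)[OF that]] by (cases "j = k") auto
  have 2: "((\<lambda>\<xi>. quad M c d ((x(k := \<xi>)) b)) has_derivative
      (\<lambda>h. if b = k then ?F \<bullet> h else 0)) (at (x k))"
    using has_derivative_of_expansion[OF quad_expand[OF assms(2), of c d "x k"] self_adjoint_linear[OF assms(2)]]
    by (cases "b = k") auto
  have \<delta>: "((\<lambda>\<xi>. (x(k := \<xi>)) j) has_derivative (\<lambda>h. if j = k then h else 0)) (at (x k))" for j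
    by (cases "j = k") auto
  have 3: "((\<lambda>\<xi>. l j \<bullet> ((x(k := \<xi>)) (j + 1) - lq_dyn p j ((x(k := \<xi>)) j) (u j))) has_derivative
      (\<lambda>h. l j \<bullet> (if j + 1 = k then h else 0) - l j \<bullet> (Am p j *v (if j = k then h else 0)))) (at (x k))" for j
    unfolding lq_dyn_def
    by (rule derivative_eq_intros \<delta> bounded_linear.has_derivative[OF matrix_vector_mul_bounded_linear] refl)+
      (simp add: inner_diff_right)
  have 4: "((\<lambda>\<xi>. l (a - 1) \<bullet> ((x(k := \<xi>)) a - e)) has_derivative
      (\<lambda>h. l (a - 1) \<bullet> (if a = k then h else 0))) (at (x k))"
    by (rule derivative_eq_intros \<delta> refl)+ simp
  have "((\<lambda>\<xi>. lagrangian (lq_ocp p a b (quad M c d) e) (x(k := \<xi>)) u l) has_derivative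
     (\<lambda>h. (\<Sum>j\<in>{a..<b}. if j = k then ?G \<bullet> h else 0) + (if b = k then ?F \<bullet> h else 0)
        + (\<Sum>j\<in>{a..<b}. l j \<bullet> (if j + 1 = k then h else 0) - l j \<bullet> (Am p j *v (if j = k then h else 0)))
        + l (a - 1) \<bullet> (if a = k then h else 0))) (at (x k))"
    unfolding lagrangian_def objective_def lq_ocp_sel
    by (intro has_derivative_add has_derivative_sum 1 2 3 4)
  moreover have "(\<lambda>h. (\<Sum>j\<in>{a..<b}. if j = k then ?G \<bullet> h else 0) + (if b = k then ?F \<bullet> h else 0)
        + (\<Sum>j\<in>{a..<b}. l j \<bullet> (if j + 1 = k then h else 0) - l j \<bullet> (Am p j *v (if j = k then h else 0)))
        + l (a - 1) \<bullet> (if a = k then h else 0))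
      = (\<lambda>h. (l (k - 1) + (if k < b then ?G - transpose (Am p k) *v l k else ?F)) \<bullet> h)"
  proof
    fix h
    have "(\<Sum>j\<in>{a..<b}. l j \<bullet> (if j + 1 = k then h else 0))
        = (\<Sum>j\<in>{a..<b}. if j = k - 1 then l j \<bullet> h else 0)"
      by (intro sum.cong) auto
    then have A: "(\<Sum>j\<in>{a..<b}. l j \<bullet> (if j + 1 = k then h else 0))
        = (if k - 1 \<in> {a..<b} then l (k - 1) \<bullet> h else 0)"
      by (simp only: sum.delta[OF finite_atLeastLessThan_int])
    have "(\<Sum>j\<in>{a..<b}. l j \<bullet> (Am p j *v (if j = k then h else 0)))
        = (\<Sum>j\<in>{a..<b}. if j = k then l j \<bullet> (Am p j *v h) else 0)"
      by (intro sum.cong) auto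
    then have B: "(\<Sum>j\<in>{a..<b}. l j \<bullet> (Am p j *v (if j = k then h else 0)))
        = (if k \<in> {a..<b} then l k \<bullet> (Am p k *v h) else 0)"
      by (simp only: sum.delta[OF finite_atLeastLessThan_int])
    show "(\<Sum>j\<in>{a..<b}. if j = k then ?G \<bullet> h else 0) + (if b = k then ?F \<bullet> h else 0)
        + (\<Sum>j\<in>{a..<b}. l j \<bullet> (if j + 1 = k then h else 0) - l j \<bullet> (Am p j *v (if j = k then h else 0)))
        + l (a - 1) \<bullet> (if a = k then h else 0)
      = (l (k - 1) + (if k < b then ?G - transpose (Am p k) *v l k else ?F)) \<bullet> h"
      unfolding sum_subtractf A B sum.delta[OF finite_atLeastLessThan_int] using assms(3)
      by (auto simp: inner_diff_left inner_add_left inner_transpose simp del: transpose_matrix_vector)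
  qed
  ultimately show ?thesis by simp
qed

lemma has_derivative_inner_zero_iff:
  fixes g :: "'a::euclidean_space"
  assumes "(f has_derivative (\<lambda>h. g \<bullet> h)) (at x)"
  shows "(f has_derivative (\<lambda>_. 0)) (at x) \<longleftrightarrow> g = 0"
proof
  assume "(f has_derivative (\<lambda>_. 0)) (at x)"
  with assms have "(\<lambda>h. g \<bullet> h) = (\<lambda>_. 0)" by (rule has_derivative_unique)
  then have "g \<bullet> g = 0" by metis
  then show "g = 0" by simp
next
  assume "g = 0" with assms show "(f has_derivative (\<lambda>_. 0)) (at x)" by simp
qed

lemma sym_data_hess: "sym_data p a b \<Longrightarrow> k \<in> {a..<b} \<Longrightarrow> self_adjoint (hess p k)"
  by (auto simp: sym_data_def intro: hess_self_adjoint)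

lemma kkt_point_iff:
  assumes "sym_data p a b" "self_adjoint M" "a \<le> b"
  shows "kkt_point (lq_ocp p a b (quad M c d) e) w \<longleftrightarrow>
     st w a = e \<and> (\<forall>k\<in>{a..<b}. st w (k + 1) = lq_dyn p k (st w k) (ct w k)) \<and>
     adjoint_eqs p a b (rv p) (sv p) M c (st w) (ct w) (mult w)"
proof -
  let ?P = "lq_ocp p a b (quad M c d) e"
  have 1: "((\<lambda>\<xi>. lagrangian ?P ((st w)(k := \<xi>)) (ct w) (mult w)) has_derivative (\<lambda>_. 0)) (at (st w k))
     \<longleftrightarrow> mult w (k - 1) + (if k < b then 2 *\<^sub>R fst (hess p k (st w k, ct w k)) + rv p k
            - transpose (Am p k) *v mult w k else 2 *\<^sub>R M (st w k) + c) = 0" if "k \<in> {a..b}" for k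
    by (rule has_derivative_inner_zero_iff
        [OF lagrangian_derivative_state[OF sym_data_hess[OF assms(1)] assms(2) that]])
  have 2: "((\<lambda>\<eta>. lagrangian ?P (st w) ((ct w)(k := \<eta>)) (mult w)) has_derivative (\<lambda>_. 0)) (at (ct w k))
     \<longleftrightarrow> 2 *\<^sub>R snd (hess p k (st w k, ct w k)) + sv p k - transpose (Bm p k) *v mult w k = 0"
    if "k \<in> {a..<b}" for k
    by (rule has_derivative_inner_zero_iff
        [OF lagrangian_derivative_control[OF sym_data_hess[OF assms(1) that] that]])
  have I: "{a..b} = insert b {a..<b}" using assms(3) by auto
  have "stationary ?P w \<longleftrightarrow> adjoint_eqs p a b (rv p) (sv p) M c (st w) (ct w) (mult w)"
    unfolding stationary_def adjoint_eqs_def lq_ocp_sel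
    using 1 2 by (simp add: I ball_conj_distrib algebra_simps del: transpose_matrix_vector)
       (smt (verit) atLeastLessThan_iff)
  then show ?thesis unfolding kkt_point_def feasible_def by simp
qed

lemma coercive_nonneg:
  assumes "coercive p a b M \<gamma>" "0 \<le> \<gamma>" "x a = 0" "traj p a b x u"
  shows "0 \<le> run_form p a b x u x u + M (x b) \<bullet> x b"
proof -
  have "0 \<le> \<gamma> * (energy a b x u + (norm (x b))\<^sup>2)" using assms(2) energy_nonneg[of a b x u] by simp
  then show ?thesis using assms unfolding coercive_def by fastforce
qed

text \<open>The objective is quadratic, so its expansion at a KKT point is exact: first-order terms
  cancel, and the remainder is the form of a feasible difference, a trajectory starting at
  zero.\<close>

lemma kkt_point_global:
  assumes sym: "sym_data p a b" and M: "self_adjoint M" and ab: "a \<le> b"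
    and co: "coercive p a b M \<gamma>" "0 \<le> \<gamma>"
    and kkt: "kkt_point (lq_ocp p a b (quad M c d) e) w"
  shows "pd_solution (lq_ocp p a b (quad M c d) e) w"
proof -
  let ?P = "lq_ocp p a b (quad M c d) e"
  note w = kkt[unfolded kkt_point_iff[OF sym M ab]]
  have "objective ?P (st w) (ct w) \<le> objective ?P y v" if "feasible ?P y v" for y v
  proof -
    define h where "h k = y k - st w k" for k
    define g where "g k = v k - ct w k" for k
    have tr: "traj p a b h g"
      unfolding traj_def using that w
      by (auto simp: feasible_def h_def g_def lq_dyn_def matrix_vector_mult_diff_distrib)
    have h0: "h a = 0" using that w by (auto simp: feasible_def h_def)
    have y: "y k = st w k + h k" "v k = ct w k + g k" for k by (simp_all add: h_def g_def)
    have "objective ?P y v = (\<Sum>k\<in>{a..<b}. lq_cost p k (st w k) (ct w k)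
         + 2 * (hess p k (st w k, ct w k) \<bullet> (h k, g k))
         + (rv p k \<bullet> h k + sv p k \<bullet> g k) + hess p k (h k, g k) \<bullet> (h k, g k))
         + (quad M c d (st w b) + (2 *\<^sub>R M (st w b) + c) \<bullet> h b + M (h b) \<bullet> h b)"
      unfolding objective_def lq_ocp_sel y
      by (simp add: lq_cost_expand[OF sym_data_hess[OF sym]] quad_expand[OF M])
    \<comment> \<open>The last bracket is arranged to be the left side of the weak form tested with
      \<open>(h, g)\<close>; its multiplier term may be inserted because
      \<open>h a = 0\<close>.\<close>
    also have "\<dots> = objective ?P (st w) (ct w) + (run_form p a b h g h g + M (h b) \<bullet> h b)
        + (2 * (run_form p a b (st w) (ct w) h g + M (st w b) \<bullet> h b)
           + (\<Sum>k\<in>{a..<b}. rv p k \<bullet> h k + sv p k \<bullet> g k) + c \<bullet> h b + mult w (a - 1) \<bullet> h a)"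
      unfolding objective_def lq_ocp_sel run_form_def
      by (simp add: h0 sum.distrib sum_distrib_left inner_add_left)
    also have "\<dots> = objective ?P (st w) (ct w) + (run_form p a b h g h g + M (h b) \<bullet> h b)"
      using adjoint_weak_form[OF ab _ tr] w by simp
    finally show ?thesis using coercive_nonneg[OF co(1,2) h0 tr] by simp
  qed
  then show ?thesis using kkt by (simp add: pd_solution_def global_minimizer_def kkt_point_def)
qed

section \<open>Existence by the Riccati recursion\<close>

lemma self_adjoint_positive_surj:
  fixes W :: "'a::euclidean_space \<Rightarrow> 'a"
  assumes "self_adjoint W" "\<gamma> > 0" "\<And>v. \<gamma> * (norm v)\<^sup>2 \<le> W v \<bullet> v"
  shows "surj W"
proof -
  have lin: "linear W" by (rule self_adjoint_linear[OF assms(1)])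
  have "v = 0" if "W v = 0" for v
  proof -
    have "\<gamma> * (norm v)\<^sup>2 \<le> 0" using assms(3)[of v] that by simp
    then have "(norm v)\<^sup>2 \<le> 0" using assms(2) by (simp add: mult_le_0_iff)
    then show ?thesis by simp
  qed
  then have "inj W" using lin by (simp add: linear_injective_0)
  then show ?thesis using lin linear_injective_imp_surjective by blast
qed

text \<open>Riccati recursion: \<open>W\<close> is the Hessian of the last control, whose elimination moves the terminal
  cost \<open>M\<close> one stage back to \<open>M'\<close>.\<close>

lemma riccati_step:
  fixes p :: "('nx::finite, 'nu::finite) lq_data"
  assumes sym: "sym_data p a (b + 1)" and M: "self_adjoint M" and ab: "a \<le> b"
    and co: "coercive p a (b + 1) M \<gamma>" "0 < \<gamma>"
  obtains W :: "real ^ 'nu \<Rightarrow> real ^ 'nu" and K :: "real ^ 'nx \<Rightarrow> real ^ 'nu" and M'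
  where "surj W" "linear W"
    and "\<And>u. W u = Rm p b *v u + transpose (Bm p b) *v M (Bm p b *v u)"
    and "\<And>x. W (K x) + Sm p b *v x + transpose (Bm p b) *v M (Am p b *v x) = 0"
    and "\<And>x. M' x = Qm p b *v x + transpose (Sm p b) *v K x
          + transpose (Am p b) *v M (Am p b *v x + Bm p b *v K x)"
    and "self_adjoint M'" "coercive p a b M' \<gamma>"
proof -
  note T = inner_transpose
  have T': "x \<bullet> (transpose A *v y) = (A *v x) \<bullet> y" for A :: "real^'j::finite^'k::finite" and x y
    using inner_transpose[of A y x] by (simp add: inner_commute)
  have QR: "transpose (Qm p b) = Qm p b" "transpose (Rm p b) = Rm p b"
    using sym ab by (auto simp: sym_data_def)
  note Q = inner_symmetric_matrix[OF QR(1)] and R = inner_symmetric_matrix[OF QR(2)]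
  note Ml = self_adjoint_linear[OF M]
  define A B S where "A = Am p b" and "B = Bm p b" and "S = Sm p b"
  define W where "W u = Rm p b *v u + transpose B *v M (B *v u)" for u
  have Wsa: "self_adjoint W"
    unfolding self_adjoint_def W_def
    by (simp only: inner_add_left inner_add_right T T' R self_adjointD[OF M]) simp
  have Wpos: "\<gamma> * (norm v)\<^sup>2 \<le> W v \<bullet> v" for v
  proof -
    \<comment> \<open>Rest up to stage \<open>b\<close>, then one control impulse \<open>v\<close>:
      on this trajectory coercivity becomes positivity of \<open>W\<close>.\<close>
    define x where "x k = (if k = b + 1 then B *v v else 0)" for k
    define u where "u k = (if k = b then v else 0)" for k
    have "traj p a (b + 1) x u" by (auto simp: traj_def x_def u_def B_def)
    moreover have "x a = 0" using ab by (simp add: x_def)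
    ultimately have "\<gamma> * (energy a (b + 1) x u + (norm (x (b + 1)))\<^sup>2)
        \<le> run_form p a (b + 1) x u x u + M (x (b + 1)) \<bullet> x (b + 1)"
      using co unfolding coercive_def by blast
    moreover have "run_form p a (b + 1) x u x u = (Rm p b *v v) \<bullet> v"
    proof -
      have "run_form p a (b + 1) x u x u = run_form p a b x u x u + hess p b (x b, u b) \<bullet> (x b, u b)"
        unfolding run_form_def by (rule sum_int_last[OF ab])
      moreover have "run_form p a b x u x u = 0"
        by (rule run_form_zero) (auto simp: x_def u_def)
      moreover have "x b = 0" "u b = v" by (simp_all add: x_def u_def)
      ultimately show ?thesis by (simp add: hess_def)
    qed
    moreover have "(norm v)\<^sup>2 \<le> energy a (b + 1) x u"
      using energy_ge[of b a "b + 1" x u] ab by (simp add: x_def u_def)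
    moreover have "\<gamma> * (norm v)\<^sup>2 \<le> \<gamma> * (energy a (b + 1) x u + (norm (x (b + 1)))\<^sup>2)"
      using calculation(3) co(2) by (intro mult_left_mono) (auto intro: order_trans)
    ultimately have "\<gamma> * (norm v)\<^sup>2 \<le> (Rm p b *v v) \<bullet> v + M (x (b + 1)) \<bullet> x (b + 1)"
      by linarith
    then show ?thesis by (simp add: W_def x_def inner_add_left T del: transpose_matrix_vector)
  qed
  have surj: "surj W" by (rule self_adjoint_positive_surj[OF Wsa co(2) Wpos])
  have Wl: "linear W" by (rule self_adjoint_linear[OF Wsa])
  \<comment> \<open>The optimal feedback. It enters only through \<open>WK\<close>; linearity of
    \<open>M'\<close> will follow from self-adjointness.\<close>
  define K where "K x = (SOME u. W u = - (S *v x + transpose B *v M (A *v x)))" for x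
  have WK: "W (K x) = - (S *v x + transpose B *v M (A *v x))" for x
    unfolding K_def by (rule someI_ex) (metis surj surj_def)
  define M' where "M' x = Qm p b *v x + transpose S *v K x + transpose A *v M (A *v x + B *v K x)" for x
  have cross: "(S *v x) \<bullet> u + M (A *v x) \<bullet> (B *v u) = - (W (K x) \<bullet> u)" for x u
    by (simp add: WK inner_add_left inner_diff_left T del: transpose_matrix_vector)
  have MB: "M (B *v u) \<bullet> (A *v y) = M (A *v y) \<bullet> (B *v u)" for u y
    using self_adjointD[OF M] by (metis inner_commute)
  have M'sa: "self_adjoint M'"
  proof -
    \<comment> \<open>In this form the Riccati update is visibly symmetric, since \<open>Qm\<close>,
      \<open>M\<close> and \<open>W\<close> are self-adjoint.\<close>
    have e: "M' x \<bullet> y = (Qm p b *v x) \<bullet> y + M (A *v x) \<bullet> (A *v y) - W (K y) \<bullet> K x" for x y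
    proof -
      have "M' x \<bullet> y = (Qm p b *v x) \<bullet> y + K x \<bullet> (S *v y) + M (A *v x) \<bullet> (A *v y)
          + M (B *v K x) \<bullet> (A *v y)"
        unfolding M'_def by (simp only: inner_add_left T linear_add[OF Ml])
      moreover have "(S *v y) \<bullet> K x = K x \<bullet> (S *v y)" by (rule inner_commute)
      ultimately show ?thesis using cross[of y "K x"] MB[of "K x" y] by linarith
    qed
    have "M' x \<bullet> y = M' y \<bullet> x" for x y
    proof -
      have "(Qm p b *v x) \<bullet> y = (Qm p b *v y) \<bullet> x" using Q by (metis inner_commute)
      moreover have "M (A *v x) \<bullet> (A *v y) = M (A *v y) \<bullet> (A *v x)"
        using self_adjointD[OF M] by (metis inner_commute)
      moreover have "W (K y) \<bullet> K x = W (K x) \<bullet> K y"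
        using self_adjointD[OF Wsa] by (metis inner_commute)
      ultimately show ?thesis by (simp only: e)
    qed
    then show ?thesis unfolding self_adjoint_def by (metis inner_commute)
  qed
  have co': "coercive p a b M' \<gamma>"
    unfolding coercive_def
  proof (intro allI impI)
    fix x u assume x: "x a = 0" "traj p a b x u"
    define X where "X = x b"
    define y where "y k = (if k = b + 1 then A *v X + B *v K X else x k)" for k
    define v where "v k = (if k = b then K X else u k)" for k
    have "traj p a (b + 1) y v"
      unfolding traj_def
    proof
      fix k assume "k \<in> {a..<b + 1}"
      then consider "k = b" | "k \<in> {a..<b}" by fastforce
      then show "y (k + 1) = Am p k *v y k + Bm p k *v v k"
        using x(2) by cases (auto simp: y_def v_def A_def B_def X_def traj_def)
    qed
    moreover have "y a = 0" using ab x by (simp add: y_def)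
    ultimately have *: "\<gamma> * (energy a (b + 1) y v + (norm (y (b + 1)))\<^sup>2)
        \<le> run_form p a (b + 1) y v y v + M (y (b + 1)) \<bullet> y (b + 1)"
      using co unfolding coercive_def by blast
    have "y b = x b" by (simp add: y_def)
    have "energy a (b + 1) y v = energy a b y v + ((norm (y b))\<^sup>2 + (norm (v b))\<^sup>2)"
      by (rule energy_last[OF ab])
    also have "energy a b y v = energy a b x u"
      by (rule energy_cong) (auto simp: y_def v_def)
    finally have 1: "energy a b x u + (norm (x b))\<^sup>2 \<le> energy a (b + 1) y v + (norm (y (b + 1)))\<^sup>2"
      using \<open>y b = x b\<close> by simp
    have "run_form p a (b + 1) y v y v = run_form p a b y v y v + hess p b (y b, v b) \<bullet> (y b, v b)"
      unfolding run_form_def by (rule sum_int_last[OF ab])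
    also have "run_form p a b y v y v = run_form p a b x u x u"
      by (rule run_form_cong) (auto simp: y_def v_def)
    also have "hess p b (y b, v b) = hess p b (X, K X)"  by (simp add: y_def v_def X_def)
    \<comment> \<open>Value-function identity: under the feedback, the cost of stage
      \<open>b\<close> plus the terminal cost \<open>M\<close> of the successor equals
      \<open>M'\<close> at \<open>X\<close>. Extending by this stage thus leaves the form unchanged
      while the energy can only grow.\<close>
    also have "hess p b (X, K X) \<bullet> (y b, v b) = M' X \<bullet> X - M (y (b + 1)) \<bullet> y (b + 1)"
    proof -
      have a: "hess p b (X, K X) \<bullet> (y b, v b) = (Qm p b *v X) \<bullet> X + (transpose S *v K X) \<bullet> X
          + (S *v X) \<bullet> K X + (Rm p b *v K X) \<bullet> K X"
        by (simp only: hess_def y_def v_def X_def S_def inner_prod_def fst_conv snd_conv inner_add_left) simp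
      have b: "M' X \<bullet> X = (Qm p b *v X) \<bullet> X + (transpose S *v K X) \<bullet> X
          + M (A *v X + B *v K X) \<bullet> (A *v X)"
        unfolding M'_def by (simp only: inner_add_left T)
      have c: "M (y (b + 1)) \<bullet> y (b + 1) = M (A *v X + B *v K X) \<bullet> (A *v X)
          + M (A *v X) \<bullet> (B *v K X) + M (B *v K X) \<bullet> (B *v K X)"
        by (simp add: y_def linear_add[OF Ml] inner_add_left inner_add_right)
      have d: "W (K X) \<bullet> K X = (Rm p b *v K X) \<bullet> K X + M (B *v K X) \<bullet> (B *v K X)"
        by (simp only: W_def inner_add_left T)
      show ?thesis using a b c d cross[of X "K X"] by linarith
    qed
    finally have 2: "run_form p a (b + 1) y v y v + M (y (b + 1)) \<bullet> y (b + 1)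
        = run_form p a b x u x u + M' (x b) \<bullet> x b" by (simp add: X_def)
    have "\<gamma> * (energy a b x u + (norm (x b))\<^sup>2) \<le> \<gamma> * (energy a (b + 1) y v + (norm (y (b + 1)))\<^sup>2)"
      using 1 co(2) by (intro mult_left_mono) auto
    with * 2 show "\<gamma> * (energy a b x u + (norm (x b))\<^sup>2) \<le> run_form p a b x u x u + M' (x b) \<bullet> x b"
      by simp
  qed
  show ?thesis
  proof (rule that[OF surj Wl _ _ _ M'sa co'])
    show "W u = Rm p b *v u + transpose (Bm p b) *v M (Bm p b *v u)" for u
      by (simp only: W_def B_def)
    show "W (K x) + Sm p b *v x + transpose (Bm p b) *v M (Am p b *v x) = 0" for x
      by (simp add: WK A_def B_def S_def)
    show "M' x = Qm p b *v x + transpose (Sm p b) *v K x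
        + transpose (Am p b) *v M (Am p b *v x + Bm p b *v K x)" for x
      by (simp only: M'_def A_def B_def S_def)
  qed
qed

text \<open>Dynamic programming by induction on the horizon: a solution of the shortened problem
  with terminal data \<open>M'\<close>, \<open>c'\<close> is prolonged by the affine feedback
  \<open>U\<close>, and the new multiplier \<open>L\<close> is read off the terminal
  equation.\<close>

lemma adjoint_eqs_exists:
  assumes "a \<le> b" "sym_data p a b" "self_adjoint M" "coercive p a b M \<gamma>" "0 < \<gamma>"
  shows "\<exists>x u l. x a = e \<and> (\<forall>k\<in>{a..<b}. x (k + 1) = lq_dyn p k (x k) (u k)) \<and>
    adjoint_eqs p a b (rv p) (sv p) M c x u l"
  using assms(1-4)
proof (induction b arbitrary: M c rule: int_ge_induct)
  case base
  have "adjoint_eqs p a a (rv p) (sv p) M c (\<lambda>_. e) u (\<lambda>_. - (2 *\<^sub>R M e + c))" for u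
    by (simp add: adjoint_eqs_def)
  then show ?case by force
next
  case (step b)
  let ?A = "Am p b" and ?B = "Bm p b" and ?S = "Sm p b" and ?v = "vv p b"
  note T = inner_transpose
  obtain W K M' where W: "surj W" "linear W"
    and Weq: "\<And>u. W u = Rm p b *v u + transpose ?B *v M (?B *v u)"
    and K: "\<And>x. W (K x) + ?S *v x + transpose ?B *v M (?A *v x) = 0"
    and M'eq: "\<And>x. M' x = Qm p b *v x + transpose ?S *v K x + transpose ?A *v M (?A *v x + ?B *v K x)"
    and M': "self_adjoint M'" "coercive p a b M' \<gamma>"
    using riccati_step[OF step.prems(1,2) step.hyps step.prems(3) assms(5)] by metis
  note Ml = self_adjoint_linear[OF step.prems(2)]
  \<comment> \<open>The feedforward part of the last control; it cancels the terms of the control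
    equation that do not depend on the state.\<close>
  obtain k0 where k0: "W k0 = - ((1 / 2) *\<^sub>R (sv p b + transpose ?B *v (2 *\<^sub>R M ?v + c)))"
    using W(1) by (metis surj_def)
  \<comment> \<open>Chosen so that the terminal equation of the shortened problem is the state
    equation of stage \<open>b\<close> in the longer one.\<close>
  define c' where "c' = 2 *\<^sub>R (transpose ?S *v k0) + rv p b + transpose ?A *v (2 *\<^sub>R M (?B *v k0 + ?v) + c)"
  have "sym_data p a b" using step.prems(1) by (simp add: sym_data_def)
  from step.IH[OF this M', of c'] obtain x u l where x: "x a = e"
      "\<forall>k\<in>{a..<b}. x (k + 1) = lq_dyn p k (x k) (u k)"
    and adj: "adjoint_eqs p a b (rv p) (sv p) M' c' x u l" by blast
  define X where "X = x b"
  define U where "U = K X + k0"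
  define Y where "Y = ?A *v X + ?B *v U + ?v"
  define L where "L = - (2 *\<^sub>R M Y + c)"
  define x' where "x' = x(b + 1 := Y)"
  define u' where "u' = u(b := U)"
  define l' where "l' = l(b := L)"
  have MY: "M Y = M (?A *v X + ?B *v K X) + M (?B *v k0 + ?v)"
    unfolding Y_def U_def by (simp add: linear_add[OF Ml] matrix_vector_right_distrib)
  have MY2: "M Y = M (?A *v X) + M (?B *v U) + M ?v"
    unfolding Y_def by (simp add: linear_add[OF Ml])
  have adj_b: "2 *\<^sub>R M' X + c' + l (b - 1) = 0" using adj by (simp add: adjoint_eqs_def X_def)
  have "2 *\<^sub>R fst (hess p b (X, U)) + rv p b - transpose ?A *v L = 2 *\<^sub>R M' X + c'"
    unfolding L_def MY M'eq c'_def hess_def U_def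
    by (simp add: matrix_vector_right_distrib matrix_vector_mult_scaleR algebra_simps
        matrix_vector_mult_diff_distrib vec.neg del: transpose_matrix_vector)
  with adj_b have eqx: "2 *\<^sub>R fst (hess p b (X, U)) + rv p b + l (b - 1) - transpose ?A *v L = 0"
    by (simp add: algebra_simps)
  have "2 *\<^sub>R snd (hess p b (X, U)) + sv p b - transpose ?B *v L
     = 2 *\<^sub>R (W U + ?S *v X + transpose ?B *v M (?A *v X))
       + (sv p b + transpose ?B *v (2 *\<^sub>R M ?v + c))"
    unfolding L_def MY2 hess_def Weq
    by (simp add: matrix_vector_right_distrib matrix_vector_mult_scaleR algebra_simps
        matrix_vector_mult_diff_distrib vec.neg del: transpose_matrix_vector)
  also have "W U + ?S *v X + transpose ?B *v M (?A *v X) = W k0"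
    using K[of X] unfolding U_def linear_add[OF W(2)] by (simp add: algebra_simps)
  finally have equ: "2 *\<^sub>R snd (hess p b (X, U)) + sv p b - transpose ?B *v L = 0"
    by (simp add: k0)
  have "x' a = e" using x step.hyps by (simp add: x'_def)
  moreover have "\<forall>k\<in>{a..<b + 1}. x' (k + 1) = lq_dyn p k (x' k) (u' k)"
  proof
    fix k assume "k \<in> {a..<b + 1}"
    then consider "k = b" | "k \<in> {a..<b}" by fastforce
    then show "x' (k + 1) = lq_dyn p k (x' k) (u' k)"
      using x(2) by cases (auto simp: x'_def u'_def lq_dyn_def Y_def X_def)
  qed
  moreover have "adjoint_eqs p a (b + 1) (rv p) (sv p) M c x' u' l'"
    unfolding adjoint_eqs_def
  proof (rule conjI, rule ballI)
    fix k assume "k \<in> {a..<b + 1}"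
    then consider "k = b" | "k \<in> {a..<b}" by fastforce
    then show "2 *\<^sub>R fst (hess p k (x' k, u' k)) + rv p k + l' (k - 1) - transpose (Am p k) *v l' k = 0 \<and>
        2 *\<^sub>R snd (hess p k (x' k, u' k)) + sv p k - transpose (Bm p k) *v l' k = 0"
    proof cases
      case 1
      then show ?thesis using eqx equ by (simp add: x'_def u'_def l'_def X_def del: transpose_matrix_vector)
    next
      case 2
      then show ?thesis using adj
        by (simp add: x'_def u'_def l'_def adjoint_eqs_def del: transpose_matrix_vector)
    qed
  next
    show "2 *\<^sub>R M (x' (b + 1)) + c + l' (b + 1 - 1) = 0" by (simp add: x'_def l'_def L_def)
  qed
  ultimately show ?case by blast
qed

lemma kkt_point_exists:
  assumes "a \<le> b" "sym_data p a b" "self_adjoint M" "coercive p a b M \<gamma>" "0 < \<gamma>"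
  shows "\<exists>w. kkt_point (lq_ocp p a b (quad M c d) e) w"
proof -
  obtain x u l where "x a = e" "\<forall>k\<in>{a..<b}. x (k + 1) = lq_dyn p k (x k) (u k)"
    "adjoint_eqs p a b (rv p) (sv p) M c x u l"
    using adjoint_eqs_exists[OF assms] by blast
  then have "kkt_point (lq_ocp p a b (quad M c d) e) \<lparr>st = x, ct = u, mult = l\<rparr>"
    by (simp add: kkt_point_iff[OF assms(2,3,1)])
  then show ?thesis by blast
qed

section \<open>Steering\<close>

definition bounded_data :: "('nx::finite, 'nu::finite) lq_data \<Rightarrow> int \<Rightarrow> real \<Rightarrow> bool" where
  "bounded_data p N C \<longleftrightarrow>
     (\<forall>k\<in>{0..<N}. (\<forall>z. norm (hess p k z) \<le> C * norm z) \<and>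
        (\<forall>x. norm (Am p k *v x) \<le> C * norm x) \<and> (\<forall>u. norm (Bm p k *v u) \<le> C * norm u)) \<and>
     (\<forall>x. norm (Qm p N *v x) \<le> C * norm x)"

lemma bounded_dataD:
  assumes "bounded_data p N C" "k \<in> {0..<N}"
  shows "norm (hess p k z) \<le> C * norm z" "norm (Am p k *v x) \<le> C * norm x"
    "norm (Bm p k *v u) \<le> C * norm u"
  using assms unfolding bounded_data_def by blast+

lemma uniform_bound_bounded_data:
  assumes "uniform_bound p N \<Upsilon>" "\<Upsilon> \<le> C"
  shows "bounded_data p N C"
proof -
  have *: "norm (f x) \<le> C * norm x" if "bounded_linear f" "onorm f \<le> \<Upsilon>" for f and x :: "'c::real_normed_vector"
    using onorm[OF that(1), of x] that(2) assms(2) by (meson mult_right_mono norm_ge_zero order_trans)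
  have "bounded_linear (hess p k)" for k by (rule linear_linear[THEN iffD2, OF linear_hess])
  then show ?thesis
    using assms(1) unfolding bounded_data_def uniform_bound_def
    by (auto intro!: * matrix_vector_mul_bounded_linear)
qed

text \<open>The bound is required at every intermediate \<open>b\<close> because windows may stop
  before the steering is complete. Rest is demanded only if t stages remain, as controllability is
  assumed only up to stage \<open>N - t\<close>.\<close>

definition steerable :: "('nx::finite, 'nu::finite) lq_data \<Rightarrow> int \<Rightarrow> nat \<Rightarrow> real \<Rightarrow> bool" where
  "steerable p N t K \<longleftrightarrow>
     (\<forall>j\<in>{0..N}. \<forall>e. \<exists>y v. y j = e \<and> traj p j N y v \<and>
        (\<forall>b\<in>{j..N}. energy j b y v + (norm (y b))\<^sup>2 \<le> K * (norm e)\<^sup>2) \<and>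
        (j + int t \<le> N \<longrightarrow> (\<forall>k\<ge>j + int t. y k = 0 \<and> v k = 0)))"

section \<open>Response to controls and the controllability matrix\<close>

primrec rollout ::
  "('nx::finite, 'nu::finite) lq_data \<Rightarrow> int \<Rightarrow> real ^ 'nx \<Rightarrow> (int \<Rightarrow> real ^ 'nu) \<Rightarrow> nat \<Rightarrow> real ^ 'nx" where
  "rollout p j e v 0 = e"
| "rollout p j e v (Suc n) = Am p (j + int n) *v rollout p j e v n + Bm p (j + int n) *v v (j + int n)"

lemma traj_rollout: "traj p j b (\<lambda>k. rollout p j e v (nat (k - j))) v"
  unfolding traj_def
proof
  fix k assume "k \<in> {j..<b}"
  then have "nat (k + 1 - j) = Suc (nat (k - j))" "j + int (nat (k - j)) = k" by auto
  then show "rollout p j e v (nat (k + 1 - j)) = Am p k *v rollout p j e v (nat (k - j)) + Bm p k *v v k"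
    by simp
qed

lemma ctrb_block_Suc_0: "ctrb_block p j (Suc n) 0 = Bm p (j + int n)"
  by (simp add: ctrb_block_def add.commute)

lemma ctrb_block_Suc_Suc: "ctrb_block p j (Suc n) (Suc i) = Am p (j + int n) ** ctrb_block p j n i"
proof -
  have "j + int (Suc n) - int (Suc i) = j + int n - int i" by simp
  then show ?thesis by (simp add: ctrb_block_def matrix_mul_assoc algebra_simps)
qed

lemma matrix_vector_mult_sum:
  fixes A :: "real ^ 'n::finite ^ 'm::finite"
  shows "A *v sum f I = (\<Sum>i\<in>I. A *v f i)"
  by (rule linear_sum[OF matrix_vector_mul_linear])

text \<open>Variation of constants. The blocks of \<Xi> are ordered from the latest control to the
  earliest, hence the reversed stage index.\<close>

lemma rollout_ctrb:
  "rollout p j e v n = transition p j n *v e + (\<Sum>i<n. ctrb_block p j n i *v v (j + int n - 1 - int i))"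
proof (induction n)
  case (Suc n)
  have "(\<Sum>i<Suc n. ctrb_block p j (Suc n) i *v v (j + int (Suc n) - 1 - int i))
      = Bm p (j + int n) *v v (j + int n)
        + Am p (j + int n) *v (\<Sum>i<n. ctrb_block p j n i *v v (j + int n - 1 - int i))"
    unfolding sum.lessThan_Suc_shift ctrb_block_Suc_0 ctrb_block_Suc_Suc matrix_vector_mult_sum
    by (simp add: matrix_vector_mul_assoc algebra_simps)
  then show ?case
    by (simp add: Suc matrix_vector_right_distrib matrix_vector_mul_assoc del: sum.lessThan_Suc)
qed simp

lemma norm_transition_le:
  assumes "bounded_data p N C" "C \<ge> 1" "0 \<le> j" "j + int n \<le> N"
  shows "norm (transition p j n *v e) \<le> C ^ n * norm e"
  using assms(4)
proof (induction n)
  case (Suc n)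
  have "norm (transition p j (Suc n) *v e) \<le> C * norm (transition p j n *v e)"
    using bounded_dataD(2)[OF assms(1), of "j + int n"] Suc.prems assms(3)
    by (simp flip: matrix_vector_mul_assoc)
  also have "\<dots> \<le> C * (C ^ n * norm e)" using Suc assms(2) by (intro mult_left_mono) auto
  finally show ?case by simp
qed simp

lemma norm_rollout_le:
  assumes "bounded_data p N C" "C \<ge> 1" "0 \<le> j" "j + int n \<le> N"
    and v: "\<And>k. norm (v k) \<le> V" and "norm e \<le> V"
  shows "norm (rollout p j e v n) \<le> (2 * C) ^ n * V"
  using assms(4)
proof (induction n)
  case 0
  then show ?case using assms(6) by simp
next
  case (Suc n)
  have V: "0 \<le> V" using assms(6) norm_ge_zero order_trans by blast
  have k: "j + int n \<in> {0..<N}" using Suc.prems assms(3) by auto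
  have "norm (rollout p j e v (Suc n)) \<le> C * norm (rollout p j e v n) + C * norm (v (j + int n))"
    unfolding rollout.simps
    by (rule norm_triangle_le) (intro add_mono bounded_dataD[OF assms(1) k])
  also have "\<dots> \<le> C * ((2 * C) ^ n * V) + C * ((2 * C) ^ n * V)"
  proof (intro add_mono mult_left_mono)
    show "norm (rollout p j e v n) \<le> (2 * C) ^ n * V" using Suc by auto
    have "1 * V \<le> (2 * C) ^ n * V"
      using V assms(2) by (intro mult_right_mono one_le_power) auto
    then show "norm (v (j + int n)) \<le> (2 * C) ^ n * V" using v[of "j + int n"] by simp
  qed (use assms(2) in auto)
  finally show ?case by (simp add: algebra_simps)
qed

lemma ctrb_gram_mult:
  "ctrb_gram p j s *v w = (\<Sum>i<s. ctrb_block p j s i *v (transpose (ctrb_block p j s i) *v w))"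
proof -
  have *: "(sum F I) *v w = (\<Sum>i\<in>I. F i *v w)" for F :: "nat \<Rightarrow> real ^ 'a ^ 'a" and I
    by (induction I rule: infinite_finite_induct) (auto simp: matrix_vector_mult_add_rdistrib)
  show ?thesis unfolding ctrb_gram_def * by (simp only: matrix_vector_mul_assoc)
qed

lemma ctrb_gram_form:
  "w \<bullet> (ctrb_gram p j s *v w) = (\<Sum>i<s. (norm (transpose (ctrb_block p j s i) *v w))\<^sup>2)"
  unfolding ctrb_gram_mult inner_sum_right
  by (intro sum.cong refl) (simp only: power2_norm_eq_inner inner_transpose[symmetric])

text \<open>The minimal-norm controls \<open>\<Xi>\<^sup>T w\<close> with \<open>\<Xi> \<Xi>\<^sup>T w = -\<Phi> e\<close>.\<close>

lemma steering_controls: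
  fixes p :: "('nx::finite, 'nu::finite) lq_data"
  assumes "bounded_data p N C" "C \<ge> 1" "0 \<le> j" "j + int s \<le> N"
    and psd: "psd (ctrb_gram p j s - \<gamma> *\<^sub>R mat 1)" and "\<gamma> > 0"
  obtains v where "rollout p j e v s = 0" "\<And>k. k \<ge> j + int s \<Longrightarrow> v k = 0"
    "\<And>k. norm (v k) \<le> C ^ s / sqrt \<gamma> * norm e"
proof -
  let ?G = "ctrb_gram p j s"
  have pos: "\<gamma> * (norm w)\<^sup>2 \<le> w \<bullet> (?G *v w)" for w
  proof -
    have "0 \<le> w \<bullet> ((?G - \<gamma> *\<^sub>R mat 1) *v w)" using psd by (simp add: psd_def)
    then show ?thesis
      by (simp add: matrix_vector_mult_diff_rdistrib scaleR_matrix_vector_assoc[symmetric]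
          inner_diff_right power2_norm_eq_inner)
  qed
  have "w = 0" if "?G *v w = 0" for w
  proof -
    have "\<gamma> * (norm w)\<^sup>2 \<le> 0" using pos[of w] that by simp
    then show ?thesis using assms(6) by (simp add: mult_le_0_iff)
  qed
  then have "inj ((*v) ?G)" by (simp add: linear_injective_0[OF matrix_vector_mul_linear])
  then have "surj ((*v) ?G)" using linear_injective_imp_surjective matrix_vector_mul_linear by blast
  then obtain w where w: "?G *v w = - (transition p j s *v e)" by (metis surj_def)
  define v where "v k = (if k \<in> {j..<j + int s}
    then transpose (ctrb_block p j s (nat (j + int s - 1 - k))) *v w else 0)" for k
  have vi: "v (j + int s - 1 - int i) = transpose (ctrb_block p j s i) *v w" if "i < s" for i
    using that by (auto simp: v_def)
  show ?thesis
  proof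
    have "(\<Sum>i<s. ctrb_block p j s i *v v (j + int s - 1 - int i)) = ?G *v w"
      unfolding ctrb_gram_mult by (intro sum.cong refl) (simp add: vi)
    then show "rollout p j e v s = 0" unfolding rollout_ctrb by (simp add: w)
    show "v k = 0" if "k \<ge> j + int s" for k using that by (simp add: v_def)
    define P where "P = C ^ s * norm e"
    have P: "norm (transition p j s *v e) \<le> P" "0 \<le> P"
      unfolding P_def using norm_transition_le[OF assms(1-4)] assms(2) by auto
    have G1: "w \<bullet> (?G *v w) \<le> norm w * P"
    proof -
      have "w \<bullet> (?G *v w) \<le> norm w * norm (?G *v w)" by (rule norm_cauchy_schwarz)
      also have "\<dots> \<le> norm w * P" using P by (intro mult_left_mono) (simp_all add: w)
      finally show ?thesis .
    qed
    \<comment> \<open>The controls are \<Xi>^T w, whose squared norm is the Gramian form at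
      \<open>w\<close>. Bounding \<open>w\<close> first and then this form by Cauchy-Schwarz gives
      the factor 1 / sqrt \<gamma> instead of a bound on the blocks of \<Xi>.\<close>
    have "\<gamma> * norm w \<le> P"
    proof (cases "w = 0")
      case False
      have "(\<gamma> * norm w) * norm w \<le> P * norm w"
        using pos[of w] G1 by (simp add: power2_eq_square algebra_simps)
      then show ?thesis using False by simp
    qed (use P in simp)
    then have "norm w \<le> P / \<gamma>" using assms(6) by (simp add: field_simps)
    then have "norm w * P \<le> P / \<gamma> * P" using P(2) by (rule mult_right_mono)
    with G1 have G2: "w \<bullet> (?G *v w) \<le> P\<^sup>2 / \<gamma>" by (simp add: power2_eq_square)
    show "norm (v k) \<le> C ^ s / sqrt \<gamma> * norm e" for k
    proof (cases "k \<in> {j..<j + int s}")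
      case True
      define i where "i = nat (j + int s - 1 - k)"
      have i: "i < s" using True by (auto simp: i_def)
      have "(norm (transpose (ctrb_block p j s i) *v w))\<^sup>2 \<le> w \<bullet> (?G *v w)"
        unfolding ctrb_gram_form by (rule member_le_sum) (use i in auto)
      also note G2
      also have "P\<^sup>2 / \<gamma> = (C ^ s / sqrt \<gamma> * norm e)\<^sup>2"
        using assms(6) by (simp add: P_def power_mult_distrib power_divide)
      finally have "norm (transpose (ctrb_block p j s i) *v w) \<le> C ^ s / sqrt \<gamma> * norm e"
        by (rule power2_le_imp_le) (use assms(2,6) in auto)
      then show ?thesis using True by (simp add: v_def i_def)
    next
      case False
      then show ?thesis using assms(2,6) by (auto simp: v_def)
    qed
  qed
qed

lemma energy_le_card:
  assumes "\<And>k. norm (x k) \<le> R" "\<And>k. norm (u k) \<le> R" "a \<le> b" "b - a \<le> int n"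
  shows "energy a b x u \<le> 2 * real n * R\<^sup>2"
proof -
  have R: "0 \<le> R" using assms(1) norm_ge_zero order_trans by blast
  have "energy a b x u \<le> (\<Sum>k\<in>{a..<b}. R\<^sup>2 + R\<^sup>2)"
    unfolding energy_def using assms(1,2) R by (intro sum_mono add_mono power_mono) auto
  also have "\<dots> = real (nat (b - a)) * (2 * R\<^sup>2)" by simp
  also have "\<dots> \<le> real n * (2 * R\<^sup>2)" using assms(3,4) by (intro mult_right_mono) auto
  finally show ?thesis by simp
qed

lemma steerable_exists:
  assumes "C \<ge> 1" "\<gamma> > 0"
  shows "\<exists>K\<ge>1. \<forall>(p :: ('nx::finite, 'nu::finite) lq_data) N. bounded_data p N C \<longrightarrow>
    uniform_controllability p N t \<gamma> \<longrightarrow> steerable p N t K"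
proof -
  \<comment> \<open>\<open>V\<close> bounds the controls relative to \<open>norm e\<close>, its
    summand 1 covering the initial state too. \<open>R\<close> bounds the states after at most t
    stages, each multiplying by at most \<open>2 * C\<close>. \<open>K\<close> counts t states, t
    controls and one end state.\<close>
  define V where "V = 1 + C ^ t / sqrt \<gamma>"
  define R where "R = (2 * C) ^ t * V"
  define K where "K = (2 * real t + 1) * R\<^sup>2"
  have V: "1 \<le> V" using assms by (simp add: V_def)
  have C: "1 \<le> (2 * C) ^ t" by (rule one_le_power) (use assms in simp)
  have "1 * 1 \<le> (2 * C) ^ t * V" using V C by (intro mult_mono) auto
  then have R: "1 \<le> R" by (simp add: R_def)
  have VR: "V \<le> R" using V C mult_right_mono[of 1 "(2 * C) ^ t" V] by (simp add: R_def)
  have "1 * 1 \<le> (2 * real t + 1) * R\<^sup>2" using R by (intro mult_mono) auto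
  then have K: "1 \<le> K" by (simp add: K_def)
  have "steerable p N t K" if bd: "bounded_data p N C" and ctrb: "uniform_controllability p N t \<gamma>"
    for p :: "('nx, 'nu) lq_data" and N
    unfolding steerable_def
  proof (intro ballI allI)
    fix j e assume j: "j \<in> {0..N}"
    \<comment> \<open>\<open>n\<close> is the number of stages on which the state may be nonzero\<close>
    have "\<exists>n v. j + int n \<le> N \<and> n \<le> t \<and> (\<forall>k. norm (v k) \<le> V * norm e) \<and> (\<forall>k\<ge>j + int n. v k = 0)
       \<and> (j + int n = N \<and> N < j + int t \<or> rollout p j e v n = 0)"
    proof (cases "j + int t \<le> N")
      case True
      then have "j \<in> {0..N - int t}" using j by auto
      then obtain s where s: "s \<in> {1..t}" "psd (ctrb_gram p j s - \<gamma> *\<^sub>R mat 1)"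
        using ctrb unfolding uniform_controllability_def by blast
      have "0 \<le> j" "j + int s \<le> N" using s j True by auto
      then obtain v where v: "rollout p j e v s = 0" "\<And>k. k \<ge> j + int s \<Longrightarrow> v k = 0"
          "\<And>k. norm (v k) \<le> C ^ s / sqrt \<gamma> * norm e"
        using steering_controls[OF bd assms(1) _ _ s(2) assms(2), of e] by metis
      have "C ^ s / sqrt \<gamma> \<le> V"
        using power_increasing[of s t C] s assms by (simp add: V_def divide_right_mono add_increasing)
      then have "norm (v k) \<le> V * norm e" for k
        using v(3)[of k] by (meson mult_right_mono norm_ge_zero order_trans)
      then show ?thesis using s v(1,2) \<open>j + int s \<le> N\<close> by (intro exI[of _ s] exI[of _ v]) auto
    next
      case False
      \<comment> \<open>Fewer than t stages remain: the system runs to \<open>N\<close> with zero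
        controls.\<close>
      then show ?thesis using j V by (intro exI[of _ "nat (N - j)"] exI[of _ "\<lambda>_. 0"]) auto
    qed
    then obtain n v where n: "j + int n \<le> N" "n \<le> t" and v: "\<And>k. norm (v k) \<le> V * norm e"
      and v0: "\<And>k. k \<ge> j + int n \<Longrightarrow> v k = 0"
      and alt: "j + int n = N \<and> N < j + int t \<or> rollout p j e v n = 0" by blast
    \<comment> \<open>Cutting the state to zero after stage \<open>j + int n\<close> keeps the
      dynamics: the rollout vanishes there, or this stage is \<open>N\<close> and no transition
      follows.\<close>
    define y where "y k = (if k < j \<or> k > j + int n then 0 else rollout p j e v (nat (k - j)))" for k
    define u where "u k = (if k < j then 0 else v k)" for k
    have tr: "traj p j N y u"
      unfolding traj_def
    proof
      fix k assume k: "k \<in> {j..<N}"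
      consider "k < j + int n" | "k = j + int n" | "k > j + int n" by linarith
      then show "y (k + 1) = Am p k *v y k + Bm p k *v u k"
      proof cases
        case 1
        then show ?thesis using k traj_rollout[of p j N e v] by (auto simp: traj_def y_def u_def)
      next
        case 2
        then have "rollout p j e v n = 0" using alt k by auto
        then show ?thesis using 2 v0[of k] by (simp add: y_def u_def)
      next
        case 3
        then show ?thesis using v0[of k] k by (simp add: y_def u_def)
      qed
    qed
    have VN: "norm e \<le> V * norm e" using mult_right_mono[OF V, of "norm e"] by simp
    have ny: "norm (y k) \<le> R * norm e" for k
    proof (cases "k < j \<or> k > j + int n")
      case True
      then show ?thesis using R by (simp add: y_def)
    next
      case False
      then have i: "nat (k - j) \<le> t" "j + int (nat (k - j)) \<le> N" using n by auto
      have "norm (y k) \<le> (2 * C) ^ nat (k - j) * (V * norm e)"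
        using norm_rollout_le[OF bd assms(1) _ i(2) v VN] j False by (simp add: y_def)
      also have "\<dots> \<le> (2 * C) ^ t * (V * norm e)"
        using i(1) assms V by (intro mult_right_mono power_increasing) auto
      finally show ?thesis by (simp add: R_def algebra_simps)
    qed
    have nu: "norm (u k) \<le> R * norm e" for k
    proof -
      have "V * norm e \<le> R * norm e" using VR by (rule mult_right_mono) simp
      then show ?thesis using v[of k] order_trans[OF norm_ge_zero VN] by (auto simp: u_def)
    qed
    have yz: "y k = 0" "u k = 0" if "j + int t \<le> N" "k \<ge> j + int n" for k
    proof -
      have "rollout p j e v n = 0" using alt that by auto
      then show "y k = 0" using that by (cases "k = j + int n") (auto simp: y_def)
      show "u k = 0" using v0[OF that(2)] by (simp add: u_def)
    qed
    have E: "energy j b y u + (norm (y b))\<^sup>2 \<le> K * (norm e)\<^sup>2" if b: "b \<in> {j..N}" for b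
    proof -
      have "energy j b y u \<le> 2 * real t * (R * norm e)\<^sup>2"
      proof (cases "j + int t \<le> N")
        case True
        let ?c = "min b (j + int n)"
        have "energy j b y u = energy j ?c y u + energy ?c b y u"
          using b by (intro energy_split) auto
        also have "energy ?c b y u = 0" unfolding energy_def using yz[OF True] by (intro sum.neutral) auto
        also have "energy j ?c y u \<le> 2 * real t * (R * norm e)\<^sup>2"
          using b n by (intro energy_le_card ny nu) auto
        finally show ?thesis by simp
      next
        case False
        then show ?thesis using b by (intro energy_le_card ny nu) auto
      qed
      moreover have "(norm (y b))\<^sup>2 \<le> (R * norm e)\<^sup>2" using ny by (intro power_mono) auto
      ultimately show ?thesis by (simp add: K_def algebra_simps power_mult_distrib)
    qed
    have "y j = e" by (simp add: y_def)
    moreover have "\<forall>k\<ge>j + int t. y k = 0 \<and> u k = 0" if "j + int t \<le> N"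
      using yz[OF that] n by auto
    ultimately show "\<exists>y v. y j = e \<and> traj p j N y v \<and>
        (\<forall>b\<in>{j..N}. energy j b y v + (norm (y b))\<^sup>2 \<le> K * (norm e)\<^sup>2) \<and>
        (j + int t \<le> N \<longrightarrow> (\<forall>k\<ge>j + int t. y k = 0 \<and> v k = 0))"
      using tr E by blast
  qed
  then show ?thesis using K by blast
qed

section \<open>Energy estimates on a window\<close>

text \<open>Young's inequality with weight \<epsilon>; the first term is later absorbed by
  coercivity or by a multiplier norm.\<close>

lemma two_mult_le:
  fixes r s D \<epsilon> :: real
  assumes "\<epsilon> > 0"
  shows "2 * (D * s * r) \<le> \<epsilon> * r\<^sup>2 + D\<^sup>2 / \<epsilon> * s\<^sup>2"
proof -
  have "0 \<le> (\<epsilon> * r - D * s)\<^sup>2 / \<epsilon>" using assms by simp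
  also have "\<dots> = \<epsilon> * r\<^sup>2 + D\<^sup>2 / \<epsilon> * s\<^sup>2 - 2 * (D * s * r)"
    using assms by (simp add: field_simps power2_eq_square)
  finally show ?thesis by simp
qed

lemma two_inner_le:
  assumes "\<epsilon> > 0" "norm (f :: 'a::real_inner) \<le> D * s"
  shows "2 * \<bar>f \<bullet> y\<bar> \<le> \<epsilon> * (norm y)\<^sup>2 + D\<^sup>2 / \<epsilon> * s\<^sup>2"
proof -
  have "\<bar>f \<bullet> y\<bar> \<le> norm f * norm y" by (rule Cauchy_Schwarz_ineq2)
  also have "\<dots> \<le> D * s * norm y" using assms(2) by (rule mult_right_mono) simp
  finally show ?thesis using two_mult_le[OF assms(1), of D s "norm y"] by linarith
qed

lemma two_run_form_le:
  assumes "\<epsilon> > 0" "\<And>k z. k \<in> {a..<b} \<Longrightarrow> norm (hess p k z) \<le> D * norm z"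
  shows "2 * \<bar>run_form p a b x u y v\<bar> \<le> \<epsilon> * energy a b y v + D\<^sup>2 / \<epsilon> * energy a b x u"
proof -
  have "2 * \<bar>run_form p a b x u y v\<bar> \<le> (\<Sum>k\<in>{a..<b}. 2 * \<bar>hess p k (x k, u k) \<bullet> (y k, v k)\<bar>)"
    unfolding run_form_def sum_distrib_left[symmetric] using sum_abs by auto
  also have "\<dots> \<le> (\<Sum>k\<in>{a..<b}. \<epsilon> * (norm (y k, v k))\<^sup>2 + D\<^sup>2 / \<epsilon> * (norm (x k, u k))\<^sup>2)"
    by (intro sum_mono two_inner_le assms)
  also have "\<dots> = \<epsilon> * energy a b y v + D\<^sup>2 / \<epsilon> * energy a b x u"
    unfolding energy_def norm_Pair_sq sum_distrib_left by (simp only: sum.distrib)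
  finally show ?thesis .
qed

lemma two_form_le:
  assumes "\<epsilon> > 0" "\<And>k z. k \<in> {a..<b} \<Longrightarrow> norm (hess p k z) \<le> D * norm z"
    and "\<And>x. norm (M x) \<le> D * norm x"
  shows "2 * \<bar>run_form p a b x u y v + M (x b) \<bullet> y b\<bar>
    \<le> \<epsilon> * (energy a b y v + (norm (y b))\<^sup>2) + D\<^sup>2 / \<epsilon> * (energy a b x u + (norm (x b))\<^sup>2)"
proof -
  have "2 * \<bar>run_form p a b x u y v + M (x b) \<bullet> y b\<bar>
      \<le> 2 * \<bar>run_form p a b x u y v\<bar> + 2 * \<bar>M (x b) \<bullet> y b\<bar>"
    using abs_triangle_ineq[of "run_form p a b x u y v" "M (x b) \<bullet> y b"] by simp
  also have "\<dots> \<le> (\<epsilon> * energy a b y v + D\<^sup>2 / \<epsilon> * energy a b x u)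
      + (\<epsilon> * (norm (y b))\<^sup>2 + D\<^sup>2 / \<epsilon> * (norm (x b))\<^sup>2)"
    by (rule add_mono[OF two_run_form_le[OF assms(1,2)] two_inner_le[OF assms(1,3)]])
  finally show ?thesis by (simp only: distrib_left add_ac)
qed

text \<open>\<open>K\<close> is the cost of steering, \<open>D\<^sup>2 / \<gamma>\<^sup>2\<close>
  the energy of the corrected trajectory relative to the steering one, and 2 comes from the square
  of a sum.\<close>

definition tail_const :: "real \<Rightarrow> real \<Rightarrow> real \<Rightarrow> real" where
  "tail_const K D \<gamma> = 2 * (D\<^sup>2 / \<gamma>\<^sup>2 + 1) * K"

text \<open>Ratio of the energy before a block of t stages to the energy inside it.\<close>

definition hole_const :: "real \<Rightarrow> real \<Rightarrow> real \<Rightarrow> real" where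
  "hole_const K D \<gamma> = 2 * D * K / \<gamma>"

text \<open>A problem on the stages \<open>a..b\<close> of the horizon \<open>0..N\<close>, with terminal Hessian \<open>M\<close>.\<close>

locale lq_window =
  fixes p :: "('nx::finite, 'nu::finite) lq_data" and N :: int and t :: nat and K D \<gamma> :: real
    and a b :: int and M :: "real ^ 'nx \<Rightarrow> real ^ 'nx"
  assumes hess_bound: "\<And>k z. k \<in> {0..<N} \<Longrightarrow> norm (hess p k z) \<le> D * norm z"
    and M_bound: "\<And>x. norm (M x) \<le> D * norm x"
    and M_lin: "linear M"
    and coerc: "coercive p a b M \<gamma>"
    and steer: "steerable p N t K"
    and range: "0 \<le> a" "a \<le> b" "b \<le> N"
    and const_pos: "0 < t" "1 \<le> K" "1 \<le> D" "0 < \<gamma>"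
begin

lemma hess_bound': "j \<ge> a \<Longrightarrow> i \<le> b \<Longrightarrow> k \<in> {j..<i} \<Longrightarrow> norm (hess p k z) \<le> D * norm z"
  using hess_bound range by auto

lemma steerE:
  assumes "j \<in> {a..b}"
  obtains g w where "g j = e" "traj p j b g w"
    "\<And>i. i \<in> {j..b} \<Longrightarrow> energy j i g w + (norm (g i))\<^sup>2 \<le> K * (norm e)\<^sup>2"
    "\<And>k. j + int t \<le> b \<Longrightarrow> k \<ge> j + int t \<Longrightarrow> g k = 0 \<and> w k = 0"
proof -
  have "j \<in> {0..N}" using assms range by auto
  then obtain g w where g: "g j = e" "traj p j N g w"
    "\<forall>i\<in>{j..N}. energy j i g w + (norm (g i))\<^sup>2 \<le> K * (norm e)\<^sup>2"
    "j + int t \<le> N \<longrightarrow> (\<forall>k\<ge>j + int t. g k = 0 \<and> w k = 0)"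
    using steer unfolding steerable_def by blast
  show ?thesis
  proof (rule that[of g w])
    show "g j = e" by (rule g(1))
    show "traj p j b g w" using g(2) range by (auto intro: traj_mono)
    show "energy j i g w + (norm (g i))\<^sup>2 \<le> K * (norm e)\<^sup>2" if "i \<in> {j..b}" for i
      using g(3) that range by auto
    show "g k = 0 \<and> w k = 0" if "j + int t \<le> b" "k \<ge> j + int t" for k
      using g(4) that range by auto
  qed
qed

text \<open>Without terminal forcing the cost to go is comparable to \<open>\<parallel>x\<^sub>j\<parallel>\<^sup>2\<close>: subtracting the steering
  trajectory yields an admissible test direction on the stages \<open>j..b\<close>.\<close>

lemma forward_tail:
  assumes tr: "traj p a b x u" and adj: "adjoint_eqs p a b (\<lambda>_. 0) (\<lambda>_. 0) M 0 x u l"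
    and j: "j \<in> {a..b}"
  shows "energy j b x u + (norm (x b))\<^sup>2 \<le> tail_const K D \<gamma> * (norm (x j))\<^sup>2"
proof -
  obtain g w where g: "g j = x j" "traj p j b g w"
    "\<And>i. i \<in> {j..b} \<Longrightarrow> energy j i g w + (norm (g i))\<^sup>2 \<le> K * (norm (x j))\<^sup>2"
    using steerE[OF j, of "x j"] by metis
  define h where "h k = x k - g k" for k
  define v where "v k = u k - w k" for k
  have h: "h j = 0" "traj p j b h v"
    using g(1,2) tr j unfolding h_def v_def by (auto intro!: traj_diff intro: traj_mono)
  let ?E = "\<lambda>y v. energy j b y v + (norm (y b))\<^sup>2"
  \<comment> \<open>The solution is stationary in the admissible direction \<open>h\<close>, so the
    form of \<open>h = x - g\<close> tested with \<open>h\<close> reduces to minus that of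
    \<open>g\<close>.\<close>
  have "2 * (run_form p j b x u h v + M (x b) \<bullet> h b) = 0"
    using adjoint_weak_form[OF _ adjoint_eqs_mono[OF adj] h(2)] j h(1) by simp
  moreover have "run_form p j b h v h v = run_form p j b x u h v - run_form p j b g w h v"
    unfolding h_def v_def by (rule run_form_diff_left)
  moreover have "M (h b) \<bullet> h b = M (x b) \<bullet> h b - M (g b) \<bullet> h b"
    unfolding h_def linear_diff[OF M_lin] by (rule inner_diff_left)
  moreover define F where "F = run_form p j b g w h v + M (g b) \<bullet> h b"
  ultimately have "run_form p j b h v h v + M (h b) \<bullet> h b = - F"
    by simp
  moreover have "\<gamma> * ?E h v \<le> run_form p j b h v h v + M (h b) \<bullet> h b"
    using coercive_mono[OF coerc, of j] j h const_pos unfolding coercive_def by auto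
  moreover have "2 * \<bar>F\<bar> \<le> \<gamma> * ?E h v + D\<^sup>2 / \<gamma> * ?E g w"
    unfolding F_def using j by (intro two_form_le hess_bound'[of j b] M_bound const_pos) auto
  moreover define e1 e2 where "e1 = \<gamma> * ?E h v" and "e2 = D\<^sup>2 / \<gamma> * ?E g w"
  ultimately have "e1 \<le> - F" "2 * \<bar>F\<bar> \<le> e1 + e2" by simp_all
  \<comment> \<open>Absorption: \<open>e1\<close> is at most \<bar>F\<bar>, which is at most half of
    \<open>e1 + e2\<close>.\<close>
  then have "e1 \<le> e2" by linarith
  then have "\<gamma> * ?E h v \<le> D\<^sup>2 / \<gamma> * ?E g w" by (simp only: e1_def e2_def)
  then have Eh: "?E h v \<le> D\<^sup>2 / \<gamma>\<^sup>2 * ?E g w"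
    using const_pos by (simp add: field_simps power2_eq_square)
  have sq: "(norm (y + z))\<^sup>2 \<le> 2 * (norm y)\<^sup>2 + 2 * (norm z)\<^sup>2" for y z :: "'c::real_normed_vector"
  proof -
    have "(norm (y + z))\<^sup>2 \<le> (norm y + norm z)\<^sup>2" by (intro power_mono norm_triangle_ineq) simp
    also have "\<dots> \<le> 2 * (norm y)\<^sup>2 + 2 * (norm z)\<^sup>2"
      using sum_squares_bound[of "norm y" "norm z"] by (simp add: power2_sum)
    finally show ?thesis .
  qed
  have xhg: "x k = h k + g k" "u k = v k + w k" for k by (simp_all add: h_def v_def)
  have "energy j b x u \<le> (\<Sum>k\<in>{j..<b}. (2 * (norm (h k))\<^sup>2 + 2 * (norm (g k))\<^sup>2)
      + (2 * (norm (v k))\<^sup>2 + 2 * (norm (w k))\<^sup>2))"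
    unfolding energy_def xhg by (intro sum_mono add_mono sq)
  also have "\<dots> = 2 * energy j b h v + 2 * energy j b g w"
    by (simp add: energy_def sum.distrib sum_distrib_left algebra_simps)
  finally have "energy j b x u \<le> 2 * energy j b h v + 2 * energy j b g w" .
  moreover have "(norm (x b))\<^sup>2 \<le> 2 * (norm (h b))\<^sup>2 + 2 * (norm (g b))\<^sup>2"
    unfolding xhg by (rule sq)
  ultimately have "?E x u \<le> 2 * ?E h v + 2 * ?E g w" by simp
  also have "\<dots> \<le> 2 * (D\<^sup>2 / \<gamma>\<^sup>2 * ?E g w) + 2 * ?E g w" using Eh by simp
  also have "\<dots> = 2 * (D\<^sup>2 / \<gamma>\<^sup>2 + 1) * ?E g w" by (simp only: ring_distribs mult.assoc mult_1)
  also have "\<dots> \<le> 2 * (D\<^sup>2 / \<gamma>\<^sup>2 + 1) * (K * (norm (x j))\<^sup>2)"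
    using g(3)[of b] j by (intro mult_left_mono) auto
  finally show ?thesis by (simp add: tail_const_def mult.assoc)
qed

text \<open>A test trajectory starting at \<open>l (j - 1)\<close> makes the weak form produce the
  squared norm of that multiplier, while steerability keeps the energy of the test below
  \<open>K\<close> times the same square.\<close>

lemma dual_bound:
  assumes adj: "adjoint_eqs p a b (\<lambda>_. 0) (\<lambda>_. 0) M c x u l" and j: "j \<in> {a..b}"
  shows "(norm (l (j - 1)))\<^sup>2 \<le> 8 * K * (D\<^sup>2 * (energy j b x u + (norm (x b))\<^sup>2) + (norm c)\<^sup>2)"
proof -
  define L where "L = (norm (l (j - 1)))\<^sup>2"
  obtain g w where g: "g j = l (j - 1)" "traj p j b g w"
    "\<And>i. i \<in> {j..b} \<Longrightarrow> energy j i g w + (norm (g i))\<^sup>2 \<le> K * (norm (l (j - 1)))\<^sup>2"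
    using steerE[OF j, of "l (j - 1)"] by metis
  let ?E = "\<lambda>y v. energy j b y v + (norm (y b))\<^sup>2"
  \<comment> \<open>Two test terms, from the form and from \<open>c\<close>, each cost at most a
    quarter of \<open>L\<close>, so half of \<open>L\<close> remains.\<close>
  define \<epsilon> where "\<epsilon> = 1 / (4 * K)"
  have \<epsilon>: "\<epsilon> > 0" using const_pos by (simp add: \<epsilon>_def)
  define F where "F = run_form p j b x u g w + M (x b) \<bullet> g b"
  define S where "S = c \<bullet> g b"
  have "2 * F + S + L = 0"
    using adjoint_weak_form[OF _ adjoint_eqs_mono[OF adj] g(2)] j
    by (simp add: g(1) L_def F_def S_def power2_norm_eq_inner)
  moreover have "2 * \<bar>F\<bar> \<le> \<epsilon> * ?E g w + D\<^sup>2 / \<epsilon> * ?E x u"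
    unfolding F_def using j by (intro two_form_le hess_bound'[of j b] M_bound \<epsilon>) auto
  moreover have "2 * \<bar>S\<bar> \<le> \<epsilon> * (norm (g b))\<^sup>2 + 1\<^sup>2 / \<epsilon> * (norm c)\<^sup>2"
    unfolding S_def by (intro two_inner_le \<epsilon>) simp
  moreover have "\<epsilon> * ?E g w \<le> L / 4"
  proof -
    have "\<epsilon> * ?E g w \<le> \<epsilon> * (K * L)"
      using g(3)[of b] j \<epsilon> by (intro mult_left_mono) (auto simp: L_def)
    then show ?thesis using const_pos by (simp add: \<epsilon>_def)
  qed
  moreover have "\<epsilon> * (norm (g b))\<^sup>2 \<le> \<epsilon> * ?E g w"
    using energy_nonneg[of j b g w] \<epsilon> by (intro mult_left_mono) auto
  moreover have "D\<^sup>2 / \<epsilon> * ?E x u = 4 * K * (D\<^sup>2 * ?E x u)" "1\<^sup>2 / \<epsilon> * (norm c)\<^sup>2 = 4 * K * (norm c)\<^sup>2"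
    using const_pos by (simp_all add: \<epsilon>_def field_simps)
  moreover have "0 \<le> 4 * K * (norm c)\<^sup>2" "0 \<le> L" using const_pos by (auto simp: L_def)
  ultimately have "L \<le> L / 2 + 4 * K * (D\<^sup>2 * ?E x u) + 4 * K * (norm c)\<^sup>2"
    by linarith
  then show ?thesis by (simp add: L_def algebra_simps)
qed

text \<open>When t stages remain, the test trajectory is at rest before the end, so neither
  \<open>c\<close> nor the energy of later stages enters. Under terminal forcing the energy
  concentrates near the end, and a bound by the whole tail would show no decay.\<close>

lemma dual_bound_local:
  assumes adj: "adjoint_eqs p a b (\<lambda>_. 0) (\<lambda>_. 0) M c x u l" and j: "a \<le> j" "j + int t \<le> b"
  shows "(norm (l (j - 1)))\<^sup>2 \<le> 4 * K * D\<^sup>2 * energy j (j + int t) x u"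
proof -
  define L where "L = (norm (l (j - 1)))\<^sup>2"
  let ?i = "j + int t"
  have j': "j \<in> {a..b}" "?i \<in> {j..b}" using j by auto
  obtain g w where g: "g j = l (j - 1)" "traj p j b g w"
    "\<And>i. i \<in> {j..b} \<Longrightarrow> energy j i g w + (norm (g i))\<^sup>2 \<le> K * (norm (l (j - 1)))\<^sup>2"
    "\<And>k. k \<ge> ?i \<Longrightarrow> g k = 0 \<and> w k = 0"
    using steerE[OF j'(1), of "l (j - 1)"] j by metis
  define \<epsilon> where "\<epsilon> = 1 / (2 * K)"
  have \<epsilon>: "\<epsilon> > 0" using const_pos by (simp add: \<epsilon>_def)
  have "2 * (run_form p j b x u g w + M (x b) \<bullet> g b) + c \<bullet> g b + L = 0"
    using adjoint_weak_form[OF _ adjoint_eqs_mono[OF adj] g(2)] j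
    by (simp add: g(1) L_def power2_norm_eq_inner)
  moreover have "g b = 0" using g(4) j by simp
  moreover have "run_form p j b x u g w = run_form p j ?i x u g w + run_form p ?i b x u g w"
    using j by (intro run_form_split) auto
  moreover have "run_form p ?i b x u g w = 0" by (rule run_form_zero) (use g(4) in auto)
  ultimately have "2 * run_form p j ?i x u g w + L = 0" by simp
  moreover have "2 * \<bar>run_form p j ?i x u g w\<bar> \<le> \<epsilon> * energy j ?i g w + D\<^sup>2 / \<epsilon> * energy j ?i x u"
    using j by (intro two_run_form_le hess_bound'[of j ?i] \<epsilon>) auto
  moreover have "energy j ?i g w \<le> K * L"
    using g(3)[OF j'(2)] by (simp add: L_def) (smt (verit) zero_le_power2)
  then have "\<epsilon> * energy j ?i g w \<le> \<epsilon> * (K * L)" using \<epsilon> by (intro mult_left_mono) auto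
  moreover have "\<epsilon> * (K * L) = L / 2" "D\<^sup>2 / \<epsilon> = 2 * K * D\<^sup>2"
    using const_pos by (simp_all add: \<epsilon>_def field_simps)
  ultimately have "L \<le> L / 2 + 2 * K * D\<^sup>2 * energy j ?i x u" by simp
  then show ?thesis by (simp add: L_def algebra_simps)
qed

text \<open>Hole filling: steering to rest over the stages \<open>j..j+t\<close> truncates the trajectory, and the
  truncation error is controlled by the energy on these stages.\<close>

lemma backward_step:
  assumes tr: "traj p a b x u" and adj: "adjoint_eqs p a b (\<lambda>_. 0) (\<lambda>_. 0) M c x u l"
    and x0: "x a = 0" and j: "a \<le> j" "j + int t \<le> b"
  shows "energy a j x u \<le> hole_const K D \<gamma> * (energy a (j + int t) x u - energy a j x u)"
proof -
  let ?i = "j + int t"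
  have j': "j \<in> {a..b}" "?i \<in> {j..b}" using j by auto
  obtain g w where g: "g j = x j" "traj p j b g w"
    "\<And>i. i \<in> {j..b} \<Longrightarrow> energy j i g w + (norm (g i))\<^sup>2 \<le> K * (norm (x j))\<^sup>2"
    "\<And>k. k \<ge> ?i \<Longrightarrow> g k = 0 \<and> w k = 0"
    using steerE[OF j'(1), of "x j"] j by metis
  define h where "h k = (if k < j then x k else g k)" for k
  define v where "v k = (if k < j then u k else w k)" for k
  have h: "h a = 0" "h b = 0" using x0 g(1,4) j const_pos by (auto simp: h_def)
  have tr': "traj p a b h v"
    unfolding traj_def
  proof
    fix k assume k: "k \<in> {a..<b}"
    then have "x (k + 1) = Am p k *v x k + Bm p k *v u k" using tr by (simp add: traj_def)
    moreover have "j \<le> k \<Longrightarrow> g (k + 1) = Am p k *v g k + Bm p k *v w k"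
      using g(2) k by (simp add: traj_def)
    ultimately show "h (k + 1) = Am p k *v h k + Bm p k *v v k"
      using g(1) by (cases "k + 1 = j") (auto simp: h_def v_def)
  qed
  have split: "run_form p a b y v' h v = run_form p a j y v' h v + (run_form p j ?i y v' h v
     + run_form p ?i b y v' h v)" for y v'
    using run_form_split[of a j b p y v' h v] run_form_split[of j ?i b p y v' h v] j by simp
  have z: "run_form p ?i b y v' h v = 0" for y v'
    by (rule run_form_zero) (use g(4) in \<open>auto simp: h_def v_def\<close>)
  have s1: "run_form p a j y v' h v = run_form p a j y v' x u" for y v'
    by (rule run_form_cong) (auto simp: h_def v_def)
  have s2: "run_form p j ?i y v' h v = run_form p j ?i y v' g w" for y v'
    by (rule run_form_cong) (auto simp: h_def v_def)
  have s3: "run_form p a j h v x u = run_form p a j x u x u"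
    by (rule run_form_cong) (auto simp: h_def v_def)
  have s4: "run_form p j ?i h v g w = run_form p j ?i g w g w"
    by (rule run_form_cong) (auto simp: h_def v_def)
  \<comment> \<open>Stationarity in the truncated direction trades the indefinite cost on
    \<open>a..<j\<close> for a cross term on the t transition stages; \<open>h b = 0\<close> removes
    the terminal forcing.\<close>
  have "2 * (run_form p a b x u h v + M (x b) \<bullet> h b) = 0"
    using adjoint_weak_form[OF range(2) adj tr'] h by simp
  then have "run_form p a j x u x u = - run_form p j ?i x u g w"
    unfolding split z s1 s2 by (simp add: h)
  moreover have "\<gamma> * (energy a b h v + (norm (h b))\<^sup>2) \<le> run_form p a b h v h v + M (h b) \<bullet> h b"
    using coerc tr' h unfolding coercive_def by blast
  then have "\<gamma> * energy a b h v \<le> run_form p a j x u x u + run_form p j ?i g w g w"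
    unfolding split z s1 s2 s3 s4 by (simp add: h)
  moreover have "2 * \<bar>run_form p j ?i g w g w\<bar> \<le> D * energy j ?i g w + D\<^sup>2 / D * energy j ?i g w"
    "2 * \<bar>run_form p j ?i x u g w\<bar> \<le> D * energy j ?i g w + D\<^sup>2 / D * energy j ?i x u"
    using j const_pos by (intro two_run_form_le hess_bound'[of j ?i]; auto)+
  moreover have "D\<^sup>2 / D = D" using const_pos by (simp add: power2_eq_square)
  ultimately have 1: "2 * (\<gamma> * energy a b h v) \<le> 3 * (D * energy j ?i g w) + D * energy j ?i x u"
    by simp
  have "energy a j x u = energy a j h v" by (rule energy_cong) (auto simp: h_def v_def)
  also have "\<dots> \<le> energy a b h v" using j by (intro energy_mono) auto
  finally have 2: "\<gamma> * energy a j x u \<le> \<gamma> * energy a b h v" using const_pos by (intro mult_left_mono) auto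
  have "energy j ?i g w \<le> K * (norm (x j))\<^sup>2"
    using g(3)[OF j'(2)] by (smt (verit) zero_le_power2)
  \<comment> \<open>Stage \<open>j\<close> itself lies in the block since t is positive; this closes
    the estimate in terms of the block energy alone.\<close>
  also have "(norm (x j))\<^sup>2 \<le> energy j ?i x u"
    using energy_ge[of j j ?i x u] const_pos by (smt (verit) atLeastLessThan_iff of_nat_0_less_iff zero_le_power2)
  then have "K * (norm (x j))\<^sup>2 \<le> K * energy j ?i x u" using const_pos by (intro mult_left_mono) auto
  finally have "D * energy j ?i g w \<le> D * (K * energy j ?i x u)"
    using const_pos by (intro mult_left_mono) auto
  moreover have "D * (1 * energy j ?i x u) \<le> D * (K * energy j ?i x u)"
    using const_pos energy_nonneg[of j ?i x u] by (intro mult_left_mono mult_right_mono) auto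
  ultimately have "\<gamma> * energy a j x u \<le> 2 * (D * (K * energy j ?i x u))" using 1 2 by simp
  then have "energy a j x u \<le> hole_const K D \<gamma> * energy j ?i x u"
    using const_pos by (simp add: hole_const_def field_simps)
  then show ?thesis using energy_split[of a j ?i x u] j by simp
qed

text \<open>With zero initial state the solution is its own admissible test direction.\<close>

lemma backward_total:
  assumes tr: "traj p a b x u" and adj: "adjoint_eqs p a b (\<lambda>_. 0) (\<lambda>_. 0) M c x u l"
    and x0: "x a = 0"
  shows "energy a b x u + (norm (x b))\<^sup>2 \<le> (norm c)\<^sup>2 / \<gamma>\<^sup>2"
proof -
  let ?E = "energy a b x u + (norm (x b))\<^sup>2"
  have "2 * (run_form p a b x u x u + M (x b) \<bullet> x b) + c \<bullet> x b = 0"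
    using adjoint_weak_form[OF range(2) adj tr] x0 by simp
  moreover have "\<gamma> * ?E \<le> run_form p a b x u x u + M (x b) \<bullet> x b"
    using coerc tr x0 unfolding coercive_def by blast
  moreover have "2 * \<bar>c \<bullet> x b\<bar> \<le> \<gamma> * (norm (x b))\<^sup>2 + 1\<^sup>2 / \<gamma> * (norm c)\<^sup>2"
    using const_pos by (intro two_inner_le) auto
  moreover have "\<gamma> * (norm (x b))\<^sup>2 \<le> \<gamma> * ?E"
    using const_pos energy_nonneg[of a b x u] by (intro mult_left_mono) auto
  moreover have "0 \<le> \<gamma> * ?E" using const_pos energy_nonneg[of a b x u] by simp
  ultimately have "\<gamma> * ?E \<le> 1 / \<gamma> * (norm c)\<^sup>2" by simp
  then show ?thesis using const_pos by (simp add: field_simps power2_eq_square)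
qed

end

section \<open>Second-order sufficiency of the subproblems\<close>

lemma bilinear_sum_expand:
  assumes "linear L"
  shows "(\<Sum>i<d::nat. c i *\<^sub>R f i) \<bullet> L (\<Sum>i<d. c i *\<^sub>R f i) = (\<Sum>i<d. \<Sum>j<d. c i * (f i \<bullet> L (f j)) * c j)"
proof -
  have "f i \<bullet> L (\<Sum>j<d. c j *\<^sub>R f j) = (\<Sum>j<d. (f i \<bullet> L (f j)) * c j)" for i
    by (simp add: linear_sum[OF assms] linear_scale[OF assms] inner_sum_right mult.commute)
  then show ?thesis by (simp add: inner_sum_left sum_distrib_left mult.assoc)
qed

lemma traj_form_expand:
  fixes Z :: "nat \<Rightarrow> (int \<Rightarrow> real ^ 'nx::finite) \<times> (int \<Rightarrow> real ^ 'nu::finite)"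
    and L :: "int \<Rightarrow> (real ^ 'nx) \<times> (real ^ 'nu) \<Rightarrow> (real ^ 'nx) \<times> (real ^ 'nu)"
  assumes L: "\<And>k. linear (L k)" "linear L'"
    and x: "\<forall>k\<in>{0..N}. x k = (\<Sum>j<d. c j *\<^sub>R fst (Z j) k)"
    and u: "\<forall>k\<in>{0..<N}. u k = (\<Sum>j<d. c j *\<^sub>R snd (Z j) k)" and N: "0 \<le> N"
  shows "(\<Sum>k\<in>{0..<N}. (x k, u k) \<bullet> L k (x k, u k)) + x N \<bullet> L' (x N)
    = (\<Sum>i<d. \<Sum>j<d. c i * ((\<Sum>k\<in>{0..<N}. (fst (Z i) k, snd (Z i) k) \<bullet> L k (fst (Z j) k, snd (Z j) k))
        + fst (Z i) N \<bullet> L' (fst (Z j) N)) * c j)"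
proof -
  have pair: "(x k, u k) = (\<Sum>j<d. c j *\<^sub>R (fst (Z j) k, snd (Z j) k))" if "k \<in> {0..<N}" for k
    using x u that by (auto simp: prod_eq_iff fst_sum snd_sum)
  have "(\<Sum>k\<in>{0..<N}. (x k, u k) \<bullet> L k (x k, u k))
    = (\<Sum>k\<in>{0..<N}. \<Sum>i<d. \<Sum>j<d. c i * ((fst (Z i) k, snd (Z i) k) \<bullet> L k (fst (Z j) k, snd (Z j) k)) * c j)"
    by (intro sum.cong refl) (simp only: pair bilinear_sum_expand[OF L(1)])
  also have "\<dots> = (\<Sum>i<d. \<Sum>k\<in>{0..<N}. \<Sum>j<d. c i * ((fst (Z i) k, snd (Z i) k) \<bullet> L k (fst (Z j) k, snd (Z j) k)) * c j)"
    by (rule sum.swap)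
  also have "\<dots> = (\<Sum>i<d. \<Sum>j<d. \<Sum>k\<in>{0..<N}. c i * ((fst (Z i) k, snd (Z i) k) \<bullet> L k (fst (Z j) k, snd (Z j) k)) * c j)"
    by (intro sum.cong refl sum.swap)
  also have "\<dots> = (\<Sum>i<d. \<Sum>j<d. c i * (\<Sum>k\<in>{0..<N}. (fst (Z i) k, snd (Z i) k) \<bullet> L k (fst (Z j) k, snd (Z j) k)) * c j)"
    by (simp only: sum_distrib_left sum_distrib_right)
  finally have 1: "(\<Sum>k\<in>{0..<N}. (x k, u k) \<bullet> L k (x k, u k)) = \<dots>" .
  have "x N = (\<Sum>j<d. c j *\<^sub>R fst (Z j) N)" using x N by simp
  then have 2: "x N \<bullet> L' (x N) = (\<Sum>i<d. \<Sum>j<d. c i * (fst (Z i) N \<bullet> L' (fst (Z j) N)) * c j)"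
    by (simp only: bilinear_sum_expand[OF L(2)])
  show ?thesis unfolding 1 2 sum.distrib[symmetric] by (simp only: ring_distribs)
qed

text \<open>In coordinates of the orthonormal basis the energy is the sum of squared coefficients,
  and the form is that of \<open>Z\<^sup>T H Z\<close>; both follow from
  \<open>traj_form_expand\<close>, with the identity and with the Hessians.\<close>

lemma uniform_sosc_coercive:
  assumes "uniform_sosc p N \<gamma>" "0 \<le> N"
  shows "coercive p 0 N ((*v) (Qm p N)) \<gamma>"
  unfolding coercive_def
proof (intro allI impI)
  fix x u assume xu: "x 0 = 0" "traj p 0 N x u"
  obtain d Z where Z: "orthonormal_null_basis p N d Z"
    and pos: "\<And>c :: nat \<Rightarrow> real.
      \<gamma> * (\<Sum>i<d. (c i)\<^sup>2) \<le> (\<Sum>i<d. \<Sum>j<d. c i * traj_hess p N (Z i) (Z j) * c j)"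
    using assms(1) unfolding uniform_sosc_def by blast
  have "null_traj p N (x, u)" using xu by (simp add: null_traj_def traj_def)
  then obtain c where c: "\<forall>k\<in>{0..N}. x k = (\<Sum>j<d. c j *\<^sub>R fst (Z j) k)"
      "\<forall>k\<in>{0..<N}. u k = (\<Sum>j<d. c j *\<^sub>R snd (Z j) k)"
    using Z unfolding orthonormal_null_basis_def by force
  have "energy 0 N x u + (norm (x N))\<^sup>2 = (\<Sum>k\<in>{0..<N}. (x k, u k) \<bullet> id (x k, u k)) + x N \<bullet> id (x N)"
    by (simp add: energy_def power2_norm_eq_inner)
  also have "\<dots> = (\<Sum>i<d. \<Sum>j<d. c i * traj_inner N (Z i) (Z j) * c j)"
    using traj_form_expand[where L = "\<lambda>_. id" and L' = id, OF linear_id linear_id c assms(2)]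
    by (simp only: id_apply traj_inner_def)
  also have "\<dots> = (\<Sum>i<d. \<Sum>j<d. if i = j then (c i)\<^sup>2 else 0)"
    using Z by (intro sum.cong refl) (auto simp: orthonormal_null_basis_def power2_eq_square)
  also have "\<dots> = (\<Sum>i<d. (c i)\<^sup>2)" by simp
  finally have 1: "energy 0 N x u + (norm (x N))\<^sup>2 = (\<Sum>i<d. (c i)\<^sup>2)" .
  have "run_form p 0 N x u x u + (Qm p N *v x N) \<bullet> x N
      = (\<Sum>k\<in>{0..<N}. (x k, u k) \<bullet> hess p k (x k, u k)) + x N \<bullet> (Qm p N *v x N)"
    unfolding run_form_def by (simp add: inner_commute)
  also have "\<dots> = (\<Sum>i<d. \<Sum>j<d. c i * traj_hess p N (Z i) (Z j) * c j)"
    using traj_form_expand[where L = "hess p" and L' = "(*v) (Qm p N)",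
        OF linear_hess matrix_vector_mul_linear c assms(2)]
    by (simp only: traj_hess_def)
  finally show "\<gamma> * (energy 0 N x u + (norm (x N))\<^sup>2)
      \<le> run_form p 0 N x u x u + (Qm p N *v x N) \<bullet> x N"
    using pos[of c] 1 by simp
qed

lemma norm_Qm_le:
  assumes "bounded_data p N C" "k \<in> {0..N}"
  shows "norm (Qm p k *v x) \<le> C * norm x"
proof (cases "k = N")
  case True
  then show ?thesis using assms(1) by (simp add: bounded_data_def)
next
  case False
  then have "norm (hess p k (x, 0)) \<le> C * norm (x, 0 :: real ^ 'b)"
    using assms by (intro bounded_dataD(1)) auto
  moreover have "norm (Qm p k *v x) \<le> norm (hess p k (x, 0))"
    using norm_fst_le[of "Qm p k *v x" "Sm p k *v x"] by (simp add: hess_def)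
  ultimately show ?thesis by simp
qed

text \<open>A trajectory on \<open>a..b\<close> is extended to the full horizon by steering it to rest; the cost of doing
  so is compensated by the penalty.\<close>

lemma coercive_penalized:
  assumes co: "coercive p 0 N ((*v) (Qm p N)) \<gamma>" "0 \<le> \<gamma>"
    and st: "steerable p N t K" and bd: "bounded_data p N C" "1 \<le> C"
    and ab: "0 \<le> a" "a \<le> b" "b < N" and \<mu>: "C * K + C \<le> \<mu> / 2"
  shows "coercive p a b (\<lambda>x. Qm p b *v x + (\<mu> / 2) *\<^sub>R x) \<gamma>"
  unfolding coercive_def
proof (intro allI impI)
  fix x u assume xu: "x a = 0" "traj p a b x u"
  have "b \<in> {0..N}" using ab by auto
  then obtain g w where g: "g b = x b" "traj p b N g w"
    "energy b N g w + (norm (g N))\<^sup>2 \<le> K * (norm (x b))\<^sup>2"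
    using st ab unfolding steerable_def by (metis atLeastAtMost_iff order_refl)
  define y where "y k = (if k < b then x k else g k)" for k
  define v where "v k = (if k < b then u k else w k)" for k
  have "traj p a N y v"
    unfolding traj_def
  proof
    fix k assume k: "k \<in> {a..<N}"
    have "k < b \<Longrightarrow> x (k + 1) = Am p k *v x k + Bm p k *v u k"
      using xu k by (simp add: traj_def)
    moreover have "b \<le> k \<Longrightarrow> g (k + 1) = Am p k *v g k + Bm p k *v w k"
      using g(2) k by (simp add: traj_def)
    ultimately show "y (k + 1) = Am p k *v y k + Bm p k *v v k"
      using g(1) by (cases "k + 1 = b") (auto simp: y_def v_def)
  qed
  moreover have "y a = 0" using xu g(1) ab by (auto simp: y_def)
  moreover have "coercive p a N ((*v) (Qm p N)) \<gamma>" using ab co by (intro coercive_mono[OF co(1)]) auto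
  ultimately have main: "\<gamma> * (energy a N y v + (norm (y N))\<^sup>2)
      \<le> run_form p a N y v y v + (Qm p N *v y N) \<bullet> y N"
    unfolding coercive_def by blast
  have yN: "y N = g N" using ab by (simp add: y_def)
  have "energy a N y v = energy a b y v + energy b N y v" using ab by (intro energy_split) auto
  moreover have "energy a b y v = energy a b x u" "energy b N y v = energy b N g w"
    by (intro energy_cong; simp add: y_def v_def)+
  \<comment> \<open>Since \<open>b < N\<close>, the end state of the window is the first running
    state of the extension, so no energy is lost.\<close>
  moreover have "(norm (x b))\<^sup>2 \<le> energy b N g w"
    using energy_ge[of b b N g w] ab g(1) by (smt (verit) atLeastLessThan_iff zero_le_power2)
  ultimately have "energy a b x u + (norm (x b))\<^sup>2 \<le> energy a N y v + (norm (y N))\<^sup>2"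
    using zero_le_power2[of "norm (y N)"] by linarith
  then have E: "\<gamma> * (energy a b x u + (norm (x b))\<^sup>2) \<le> \<gamma> * (energy a N y v + (norm (y N))\<^sup>2)"
    using co(2) by (rule mult_left_mono)
  have "run_form p a N y v y v = run_form p a b y v y v + run_form p b N y v y v"
    using ab by (intro run_form_split) auto
  moreover have "run_form p a b y v y v = run_form p a b x u x u"
    "run_form p b N y v y v = run_form p b N g w g w"
    by (intro run_form_cong; simp add: y_def v_def)+
  moreover have "2 * \<bar>run_form p b N g w g w + (Qm p N *v g N) \<bullet> g N\<bar>
      \<le> C * (energy b N g w + (norm (g N))\<^sup>2) + C\<^sup>2 / C * (energy b N g w + (norm (g N))\<^sup>2)"
    using bd ab by (intro two_form_le bounded_dataD[OF bd(1)] norm_Qm_le[OF bd(1)]) auto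
  then have "run_form p b N g w g w + (Qm p N *v g N) \<bullet> g N \<le> C * (energy b N g w + (norm (g N))\<^sup>2)"
    using bd(2) by (simp add: power2_eq_square)
  moreover have "C * (energy b N g w + (norm (g N))\<^sup>2) \<le> C * (K * (norm (x b))\<^sup>2)"
    using g(3) bd(2) by (intro mult_left_mono) auto
  ultimately have R: "run_form p a N y v y v + (Qm p N *v y N) \<bullet> y N
      \<le> run_form p a b x u x u + C * K * (norm (x b))\<^sup>2" by (simp add: yN)
  have "2 * \<bar>(Qm p b *v x b) \<bullet> x b\<bar> \<le> C * (norm (x b))\<^sup>2 + C\<^sup>2 / C * (norm (x b))\<^sup>2"
    using bd ab by (intro two_inner_le norm_Qm_le[OF bd(1)]) auto
  then have "- (C * (norm (x b))\<^sup>2) \<le> (Qm p b *v x b) \<bullet> x b"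
    using bd(2) by (simp add: power2_eq_square)
  \<comment> \<open>Origin of the threshold on \<mu>: \<open>C * K\<close> pays for the extension,
    and \<open>C\<close> for a possibly negative \<open>Qm p b\<close>.\<close>
  moreover have "(C * K + C) * (norm (x b))\<^sup>2 \<le> \<mu> / 2 * (norm (x b))\<^sup>2"
    using \<mu> by (rule mult_right_mono) simp
  ultimately have "C * K * (norm (x b))\<^sup>2 \<le> (Qm p b *v x b + (\<mu> / 2) *\<^sub>R x b) \<bullet> x b"
    by (simp add: inner_add_left power2_norm_eq_inner ring_distribs)
  with main E R show "\<gamma> * (energy a b x u + (norm (x b))\<^sup>2)
      \<le> run_form p a b x u x u + (Qm p b *v x b + (\<mu> / 2) *\<^sub>R x b) \<bullet> x b" by linarith
qed

section \<open>Exponential decay\<close>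

lemma geometric_forward:
  fixes E :: "int \<Rightarrow> real"
  assumes step: "\<And>j. j \<in> {a..<b} \<Longrightarrow> E (j + 1) \<le> r * E j" and r: "0 \<le> r" and k: "a \<le> k" "k \<le> b"
  shows "E k \<le> r ^ nat (k - a) * E a"
  using k
proof (induction k rule: int_ge_induct)
  case (step i)
  have "E (i + 1) \<le> r * E i" using step by (intro assms(1)) auto
  also have "\<dots> \<le> r * (r ^ nat (i - a) * E a)" using step r by (intro mult_left_mono) auto
  also have "\<dots> = r ^ nat (i + 1 - a) * E a"
    using step.hyps by (simp add: Suc_nat_eq_nat_zadd1 flip: power_Suc mult.assoc) (simp add: algebra_simps)
  finally show ?case .
qed simp

text \<open>Steps of length t leave fewer than t stages at the end, where only monotonicity applies;
  the factor \<open>r ^ t\<close> on the left pays for them.\<close>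

lemma geometric_backward:
  fixes F :: "int \<Rightarrow> real"
  assumes mono: "\<And>j. j \<in> {a..b} \<Longrightarrow> F j \<le> F b" and pos: "0 \<le> F b"
    and step: "\<And>j. a \<le> j \<Longrightarrow> j + int t \<le> b \<Longrightarrow> F j \<le> r ^ t * F (j + int t)"
    and r: "0 \<le> r" "r \<le> 1" and t: "t > 0" and k: "k \<in> {a..b}"
  shows "r ^ t * F k \<le> r ^ nat (b - k) * F b"
  using k
proof (induction "nat (b - k)" arbitrary: k rule: less_induct)
  case less
  show ?case
  proof (cases "k + int t \<le> b")
    case True
    have e: "nat (b - k) = t + nat (b - (k + int t))" using True by auto
    have "r ^ t * F k \<le> r ^ t * (r ^ t * F (k + int t))"
      using True less.prems r by (intro mult_left_mono step) auto
    also have "\<dots> \<le> r ^ t * (r ^ nat (b - (k + int t)) * F b)"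
      using True less.prems r t by (intro mult_left_mono less.hyps) auto
    finally show ?thesis unfolding e power_add by (simp add: mult.assoc)
  next
    case False
    have "r ^ t * F k \<le> r ^ t * F b" using less.prems r by (intro mult_left_mono mono) auto
    also have "\<dots> \<le> r ^ nat (b - k) * F b"
      using False r pos by (intro mult_right_mono power_decreasing) auto
    finally show ?thesis .
  qed
qed

section \<open>Stage norms\<close>

lemma stage_norm_le:
  assumes "a \<le> k \<Longrightarrow> norm (st w k) \<le> B" "a \<le> k \<Longrightarrow> k < b \<Longrightarrow> norm (ct w k) \<le> B"
    "k < b \<Longrightarrow> norm (mult w k) \<le> B" "a \<le> b"
  shows "stage_norm a b k w \<le> B"
  using assms by (auto simp: stage_norm_def)

lemma stage_norm_nonneg: "0 \<le> stage_norm a b k w"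
  by (simp add: stage_norm_def le_max_iff_disj)

lemma norm_le_stage_norm:
  "a \<le> k \<Longrightarrow> norm (st w k) \<le> stage_norm a b k w"
  "a \<le> k \<Longrightarrow> k < b \<Longrightarrow> norm (ct w k) \<le> stage_norm a b k w"
  "a \<le> b \<Longrightarrow> k < b \<Longrightarrow> norm (mult w k) \<le> stage_norm a b k w"
  by (auto simp: stage_norm_def)

lemma stage_norm_triangle:
  assumes "a \<le> b"
  shows "stage_norm a b k (pd_diff y z) \<le> stage_norm a b k (pd_diff y w) + stage_norm a b k (pd_diff w z)"
proof -
  have *: "norm (f - h) \<le> B + B'" if "norm (f - g) \<le> B" "norm (g - h) \<le> B'"
    for f g h :: "'c::real_normed_vector" and B B'
    using norm_triangle_ineq[of "f - g" "g - h"] that by simp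
  note n = norm_le_stage_norm[where a = a and b = b and k = k and w = "pd_diff y w"]
    norm_le_stage_norm[where a = a and b = b and k = k and w = "pd_diff w z"]
  show ?thesis
    by (rule stage_norm_le; use n assms in \<open>simp add: pd_diff_def\<close>; intro *; simp)
qed

text \<open>The dual bound applied to the tail energy, followed by a square root; it also dominates
  states and controls.\<close>

definition fwd_const :: "real \<Rightarrow> real \<Rightarrow> real \<Rightarrow> real" where
  "fwd_const K D \<gamma> = sqrt (8 * K * D\<^sup>2 * tail_const K D \<gamma>)"

text \<open>The exponent \<open>2 * t + 1\<close> collects the losses at a multiplier: t from
  \<open>geometric_backward\<close>, t from the length of the local test trajectory, and 1 because
  \<open>l k\<close> is tested from stage \<open>k + 1\<close>.\<close>

definition bwd_const :: "real \<Rightarrow> real \<Rightarrow> real \<Rightarrow> nat \<Rightarrow> real \<Rightarrow> real" where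
  "bwd_const K D \<gamma> t \<rho> = sqrt (8 * K * (D\<^sup>2 / \<gamma>\<^sup>2 + 1) / (\<rho>\<^sup>2) ^ (2 * t + 1))"

text \<open>The two conditions on \<rho> are the contraction factors of the tail energy over one
  stage and of the initial energy over t stages.\<close>

locale lq_decay = lq_window +
  fixes \<rho> :: real
  assumes rho: "0 < \<rho>" "\<rho> < 1" "1 - 1 / tail_const K D \<gamma> \<le> \<rho>\<^sup>2"
    "hole_const K D \<gamma> / (1 + hole_const K D \<gamma>) \<le> (\<rho>\<^sup>2) ^ t"
begin

lemma rho_sq: "0 < \<rho>\<^sup>2" "\<rho>\<^sup>2 \<le> 1" "\<rho>\<^sup>2 < 1"
  using rho by (auto simp: power_le_one power_less_one_iff)

lemma tail_const_ge: "2 \<le> tail_const K D \<gamma>"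
proof -
  have "2 * 1 * 1 \<le> 2 * (D\<^sup>2 / \<gamma>\<^sup>2 + 1) * K" using const_pos by (intro mult_mono) auto
  then show ?thesis by (simp add: tail_const_def)
qed

lemma rho_powi_sq: "0 \<le> n \<Longrightarrow> (\<rho> powi n)\<^sup>2 = (\<rho>\<^sup>2) ^ nat n"
  by (simp add: power_int_def mult.commute flip: power_mult)

lemma forward_decay:
  assumes tr: "traj p a b x u" and adj: "adjoint_eqs p a b (\<lambda>_. 0) (\<lambda>_. 0) M 0 x u l"
    and k: "k \<in> {a..b}"
  shows "energy k b x u + (norm (x b))\<^sup>2 \<le> (\<rho>\<^sup>2) ^ nat (k - a) * (tail_const K D \<gamma> * (norm (x a))\<^sup>2)"
proof -
  define E where "E j = energy j b x u + (norm (x b))\<^sup>2" for j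
  let ?c = "tail_const K D \<gamma>"
  have "E (j + 1) \<le> \<rho>\<^sup>2 * E j" if j: "j \<in> {a..<b}" for j
  proof -
    have "E j \<le> ?c * (norm (x j))\<^sup>2" unfolding E_def using forward_tail[OF tr adj, of j] j by simp
    moreover have "E j = (norm (x j))\<^sup>2 + (norm (u j))\<^sup>2 + E (j + 1)"
      unfolding E_def using energy_first[of j b x u] j by simp
    \<comment> \<open>The drop of the tail energy over stage \<open>j\<close> contains the squared
      norm of \<open>x j\<close>, which bounds the whole tail.\<close>
    ultimately have "E j \<le> ?c * (E j - E (j + 1))"
      using tail_const_ge by (smt (verit) mult_left_mono zero_le_power2)
    then have "E (j + 1) \<le> (1 - 1 / ?c) * E j"
      using tail_const_ge by (simp add: field_simps)
    also have "\<dots> \<le> \<rho>\<^sup>2 * E j"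
      using rho(3) energy_nonneg[of j b x u] by (intro mult_right_mono) (auto simp: E_def)
    finally show ?thesis .
  qed
  then have "E k \<le> (\<rho>\<^sup>2) ^ nat (k - a) * E a" using k by (intro geometric_forward[of a b]) auto
  also have "\<dots> \<le> (\<rho>\<^sup>2) ^ nat (k - a) * (?c * (norm (x a))\<^sup>2)"
    unfolding E_def using forward_tail[OF tr adj, of a] range by (intro mult_left_mono) auto
  finally show ?thesis by (simp add: E_def)
qed

lemma backward_decay:
  assumes tr: "traj p a b x u" and adj: "adjoint_eqs p a b (\<lambda>_. 0) (\<lambda>_. 0) M c x u l"
    and x0: "x a = 0" and k: "k \<in> {a..b}"
  shows "(\<rho>\<^sup>2) ^ t * energy a k x u \<le> (\<rho>\<^sup>2) ^ nat (b - k) * ((norm c)\<^sup>2 / \<gamma>\<^sup>2)"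
proof -
  let ?F = "\<lambda>k. energy a k x u" and ?h = "hole_const K D \<gamma>"
  have h: "0 < ?h" using const_pos by (simp add: hole_const_def)
  have "?F j \<le> (\<rho>\<^sup>2) ^ t * ?F (j + int t)" if "a \<le> j" "j + int t \<le> b" for j
  proof -
    have "?F j \<le> ?h * (?F (j + int t) - ?F j)" by (rule backward_step[OF tr adj x0 that])
    then have "?F j \<le> ?h / (1 + ?h) * ?F (j + int t)" using h by (simp add: field_simps)
    also have "\<dots> \<le> (\<rho>\<^sup>2) ^ t * ?F (j + int t)" using rho(4) energy_nonneg by (rule mult_right_mono)
    finally show ?thesis .
  qed
  then have "(\<rho>\<^sup>2) ^ t * ?F k \<le> (\<rho>\<^sup>2) ^ nat (b - k) * ?F b"
    using k rho_sq const_pos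
    by (intro geometric_backward[where a = a]) (auto intro: energy_mono energy_nonneg)
  also have "\<dots> \<le> (\<rho>\<^sup>2) ^ nat (b - k) * ((norm c)\<^sup>2 / \<gamma>\<^sup>2)"
    using backward_total[OF tr adj x0] by (intro mult_left_mono) (smt (verit) zero_le_power2, simp)
  finally show ?thesis .
qed

lemma stage_norm_forward:
  assumes tr: "traj p a b (st w) (ct w)"
    and adj: "adjoint_eqs p a b (\<lambda>_. 0) (\<lambda>_. 0) M 0 (st w) (ct w) (mult w)"
    and k: "k \<in> {a - 1..b}"
  shows "stage_norm a b k w \<le> fwd_const K D \<gamma> * (\<rho> powi (k - a) * norm (st w a))"
proof -
  let ?x = "st w" and ?u = "ct w" and ?l = "mult w"
  let ?E = "\<lambda>j. energy j b ?x ?u + (norm (?x b))\<^sup>2"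
  define B where "B = fwd_const K D \<gamma> * (\<rho> powi (k - a) * norm (?x a))"
  have tc: "0 \<le> tail_const K D \<gamma>" using tail_const_ge by simp
  have KD: "1 \<le> 8 * K * D\<^sup>2" using const_pos mult_mono[of 1 "8 * K" 1 "D\<^sup>2"] by simp
  have "0 \<le> fwd_const K D \<gamma>" using tc const_pos by (simp add: fwd_const_def)
  then have B0: "0 \<le> B" using rho by (simp add: B_def)
  have B2: "B\<^sup>2 = 8 * K * D\<^sup>2 * ((\<rho> powi (k - a))\<^sup>2 * (tail_const K D \<gamma> * (norm (?x a))\<^sup>2))"
    using tc const_pos by (simp add: B_def fwd_const_def power_mult_distrib)
  have EB: "8 * K * D\<^sup>2 * ?E k \<le> B\<^sup>2" if "a \<le> k"
    unfolding B2 using forward_decay[OF tr adj, of k] that k const_pos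
    by (intro mult_left_mono) (auto simp: rho_powi_sq)
  have E0: "0 \<le> ?E k" using energy_nonneg[of k b ?x ?u] by simp
  have EB': "?E k \<le> B\<^sup>2" if "a \<le> k"
    using order_trans[OF mult_right_mono[OF KD E0] EB[OF that]] by simp
  have xu: "(norm (?x k))\<^sup>2 + (norm (?u k))\<^sup>2 \<le> ?E k" if "a \<le> k" "k < b"
    using energy_ge[of k k b ?x ?u] that by (simp add: add_increasing2)
  have "(norm (?x k))\<^sup>2 \<le> B\<^sup>2" if "a \<le> k"
  proof (cases "k = b")
    case True then show ?thesis using EB'[OF that] energy_nonneg[of k b ?x ?u] by simp
  next
    case False then show ?thesis using EB'[OF that] xu that k by (smt (verit) atLeastAtMost_iff zero_le_power2)
  qed
  moreover have "(norm (?u k))\<^sup>2 \<le> B\<^sup>2" if "a \<le> k" "k < b"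
    using EB'[OF that(1)] xu[OF that] by (smt (verit) zero_le_power2)
  moreover have "(norm (?l k))\<^sup>2 \<le> B\<^sup>2" if "k < b"
  proof -
    have 1: "(norm (?l k))\<^sup>2 \<le> 8 * K * D\<^sup>2 * ?E (k + 1)"
      using dual_bound[OF adj, of "k + 1"] that k by (simp add: mult.assoc)
    show ?thesis
    proof (cases "a \<le> k")
      case True
      have "energy (k + 1) b ?x ?u \<le> energy k b ?x ?u" by (rule energy_mono) auto
      then have "8 * K * D\<^sup>2 * ?E (k + 1) \<le> 8 * K * D\<^sup>2 * ?E k"
        using const_pos by (intro mult_left_mono) auto
      then show ?thesis using 1 EB[OF True] by linarith
    next
      case False
      then have ka: "k = a - 1" using k by auto
      \<comment> \<open>Stage \<open>a - 1\<close> holds only the multiplier of the initial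
        condition; the exponent -1 gives a weight above 1, so the undecayed bound at
        \<open>a\<close> suffices.\<close>
      have "1 \<le> (\<rho> powi (k - a))\<^sup>2" using rho_sq by (simp add: ka power_int_minus field_simps)
      then have "1 * (tail_const K D \<gamma> * (norm (?x a))\<^sup>2) \<le> (\<rho> powi (k - a))\<^sup>2 * (tail_const K D \<gamma> * (norm (?x a))\<^sup>2)"
        using tc by (intro mult_right_mono) auto
      then have "?E (k + 1) \<le> (\<rho> powi (k - a))\<^sup>2 * (tail_const K D \<gamma> * (norm (?x a))\<^sup>2)"
        using forward_tail[OF tr adj, of a] range by (simp add: ka)
      then have "8 * K * D\<^sup>2 * ?E (k + 1) \<le> B\<^sup>2"
        unfolding B2 using const_pos by (intro mult_left_mono) auto
      then show ?thesis using 1 by linarith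
    qed
  qed
  ultimately have "stage_norm a b k w \<le> B"
    using B0 range by (intro stage_norm_le) (auto intro: power2_le_imp_le)
  then show ?thesis by (simp add: B_def)
qed

lemma stage_norm_backward:
  assumes tr: "traj p a b (st w) (ct w)"
    and adj: "adjoint_eqs p a b (\<lambda>_. 0) (\<lambda>_. 0) M c (st w) (ct w) (mult w)"
    and x0: "st w a = 0" and k: "k \<in> {a - 1..b}"
  shows "stage_norm a b k w \<le> bwd_const K D \<gamma> t \<rho> * (\<rho> powi (b - k) * norm c)"
proof -
  let ?x = "st w" and ?u = "ct w" and ?l = "mult w" and ?r = "\<rho>\<^sup>2"
  define B where "B = bwd_const K D \<gamma> t \<rho> * (\<rho> powi (b - k) * norm c)"
  define G where "G = (norm c)\<^sup>2 / \<gamma>\<^sup>2"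
  define H where "H = 8 * K * (D\<^sup>2 * G + (norm c)\<^sup>2)"
  have G: "0 \<le> G" by (simp add: G_def)
  have "0 \<le> bwd_const K D \<gamma> t \<rho>" using const_pos by (simp add: bwd_const_def)
  then have B0: "0 \<le> B" using rho by (simp add: B_def)
  have B2: "?r ^ (2 * t + 1) * B\<^sup>2 = ?r ^ nat (b - k) * H"
    using k const_pos rho
    by (simp add: B_def H_def G_def bwd_const_def power_mult_distrib rho_powi_sq field_simps)
  have "1 * G \<le> (8 * K * D\<^sup>2) * G"
    using const_pos mult_mono[of 1 "8 * K" 1 "D\<^sup>2"] G by (intro mult_right_mono) auto
  moreover have "0 \<le> 8 * K * (norm c)\<^sup>2" using const_pos by simp
  moreover have "H = 8 * K * D\<^sup>2 * G + 8 * K * (norm c)\<^sup>2" by (simp add: H_def algebra_simps)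
  ultimately have GH: "G \<le> H" and GH': "8 * K * D\<^sup>2 * G \<le> H" and H: "0 \<le> H"
    using G by simp_all
  \<comment> \<open>Bookkeeping of exponents: an estimate with loss \<open>i\<close> on the left and
    remaining decay \<open>j\<close> on the right is enough if the offsets total at most
    \<open>2 * t + 1\<close>.\<close>
  have conclude: "q \<le> B\<^sup>2" if "?r ^ i * q \<le> ?r ^ j * H" "0 \<le> H" "nat (b - k) + i \<le> 2 * t + 1 + j" for q i j
  proof -
    have "?r ^ (2 * t + 1 + i) * q \<le> ?r ^ (2 * t + 1 + j) * H"
      using mult_left_mono[OF that(1), of "?r ^ (2 * t + 1)"] by (simp add: power_add mult.assoc)
    also have "\<dots> \<le> ?r ^ (nat (b - k) + i) * H"
      using that rho_sq by (intro mult_right_mono power_decreasing) auto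
    also have "\<dots> = ?r ^ (2 * t + 1 + i) * B\<^sup>2" unfolding power_add using B2 by (simp add: algebra_simps)
    finally show ?thesis using rho_sq by simp
  qed
  have xu: "(norm (?x k))\<^sup>2 + (norm (?u k))\<^sup>2 \<le> B\<^sup>2" if "a \<le> k" "k < b"
  proof (rule conclude)
    have "(norm (?x k))\<^sup>2 + (norm (?u k))\<^sup>2 \<le> energy a (k + 1) ?x ?u"
      using that by (intro energy_ge) auto
    then have "?r ^ t * ((norm (?x k))\<^sup>2 + (norm (?u k))\<^sup>2) \<le> ?r ^ t * energy a (k + 1) ?x ?u"
      by (intro mult_left_mono) auto
    also have "\<dots> \<le> ?r ^ nat (b - (k + 1)) * G"
      unfolding G_def using that by (intro backward_decay[OF tr adj x0]) auto
    also have "\<dots> \<le> ?r ^ nat (b - (k + 1)) * H" using GH by (intro mult_left_mono) auto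
    finally show "?r ^ t * ((norm (?x k))\<^sup>2 + (norm (?u k))\<^sup>2) \<le> ?r ^ nat (b - (k + 1)) * H" .
  qed (use H that in auto)
  have total: "energy a b ?x ?u + (norm (?x b))\<^sup>2 \<le> G"
    unfolding G_def by (rule backward_total[OF tr adj x0])
  have "(norm (?x k))\<^sup>2 \<le> B\<^sup>2" if "a \<le> k"
  proof (cases "k = b")
    case True
    have "(norm (?x b))\<^sup>2 \<le> H" using total GH energy_nonneg[of a b ?x ?u] by linarith
    then show ?thesis using True H by (intro conclude[of 0 _ 0]) auto
  next
    case False then show ?thesis using xu that k by (smt (verit) atLeastAtMost_iff zero_le_power2)
  qed
  moreover have "(norm (?u k))\<^sup>2 \<le> B\<^sup>2" if "a \<le> k" "k < b"
    using xu[OF that] by (smt (verit) zero_le_power2)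
  moreover have "(norm (?l k))\<^sup>2 \<le> B\<^sup>2" if "k < b"
  \<comment> \<open>The local dual bound needs t stages after \<open>k + 1\<close>. Otherwise
    \<open>k\<close> is so close to the end that the constant absorbs all decay and the total energy
    bound suffices.\<close>
  proof (cases "k + 1 + int t \<le> b")
    case True
    let ?i = "k + 1 + int t"
    have "(norm (?l k))\<^sup>2 \<le> 4 * K * D\<^sup>2 * energy (k + 1) ?i ?x ?u"
      using dual_bound_local[OF adj, of "k + 1"] True k by simp
    also have "\<dots> \<le> 8 * K * D\<^sup>2 * energy a ?i ?x ?u"
      using k const_pos energy_nonneg[of "k + 1" ?i ?x ?u]
      by (intro mult_mono energy_mono) auto
    finally have "?r ^ t * (norm (?l k))\<^sup>2 \<le> 8 * K * D\<^sup>2 * (?r ^ t * energy a ?i ?x ?u)"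
      using rho_sq mult_left_mono[of "(norm (?l k))\<^sup>2" _ "?r ^ t"] by (simp add: algebra_simps)
    also have "\<dots> \<le> 8 * K * D\<^sup>2 * (?r ^ nat (b - ?i) * G)"
      unfolding G_def using k True const_pos by (intro mult_left_mono backward_decay[OF tr adj x0]) auto
    also have "\<dots> \<le> ?r ^ nat (b - ?i) * H"
      using mult_left_mono[OF GH', of "?r ^ nat (b - ?i)"] by (simp add: algebra_simps)
    finally show ?thesis by (rule conclude) (use H True in auto)
  next
    case False
    have "energy (k + 1) b ?x ?u \<le> energy a b ?x ?u" using k by (intro energy_mono) auto
    then have "8 * K * (D\<^sup>2 * (energy (k + 1) b ?x ?u + (norm (?x b))\<^sup>2) + (norm c)\<^sup>2) \<le> H"
      unfolding H_def using total const_pos by (intro mult_left_mono add_mono) auto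
    then have "(norm (?l k))\<^sup>2 \<le> H" using dual_bound[OF adj, of "k + 1"] that k by simp
    then show ?thesis using False H by (intro conclude[of 0 _ 0]) auto
  qed
  ultimately have "stage_norm a b k w \<le> B"
    using B0 range by (intro stage_norm_le) (auto intro: power2_le_imp_le)
  then show ?thesis by (simp add: B_def)
qed

end

lemma decay_rate_exists:
  assumes "1 \<le> K" "1 \<le> D" "0 < \<gamma>" "0 < t"
  shows "\<exists>\<rho>\<in>{0<..<1}. 1 - 1 / tail_const K D \<gamma> \<le> \<rho>\<^sup>2 \<and>
    hole_const K D \<gamma> / (1 + hole_const K D \<gamma>) \<le> (\<rho>\<^sup>2) ^ t"
proof -
  define \<kappa> where "\<kappa> = max (1 / 2) (max (1 - 1 / tail_const K D \<gamma>)
    (hole_const K D \<gamma> / (1 + hole_const K D \<gamma>)))"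
  have "0 < hole_const K D \<gamma>" using assms by (simp add: hole_const_def)
  moreover have "0 < tail_const K D \<gamma>" using assms by (simp add: tail_const_def add_nonneg_pos)
  ultimately have \<kappa>: "0 < \<kappa>" "\<kappa> < 1" by (auto simp: \<kappa>_def)
  \<comment> \<open>The root of order \<open>2 * t\<close> makes the t-stage factor exactly
    \<kappa>; the one-stage factor \<open>\<rho>\<^sup>2\<close> is then at least \<kappa>.\<close>
  define \<rho> where "\<rho> = root (2 * t) \<kappa>"
  have \<rho>: "0 < \<rho>" "\<rho> < 1" using \<kappa> assms(4) by (auto simp: \<rho>_def)
  have pow: "(\<rho>\<^sup>2) ^ t = \<kappa>"
    using \<kappa> assms(4) by (simp add: \<rho>_def flip: power_mult)
  have "(\<rho>\<^sup>2) ^ t \<le> (\<rho>\<^sup>2) ^ 1"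
    using \<rho> assms(4) by (intro power_decreasing) (auto simp: power_le_one)
  then have "1 - 1 / tail_const K D \<gamma> \<le> \<rho>\<^sup>2" unfolding pow by (simp add: \<kappa>_def)
  moreover have "hole_const K D \<gamma> / (1 + hole_const K D \<gamma>) \<le> (\<rho>\<^sup>2) ^ t" unfolding pow by (simp add: \<kappa>_def)
  ultimately show ?thesis using \<rho> by auto
qed

section \<open>Sensitivity of the subproblems\<close>

text \<open>Hessian and linear term of the terminal cost of a subproblem whose horizon ends at \<open>n\<close>.\<close>

definition cut_hess ::
  "('nx::finite, 'nu::finite) lq_data \<Rightarrow> int \<Rightarrow> real \<Rightarrow> int \<Rightarrow> real ^ 'nx \<Rightarrow> real ^ 'nx" where
  "cut_hess p N \<mu> n = (if n = N then (*v) (Qm p N) else (\<lambda>x. Qm p n *v x + (\<mu> / 2) *\<^sub>R x))"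

definition cut_lin ::
  "('nx::finite, 'nu::finite) lq_data \<Rightarrow> int \<Rightarrow> real \<Rightarrow> int \<Rightarrow> ('nx, 'nu) pd_vec \<Rightarrow> real ^ 'nx" where
  "cut_lin p N \<mu> n w = (if n = N then rv p N
     else 2 *\<^sub>R (transpose (Sm p n) *v ct w n) + rv p n - transpose (Am p n) *v mult w n - \<mu> *\<^sub>R st w n)"

lemma sub_terminal_quad: "\<exists>d. sub_terminal p N \<mu> n w = quad (cut_hess p N \<mu> n) (cut_lin p N \<mu> n w) d"
proof (cases "n = N")
  case True
  then have "sub_terminal p N \<mu> n w = quad (cut_hess p N \<mu> n) (cut_lin p N \<mu> n w) 0"
    by (simp add: fun_eq_iff sub_terminal_def lq_terminal_def quad_def cut_hess_def cut_lin_def inner_commute)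
  then show ?thesis by blast
next
  case False
  let ?u = "ct w n" and ?l = "mult w n" and ?y = "st w n"
  define d where "d = ?u \<bullet> (Rm p n *v ?u) + sv p n \<bullet> ?u - ?l \<bullet> (Bm p n *v ?u + vv p n)
    + \<mu> / 2 * (?y \<bullet> ?y)"
  have "sub_terminal p N \<mu> n w x = quad (cut_hess p N \<mu> n) (cut_lin p N \<mu> n w) d x" for x
  proof -
    have S: "x \<bullet> (transpose (Sm p n) *v ?u) = (transpose (Sm p n) *v ?u) \<bullet> x" by (rule inner_commute)
    have S': "?u \<bullet> (Sm p n *v x) = (transpose (Sm p n) *v ?u) \<bullet> x" by (rule inner_transpose[symmetric])
    have A: "?l \<bullet> (Am p n *v x) = (transpose (Am p n) *v ?l) \<bullet> x" by (rule inner_transpose[symmetric])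
    have Q: "x \<bullet> (Qm p n *v x) = (Qm p n *v x) \<bullet> x" by (rule inner_commute)
    have cost: "lq_cost p n x ?u = (Qm p n *v x) \<bullet> x + 2 * ((transpose (Sm p n) *v ?u) \<bullet> x)
        + ?u \<bullet> (Rm p n *v ?u) + rv p n \<bullet> x + sv p n \<bullet> ?u"
      unfolding lq_cost_def hess_def inner_prod_def fst_conv snd_conv inner_add_right Q S S' by simp
    have dyn: "?l \<bullet> lq_dyn p n x ?u = (transpose (Am p n) *v ?l) \<bullet> x + ?l \<bullet> (Bm p n *v ?u + vv p n)"
      unfolding lq_dyn_def inner_add_right A by simp
    have pen: "\<mu> / 2 * (norm (x - ?y))\<^sup>2 = \<mu> / 2 * (x \<bullet> x) - \<mu> * (?y \<bullet> x) + \<mu> / 2 * (?y \<bullet> ?y)"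
      unfolding power2_norm_eq_inner by (simp add: inner_diff_left inner_diff_right inner_commute algebra_simps)
    have rhs: "quad (cut_hess p N \<mu> n) (cut_lin p N \<mu> n w) d x
      = (Qm p n *v x) \<bullet> x + \<mu> / 2 * (x \<bullet> x)
        + (2 * ((transpose (Sm p n) *v ?u) \<bullet> x) + rv p n \<bullet> x - (transpose (Am p n) *v ?l) \<bullet> x
        - \<mu> * (?y \<bullet> x)) + d"
      using False by (simp only: quad_def cut_hess_def cut_lin_def if_False inner_add_left
          inner_diff_left inner_scaleR_left)
    show ?thesis
      unfolding sub_terminal_def if_not_P[OF False] cost dyn pen rhs by (simp add: d_def)
  qed
  then have "sub_terminal p N \<mu> n w = quad (cut_hess p N \<mu> n) (cut_lin p N \<mu> n w) d"
    by (rule ext)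
  then show ?thesis by blast
qed

lemma subproblem_lq_ocp:
  "\<exists>d. subproblem p N m \<tau> \<mu> i w = lq_ocp p (n1 m \<tau> i) (n2 N m \<tau> i)
     (quad (cut_hess p N \<mu> (n2 N m \<tau> i)) (cut_lin p N \<mu> (n2 N m \<tau> i) w) d) (st w (n1 m \<tau> i))"
proof -
  obtain d where "sub_terminal p N \<mu> (n2 N m \<tau> i) w
      = quad (cut_hess p N \<mu> (n2 N m \<tau> i)) (cut_lin p N \<mu> (n2 N m \<tau> i) w) d"
    using sub_terminal_quad by blast
  then show ?thesis by (auto simp: subproblem_def lq_ocp_def)
qed

lemma full_problem_lq_ocp:
  "full_problem p N = lq_ocp p 0 N (quad (cut_hess p N \<mu> N) (rv p N) 0) (xinit p)"
proof -
  have "lq_terminal p N = quad (cut_hess p N \<mu> N) (rv p N) 0"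
    by (simp add: fun_eq_iff lq_terminal_def quad_def cut_hess_def inner_commute)
  then show ?thesis by (simp add: full_problem_def lq_ocp_def)
qed

lemma decomposition_bounds:
  assumes "decomposition N T m" "i < T"
  shows "0 \<le> m i" "m i < m (Suc i)" "m (Suc i) \<le> N"
proof -
  have m: "m 0 = 0" "m T = N" "\<And>i. i < T \<Longrightarrow> m i < m (Suc i)"
    using assms(1) by (auto simp: decomposition_def)
  have mono: "j \<le> k \<Longrightarrow> k \<le> T \<Longrightarrow> m j \<le> m k" for j k
  proof (induction k)
    case (Suc k)
    then show ?case using m(3)[of k] by (auto simp: le_Suc_eq)
  qed simp
  show "0 \<le> m i" "m (Suc i) \<le> N" using mono[of 0 i] mono[of "Suc i" T] m assms(2) by auto
  show "m i < m (Suc i)" using m(3) assms(2) by simp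
qed

lemma decomposition_window:
  assumes "decomposition N T m" "i < T"
  shows "0 \<le> n1 m \<tau> i" "n1 m \<tau> i < n2 N m \<tau> i" "n2 N m \<tau> i \<le> N"
  using decomposition_bounds[OF assms] by (auto simp: n1_def n2_def)

lemma traj_lq_diff:
  assumes "\<forall>k\<in>{a..<b}. x (k + 1) = lq_dyn p k (x k) (u k)" "\<forall>k\<in>{a..<b}. y (k + 1) = lq_dyn p k (y k) (v k)"
  shows "traj p a b (\<lambda>k. x k - y k) (\<lambda>k. u k - v k)"
  using assms by (simp add: traj_def lq_dyn_def matrix_vector_mult_diff_distrib)

lemma pd_diff_sel [simp]:
  "st (pd_diff w w') = (\<lambda>k. st w k - st w' k)" "ct (pd_diff w w') = (\<lambda>k. ct w k - ct w' k)"
  "mult (pd_diff w w') = (\<lambda>k. mult w k - mult w' k)"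
  by (simp_all add: pd_diff_def)

text \<open>Test \<open>A\<close> at the vector \<open>transpose A *v y\<close> itself and cancel
  one factor of its norm.\<close>

lemma norm_transpose_le:
  fixes A :: "real ^ 'n::finite ^ 'm::finite"
  assumes "0 \<le> C" "\<And>x. norm (A *v x) \<le> C * norm x"
  shows "norm (transpose A *v y) \<le> C * norm y"
proof (cases "transpose A *v y = 0")
  case True
  then show ?thesis using assms(1) by (simp del: transpose_matrix_vector)
next
  case False
  let ?z = "transpose A *v y"
  have "norm ?z * norm ?z = y \<bullet> (A *v ?z)"
    using inner_transpose[of A y ?z] by (simp add: power2_norm_eq_inner flip: power2_eq_square)
  also have "\<dots> \<le> norm y * norm (A *v ?z)" by (rule norm_cauchy_schwarz)
  also have "\<dots> \<le> norm y * (C * norm ?z)" by (intro mult_left_mono assms(2)) simp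
  finally show ?thesis using False by (simp add: mult.commute mult.left_commute)
qed

locale lq_setting =
  fixes p :: "('nx::finite, 'nu::finite) lq_data" and N :: int and t :: nat and C K \<gamma> \<mu> \<rho> :: real
  assumes Q_sym: "\<And>k. k \<in> {0..N} \<Longrightarrow> transpose (Qm p k) = Qm p k"
    and R_sym: "\<And>k. k \<in> {0..<N} \<Longrightarrow> transpose (Rm p k) = Rm p k"
    and bd: "bounded_data p N C" and C: "1 \<le> C"
    and st: "steerable p N t K" and K: "1 \<le> K" and t: "0 < t"
    and co: "coercive p 0 N ((*v) (Qm p N)) \<gamma>" and \<gamma>: "0 < \<gamma>"
    and \<mu>: "C * K + C \<le> \<mu> / 2"
    and rho: "0 < \<rho>" "\<rho> < 1" "1 - 1 / tail_const K (C + \<mu> / 2) \<gamma> \<le> \<rho>\<^sup>2"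
      "hole_const K (C + \<mu> / 2) \<gamma> / (1 + hole_const K (C + \<mu> / 2) \<gamma>) \<le> (\<rho>\<^sup>2) ^ t"
begin

text \<open>The penalty adds \<mu> / 2 to the bound on the terminal Hessian, so one constant serves
  windows ending at \<open>N\<close> and before it.\<close>

abbreviation "D \<equiv> C + \<mu> / 2"

abbreviation "window a b c d e \<equiv> lq_ocp p a b (quad (cut_hess p N \<mu> b) c d) e"

lemma \<mu>_pos: "0 < \<mu>"
  using \<mu> C K mult_mono[of 1 C 1 K] by simp

lemma cut_self_adjoint:
  assumes "b \<in> {0..N}" shows "self_adjoint (cut_hess p N \<mu> b)"
  using inner_symmetric_matrix[OF Q_sym[OF assms]]
  by (auto simp: self_adjoint_def cut_hess_def inner_add_left inner_add_right)

lemma window_sym: "0 \<le> a \<Longrightarrow> b \<le> N \<Longrightarrow> sym_data p a b"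
  using Q_sym R_sym by (simp add: sym_data_def)

lemma window_decay:
  assumes "0 \<le> a" "a \<le> b" "b \<le> N"
  shows "lq_decay p N t K D \<gamma> a b (cut_hess p N \<mu> b) \<rho>"
proof (intro lq_decay.intro lq_window.intro lq_decay_axioms.intro)
  show "norm (hess p k z) \<le> D * norm z" if "k \<in> {0..<N}" for k z
    using bounded_dataD(1)[OF bd that, of z] mult_right_mono[of C D "norm z"] \<mu>_pos by simp
  show "norm (cut_hess p N \<mu> b x) \<le> D * norm x" for x
  proof -
    have Q: "norm (Qm p b *v x) \<le> C * norm x" using assms by (intro norm_Qm_le[OF bd]) auto
    have "norm (cut_hess p N \<mu> b x) \<le> norm (Qm p b *v x) + norm ((\<mu> / 2) *\<^sub>R x)"
      using norm_triangle_ineq[of "Qm p b *v x" "(\<mu> / 2) *\<^sub>R x"] by (simp add: cut_hess_def)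
    then show ?thesis using Q \<mu>_pos by (simp add: algebra_simps)
  qed
  show "linear (cut_hess p N \<mu> b)"
    using assms by (intro self_adjoint_linear cut_self_adjoint) auto
  show "coercive p a b (cut_hess p N \<mu> b) \<gamma>"
  proof (cases "b = N")
    case True
    then show ?thesis using coercive_mono[OF co] assms \<gamma> by (simp add: cut_hess_def)
  next
    case False
    then show ?thesis
      using coercive_penalized[OF co _ st bd C _ _ _ \<mu>, of a b] assms \<gamma> by (simp add: cut_hess_def)
  qed
qed (use assms st t K C \<gamma> \<mu>_pos rho in auto)

section \<open>KKT points of windows: sensitivity, existence and uniqueness\<close>

lemma window_kkt_iff:
  assumes "0 \<le> a" "a \<le> b" "b \<le> N"
  shows "kkt_point (window a b c d e) w \<longleftrightarrow>
     st w a = e \<and> (\<forall>k\<in>{a..<b}. st w (k + 1) = lq_dyn p k (st w k) (ct w k)) \<and>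
     adjoint_eqs p a b (rv p) (sv p) (cut_hess p N \<mu> b) c (st w) (ct w) (mult w)"
  using assms by (intro kkt_point_iff window_sym cut_self_adjoint) auto

lemma window_initial_sensitivity:
  assumes ab: "0 \<le> a" "a \<le> b" "b \<le> N"
    and w: "kkt_point (window a b c d e) w" "kkt_point (window a b c d' e') w'"
    and k: "k \<in> {a - 1..b}"
  shows "stage_norm a b k (pd_diff w w') \<le> fwd_const K D \<gamma> * (\<rho> powi (k - a) * norm (e - e'))"
proof -
  interpret lq_decay p N t K D \<gamma> a b "cut_hess p N \<mu> b" \<rho> by (rule window_decay[OF ab])
  note w' = w[unfolded window_kkt_iff[OF ab]]
  have "traj p a b (st (pd_diff w w')) (ct (pd_diff w w'))"
    using w' by (auto intro!: traj_lq_diff)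
  moreover have "adjoint_eqs p a b (\<lambda>_. 0) (\<lambda>_. 0) (cut_hess p N \<mu> b) 0
      (st (pd_diff w w')) (ct (pd_diff w w')) (mult (pd_diff w w'))"
    using adjoint_eqs_diff[OF M_lin w'[THEN conjunct2, THEN conjunct2]] by simp
  ultimately show ?thesis using stage_norm_forward[OF _ _ k] w' by fastforce
qed

lemma window_terminal_sensitivity:
  assumes ab: "0 \<le> a" "a \<le> b" "b \<le> N"
    and w: "kkt_point (window a b c d e) w" "kkt_point (window a b c' d' e) w'"
    and k: "k \<in> {a - 1..b}"
  shows "stage_norm a b k (pd_diff w w') \<le> bwd_const K D \<gamma> t \<rho> * (\<rho> powi (b - k) * norm (c - c'))"
proof -
  interpret lq_decay p N t K D \<gamma> a b "cut_hess p N \<mu> b" \<rho> by (rule window_decay[OF ab])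
  note w' = w[unfolded window_kkt_iff[OF ab]]
  have "traj p a b (st (pd_diff w w')) (ct (pd_diff w w'))"
    using w' by (auto intro!: traj_lq_diff)
  moreover have "adjoint_eqs p a b (\<lambda>_. 0) (\<lambda>_. 0) (cut_hess p N \<mu> b) (c - c')
      (st (pd_diff w w')) (ct (pd_diff w w')) (mult (pd_diff w w'))"
    using adjoint_eqs_diff[OF M_lin w'[THEN conjunct2, THEN conjunct2]] by simp
  ultimately show ?thesis using stage_norm_backward[OF _ _ _ k] w' by fastforce
qed

lemma window_kkt_exists:
  assumes ab: "0 \<le> a" "a \<le> b" "b \<le> N"
  shows "\<exists>w. kkt_point (window a b c d e) w"
proof -
  interpret lq_decay p N t K D \<gamma> a b "cut_hess p N \<mu> b" \<rho> by (rule window_decay[OF ab])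
  show ?thesis using ab coerc \<gamma> by (intro kkt_point_exists window_sym cut_self_adjoint) auto
qed

text \<open>Two KKT points of one window share the initial state and the terminal data, so initial
  sensitivity bounds their difference by zero at every stage, multipliers included.\<close>

lemma window_unique:
  assumes ab: "0 \<le> a" "a \<le> b" "b \<le> N" and w: "kkt_point (window a b c d e) w"
  shows "unique_global_pd_solution (window a b c d e) w"
  unfolding unique_global_pd_solution_def lq_ocp_sel
proof (intro conjI allI impI ballI)
  interpret lq_decay p N t K D \<gamma> a b "cut_hess p N \<mu> b" \<rho> by (rule window_decay[OF ab])
  show "pd_solution (window a b c d e) w"
    using ab coerc \<gamma> w by (intro kkt_point_global window_sym cut_self_adjoint) auto
next
  fix w' k assume w': "kkt_point (window a b c d e) w'" and k: "k \<in> {a - 1..b}"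
  have "stage_norm a b k (pd_diff w' w) \<le> 0"
    using window_initial_sensitivity[OF ab w' w k] by simp
  then have z: "stage_norm a b k (pd_diff w' w) = 0" using stage_norm_nonneg by (rule antisym)
  show "stage_eq a b k w' w"
    using norm_le_stage_norm[where a = a and b = b and k = k and w = "pd_diff w' w"] ab
    unfolding stage_eq_def z by auto
qed

text \<open>The term with the multiplier in the adjusted terminal cost reproduces the adjoint
  equation of stage \<open>b\<close>, and the gradient of the penalty vanishes at its own centre.
  The solution is therefore a fixed point of the subproblem map.\<close>

lemma full_kkt_window:
  assumes ab: "0 \<le> a" "a \<le> b" "b \<le> N" and w: "kkt_point (full_problem p N) w"
  shows "kkt_point (window a b (cut_lin p N \<mu> b w) d (st w a)) w"
proof -
  have N: "0 \<le> N" using ab by simp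
  note w' = w[unfolded full_problem_lq_ocp[where \<mu> = \<mu>] window_kkt_iff[OF order_refl N order_refl]]
  have adj: "adjoint_eqs p 0 N (rv p) (sv p) (cut_hess p N \<mu> N) (rv p N) (st w) (ct w) (mult w)"
    using w' by blast
  have "2 *\<^sub>R cut_hess p N \<mu> b (st w b) + cut_lin p N \<mu> b w + mult w (b - 1) = 0"
  proof (cases "b = N")
    case True
    then show ?thesis using adj by (simp add: adjoint_eqs_def cut_lin_def)
  next
    case False
    then have "b \<in> {0..<N}" using ab by auto
    then have "2 *\<^sub>R fst (hess p b (st w b, ct w b)) + rv p b + mult w (b - 1)
        - transpose (Am p b) *v mult w b = 0"
      using adj unfolding adjoint_eqs_def by blast
    then show ?thesis using False
      by (simp add: hess_def cut_hess_def cut_lin_def scaleR_add_right algebra_simps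
          del: transpose_matrix_vector)
  qed
  then have "adjoint_eqs p a b (rv p) (sv p) (cut_hess p N \<mu> b) (cut_lin p N \<mu> b w) (st w) (ct w) (mult w)"
    using adj ab by (simp add: adjoint_eqs_def)
  then show ?thesis using w' ab by (simp add: window_kkt_iff)
qed

text \<open>The control enters through \<open>2 * S^T\<close>, the multiplier through
  \<open>A^T\<close>, and the state through the centre of the penalty: 2 C, C and \<mu>.\<close>

lemma norm_cut_lin_diff:
  assumes b: "0 \<le> b" "b < N"
  shows "norm (cut_lin p N \<mu> b w - cut_lin p N \<mu> b w') \<le> (3 * C + \<mu>) * stage_norm 0 N b (pd_diff w w')"
proof -
  let ?s = "stage_norm 0 N b (pd_diff w w')"
  let ?x = "st w b - st w' b" and ?u = "ct w b - ct w' b" and ?l = "mult w b - mult w' b"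
  have k: "b \<in> {0..<N}" using b by auto
  have s: "norm ?x \<le> ?s" "norm ?u \<le> ?s" "norm ?l \<le> ?s"
    using norm_le_stage_norm[where a = 0 and b = N and k = b and w = "pd_diff w w'"] b by auto
  have S: "norm (transpose (Sm p b) *v ?u) \<le> C * norm ?u"
  proof -
    have "norm (transpose (Sm p b) *v ?u) \<le> norm (hess p b (0, ?u))"
      using norm_fst_le[of "transpose (Sm p b) *v ?u" "Rm p b *v ?u"]
      by (simp add: hess_def del: transpose_matrix_vector)
    also have "\<dots> \<le> C * norm (0 :: real ^ 'nx, ?u)" by (rule bounded_dataD[OF bd k])
    finally show ?thesis by simp
  qed
  have A: "norm (transpose (Am p b) *v ?l) \<le> C * norm ?l"
    using C by (intro norm_transpose_le bounded_dataD[OF bd k]) simp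
  have "cut_lin p N \<mu> b w - cut_lin p N \<mu> b w'
      = 2 *\<^sub>R (transpose (Sm p b) *v ?u) - transpose (Am p b) *v ?l - \<mu> *\<^sub>R ?x"
    using b by (simp add: cut_lin_def matrix_vector_mult_diff_distrib algebra_simps scaleR_diff_right
        del: transpose_matrix_vector)
  then have "norm (cut_lin p N \<mu> b w - cut_lin p N \<mu> b w')
      \<le> norm (2 *\<^sub>R (transpose (Sm p b) *v ?u) - transpose (Am p b) *v ?l) + norm (\<mu> *\<^sub>R ?x)"
    by (simp only: norm_triangle_ineq4)
  also have "\<dots> \<le> norm (2 *\<^sub>R (transpose (Sm p b) *v ?u)) + norm (transpose (Am p b) *v ?l)
      + norm (\<mu> *\<^sub>R ?x)"
    by (intro add_right_mono norm_triangle_ineq4)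
  also have "\<dots> \<le> 2 * (C * ?s) + C * ?s + \<mu> * ?s"
  proof (intro add_mono)
    have "norm (transpose (Sm p b) *v ?u) \<le> C * ?s"
      using S s(2) C by (smt (verit) mult_left_mono)
    then show "norm (2 *\<^sub>R (transpose (Sm p b) *v ?u)) \<le> 2 * (C * ?s)" by simp
    show "norm (transpose (Am p b) *v ?l) \<le> C * ?s"
      using A s(3) C by (smt (verit) mult_left_mono)
    show "norm (\<mu> *\<^sub>R ?x) \<le> \<mu> * ?s" using s(1) \<mu>_pos by simp
  qed
  finally show ?thesis by (simp add: algebra_simps)
qed

lemma subproblem_unique_solution:
  assumes "decomposition N T m" "i < T"
  shows "\<exists>y. unique_global_pd_solution (subproblem p N m \<tau> \<mu> i w) y"
proof -
  note ab = decomposition_window[OF assms, of \<tau>]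
  note ab' = ab(1) less_imp_le[OF ab(2)] ab(3)
  obtain d where "subproblem p N m \<tau> \<mu> i w = window (n1 m \<tau> i) (n2 N m \<tau> i)
     (cut_lin p N \<mu> (n2 N m \<tau> i) w) d (st w (n1 m \<tau> i))"
    using subproblem_lq_ocp by blast
  then show ?thesis using window_kkt_exists[OF ab'] window_unique[OF ab'] by metis
qed

lemma full_unique_solution:
  assumes "0 \<le> N"
  shows "\<exists>w. unique_global_pd_solution (full_problem p N) w"
  unfolding full_problem_lq_ocp[where \<mu> = \<mu>]
  using window_kkt_exists[OF order_refl assms order_refl] window_unique[OF order_refl assms order_refl]
  by blast

text \<open>The two contributions are separated by an intermediate subproblem whose initial state is taken
  from \<open>wb\<close> and whose terminal data are taken from \<open>ws\<close>.\<close>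

lemma stagewise_estimate_holds:
  assumes dec: "decomposition N T m" and ws: "kkt_point (full_problem p N) ws"
    and \<Upsilon>: "fwd_const K D \<gamma> \<le> \<Upsilon>" "bwd_const K D \<gamma> t \<rho> * (3 * C + \<mu>) \<le> \<Upsilon>"
  shows "stagewise_estimate p N T m \<tau> \<mu> \<Upsilon> \<rho> ws"
  unfolding stagewise_estimate_def Let_def
proof (intro allI impI ballI)
  fix i wb y k
  assume i: "i < T" and y: "pd_solution (subproblem p N m \<tau> \<mu> i wb) y"
    and k: "k \<in> {n1 m \<tau> i - 1..n2 N m \<tau> i}"
  define a b where "a = n1 m \<tau> i" and "b = n2 N m \<tau> i"
  have ab: "0 \<le> a" "a \<le> b" "b \<le> N"
    using decomposition_window[OF dec i, of \<tau>] by (auto simp: a_def b_def)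
  have k: "k \<in> {a - 1..b}" using k by (simp add: a_def b_def)
  obtain d where d: "kkt_point (window a b (cut_lin p N \<mu> b wb) d (st wb a)) y"
    using y subproblem_lq_ocp[of p N m \<tau> \<mu> i wb] unfolding pd_solution_def a_def b_def by auto
  have ws': "kkt_point (window a b (cut_lin p N \<mu> b ws) d (st ws a)) ws"
    by (rule full_kkt_window[OF ab ws])
  obtain z where z: "kkt_point (window a b (cut_lin p N \<mu> b ws) d (st wb a)) z"
    using window_kkt_exists[OF ab] by blast
  let ?s = "if b = N then 0 else \<rho> powi (b - k) * stage_norm 0 N b (pd_diff wb ws)"
  have 1: "stage_norm a b k (pd_diff z ws) \<le> \<Upsilon> * (\<rho> powi (k - a) * norm (st wb a - st ws a))"
    using window_initial_sensitivity[OF ab z ws' k] \<Upsilon>(1) rho(1)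
    by (smt (verit) mult_nonneg_nonneg mult_right_mono norm_ge_zero zero_le_power_int)
  have B: "0 \<le> bwd_const K D \<gamma> t \<rho>" using C K \<mu>_pos by (simp add: bwd_const_def)
  have 2: "stage_norm a b k (pd_diff y z) \<le> \<Upsilon> * ?s"
  proof (cases "b = N")
    case True
    then show ?thesis
      using window_terminal_sensitivity[OF ab d z k] by (simp add: cut_lin_def)
  next
    case False
    let ?n = "stage_norm 0 N b (pd_diff wb ws)"
    have "stage_norm a b k (pd_diff y z)
        \<le> bwd_const K D \<gamma> t \<rho> * (\<rho> powi (b - k) * norm (cut_lin p N \<mu> b wb - cut_lin p N \<mu> b ws))"
      by (rule window_terminal_sensitivity[OF ab d z k])
    also have "\<dots> \<le> bwd_const K D \<gamma> t \<rho> * (\<rho> powi (b - k) * ((3 * C + \<mu>) * ?n))"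
      using False ab B rho(1) by (intro mult_left_mono norm_cut_lin_diff) auto
    also have "\<dots> = bwd_const K D \<gamma> t \<rho> * (3 * C + \<mu>) * (\<rho> powi (b - k) * ?n)" by simp
    also have "\<dots> \<le> \<Upsilon> * (\<rho> powi (b - k) * ?n)"
      using \<Upsilon>(2) rho(1) by (intro mult_right_mono mult_nonneg_nonneg stage_norm_nonneg) auto
    finally show ?thesis using False by simp
  qed
  have "stage_norm a b k (pd_diff y ws) \<le> \<Upsilon> * ?s + \<Upsilon> * (\<rho> powi (k - a) * norm (st wb a - st ws a))"
    using stage_norm_triangle[OF ab(2), of k y ws z] 1 2 by linarith
  then show "stage_norm (n1 m \<tau> i) (n2 N m \<tau> i) k (pd_diff y ws) \<le> \<Upsilon> *
     (\<rho> powi (k - n1 m \<tau> i) * norm (st wb (n1 m \<tau> i) - st ws (n1 m \<tau> i)) +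
      (if n2 N m \<tau> i = N then 0
       else \<rho> powi (n2 N m \<tau> i - k) * stage_norm 0 N (n2 N m \<tau> i) (pd_diff wb ws)))"
    unfolding a_def[symmetric] b_def[symmetric] by (simp only: distrib_left add.commute)
qed

end

section \<open>Convergence of the Schwarz iteration\<close>

lemma decomposition_cover:
  assumes "decomposition N T m" "k \<in> {-1..N}"
  shows "\<exists>i<T. k \<in> own_stages N T m i"
proof -
  have T: "1 \<le> T" and m: "m 0 = 0" "m T = N"
    using assms(1) by (auto simp: decomposition_def)
  consider "k = -1" | "k = N" | "0 \<le> k" "k < N" using assms(2) by fastforce
  then show ?thesis
  proof cases
    case 1 then show ?thesis using T by (intro exI[of _ 0]) (auto simp: own_stages_def)
  next
    case 2 then show ?thesis using T by (intro exI[of _ "T - 1"]) (auto simp: own_stages_def)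
  next
    case 3
    have "k < m n \<Longrightarrow> \<exists>i<n. m i \<le> k \<and> k < m (Suc i)" for n
    proof (induction n)
      case 0 then show ?case using 3 m by simp
    next
      case (Suc n) then show ?case by (cases "k < m n") (auto intro: less_SucI)
    qed
    then obtain i where "i < T" "m i \<le> k" "k < m (Suc i)" using 3 m by metis
    then show ?thesis by (intro exI[of _ i]) (auto simp: own_stages_def)
  qed
qed

lemma w_norm_ge:
  assumes "k \<in> {a - 1..b}" shows "stage_norm a b k w \<le> w_norm a b w"
  unfolding w_norm_def using assms by (intro Max_ge) auto

lemma w_norm_le:
  assumes "a - 1 \<le> b" "\<And>k. k \<in> {a - 1..b} \<Longrightarrow> stage_norm a b k w \<le> B"
  shows "w_norm a b w \<le> B"
  unfolding w_norm_def using assms by (subst Max_le_iff) auto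

text \<open>A window boundary carries fewer components than the same stage of the full horizon. The
  hypotheses keep an owned stage off such a boundary unless it coincides with an end of the full
  horizon.\<close>

lemma stage_norm_own_window:
  assumes "stage_eq 0 N k w y" "a = 0 \<or> 0 \<le> k" "0 \<le> a" "a \<le> max k 0" "k < b \<or> b = N" "b \<le> N" "0 \<le> N"
  shows "stage_norm 0 N k (pd_diff w z) \<le> stage_norm a b k (pd_diff y z)"
  using assms by (auto simp: stage_eq_def stage_norm_def)

text \<open>Each boundary term is small for one of two reasons: its end is at least \<tau> stages
  away, or the horizon is cut at 0 or \<open>N\<close> and no boundary error exists there. The two
  ends account for the factor 2.\<close>

lemma schwarz_linear_convergence:
  assumes dec: "decomposition N T m" and est: "stagewise_estimate p N T m \<tau> \<mu> \<Upsilon> \<rho> ws"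
    and ws0: "st ws 0 = xinit p" and sch: "schwarz_iterates p N T m \<tau> \<mu> w"
    and c: "0 < \<Upsilon>" "0 < \<rho>" "\<rho> < 1"
  shows "w_norm 0 N (pd_diff (w l) ws) \<le> (2 * \<Upsilon> * \<rho> ^ \<tau>) ^ l * w_norm 0 N (pd_diff (w 0) ws)"
proof -
  have T: "0 < T" and m: "m 0 = 0" "m T = N" "\<And>i. i < T \<Longrightarrow> m i < m (Suc i)"
    using dec by (auto simp: decomposition_def)
  have N: "0 \<le> N" using decomposition_bounds[OF dec T] by simp
  \<comment> \<open>At a left end cut at 0 the power of \<rho> may not be small, so the initial
    state must be exact in every iterate; each sweep passes it on.\<close>
  have init: "st (w l) 0 = st ws 0" for l
  proof (induction l)
    case 0 then show ?case using sch ws0 by (simp add: schwarz_iterates_def)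
  next
    case (Suc l)
    obtain y where y: "pd_solution (subproblem p N m \<tau> \<mu> 0 (w l)) y"
      "\<forall>k\<in>own_stages N T m 0. stage_eq 0 N k (w (Suc l)) y"
      using sch T unfolding schwarz_iterates_def by blast
    have "0 \<in> own_stages N T m 0" using m(1) m(3)[of 0] T by (simp add: own_stages_def)
    then have "st (w (Suc l)) 0 = st y 0" using y(2) by (auto simp: stage_eq_def)
    also have "\<dots> = st (w l) 0"
      using y(1) m by (simp add: pd_solution_def kkt_point_def feasible_def subproblem_def n1_def)
    finally show ?case using Suc by simp
  qed
  have step: "w_norm 0 N (pd_diff (w (Suc l)) ws) \<le> 2 * \<Upsilon> * \<rho> ^ \<tau> * w_norm 0 N (pd_diff (w l) ws)" for l
  proof (rule w_norm_le)
    define e where "e = w_norm 0 N (pd_diff (w l) ws)"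
    have stage: "stage_norm 0 N j (pd_diff (w l) ws) \<le> e" if "0 \<le> j" "j \<le> N" for j
      unfolding e_def using that by (intro w_norm_ge) auto
    have e0: "0 \<le> e" using stage[of 0] stage_norm_nonneg[of 0 N 0 "pd_diff (w l) ws"] N by simp
    have weight: "\<rho> powi j * q \<le> \<rho> ^ \<tau> * e" if "int \<tau> \<le> j" "0 \<le> q" "q \<le> e" for j q
    proof -
      have "\<rho> powi j = \<rho> ^ nat j" using that(1) by (simp add: power_int_def)
      also have "\<dots> \<le> \<rho> ^ \<tau>" using that(1) c by (intro power_decreasing) auto
      finally show ?thesis using that c e0 by (intro mult_mono) auto
    qed
    fix k assume k: "k \<in> {0 - 1..N}"
    then obtain i where i: "i < T" and ki: "k \<in> own_stages N T m i"
      using decomposition_cover[OF dec, of k] by auto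
    define a b where "a = n1 m \<tau> i" and "b = n2 N m \<tau> i"
    note mi = decomposition_bounds[OF dec i]
    note win = decomposition_window[OF dec i, of \<tau>, folded a_def b_def]
    obtain y where y: "pd_solution (subproblem p N m \<tau> \<mu> i (w l)) y"
      "stage_eq 0 N k (w (Suc l)) y"
      using sch i ki unfolding schwarz_iterates_def by blast
    have k_own: "m i \<le> k \<and> k < m (Suc i) \<or> k = -1 \<and> i = 0 \<or> k = N \<and> Suc i = T"
      using ki T by (auto simp: own_stages_def split: if_splits)
    have left: "a = 0 \<or> a = m i - int \<tau> \<and> m i \<le> k"
      using k_own mi m(1,2) by (auto simp: a_def n1_def)
    have right: "b = N \<or> b = m (Suc i) + int \<tau> \<and> k < m (Suc i)"
      using k_own mi m(1,2) by (auto simp: b_def n2_def)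
    have kb: "k \<in> {a - 1..b}" using left right k mi win by auto
    have "stage_norm 0 N k (pd_diff (w (Suc l)) ws) \<le> stage_norm a b k (pd_diff y ws)"
      using y(2) left right win N mi k by (intro stage_norm_own_window) auto
    also have "\<dots> \<le> \<Upsilon> * (\<rho> powi (k - a) * norm (st (w l) a - st ws a)
       + (if b = N then 0 else \<rho> powi (b - k) * stage_norm 0 N b (pd_diff (w l) ws)))"
      using est i y(1) kb unfolding stagewise_estimate_def Let_def a_def b_def by blast
    also have "\<dots> \<le> \<Upsilon> * (\<rho> ^ \<tau> * e + \<rho> ^ \<tau> * e)"
    proof (intro mult_left_mono add_mono)
      show "\<rho> powi (k - a) * norm (st (w l) a - st ws a) \<le> \<rho> ^ \<tau> * e"
      proof (cases "a = 0")
        case True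
        then show ?thesis using init[of l] e0 c by simp
      next
        case False
        have "norm (st (w l) a - st ws a) \<le> stage_norm 0 N a (pd_diff (w l) ws)"
          using norm_le_stage_norm(1)[of 0 a "pd_diff (w l) ws" N] win by simp
        also have "\<dots> \<le> e" using stage win by simp
        finally show ?thesis using False left by (intro weight) auto
      qed
      show "(if b = N then 0 else \<rho> powi (b - k) * stage_norm 0 N b (pd_diff (w l) ws)) \<le> \<rho> ^ \<tau> * e"
        using right win stage[of b] e0 c by (auto intro!: weight stage_norm_nonneg)
    qed (use c in simp)
    finally show "stage_norm 0 N k (pd_diff (w (Suc l)) ws)
        \<le> 2 * \<Upsilon> * \<rho> ^ \<tau> * w_norm 0 N (pd_diff (w l) ws)" by (simp add: e_def)
  qed (use N in simp)
  show ?thesis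
  proof (induction l)
    case (Suc l)
    have "w_norm 0 N (pd_diff (w (Suc l)) ws)
        \<le> 2 * \<Upsilon> * \<rho> ^ \<tau> * ((2 * \<Upsilon> * \<rho> ^ \<tau>) ^ l * w_norm 0 N (pd_diff (w 0) ws))"
      by (rule order_trans[OF step mult_left_mono[OF Suc]]) (use c in simp)
    then show ?case by (simp add: mult.assoc)
  qed simp
qed

text \<open>Uniformity lies in the order of the quantifiers: the threshold on \<mu> precedes
  \<open>\<gamma>H\<close>, and all constants precede the data, the horizon and the
  decomposition.\<close>

theorem theorem9:
  fixes \<gamma>C \<Upsilon>upper :: real and t :: nat
  assumes "\<gamma>C > 0" and "t > 0"
  shows
    "\<exists>\<mu>bar>0. \<forall>\<gamma>H>0. \<forall>\<mu>\<ge>\<mu>bar. \<exists>\<Upsilon>>0. \<exists>\<rho>\<in>{0<..<1}. \<exists>\<tau>bar>0.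
       \<forall>(p :: ('nx::finite, 'nu::finite) lq_data) N T m \<tau>.
         lq_conditions p N \<gamma>H \<gamma>C t \<Upsilon>upper \<longrightarrow> decomposition N T m \<longrightarrow>
         (\<forall>i<T. \<forall>wb. \<exists>y. unique_global_pd_solution (subproblem p N m \<tau> \<mu> i wb) y) \<and>
         (\<exists>ws. unique_global_pd_solution (full_problem p N) ws \<and>
            stagewise_estimate p N T m \<tau> \<mu> \<Upsilon> \<rho> ws \<and>
            (\<tau> \<ge> \<tau>bar \<longrightarrow>
               2 * \<Upsilon> * \<rho> ^ \<tau> < 1 \<and>
               (\<forall>w. schwarz_iterates p N T m \<tau> \<mu> w \<longrightarrow>
                  (\<forall>l. w_norm 0 N (pd_diff (w l) ws)
                         \<le> (2 * \<Upsilon> * \<rho> ^ \<tau>) ^ l * w_norm 0 N (pd_diff (w 0) ws)))))"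
proof -
  \<comment> \<open>Steering bounds and the weighted inequalities are stated for a bound of at least
    1.\<close>
  define C where "C = max \<Upsilon>upper 1"
  have C: "1 \<le> C" "\<Upsilon>upper \<le> C" by (auto simp: C_def)
  obtain K where K: "1 \<le> K" and steer: "\<And>(p :: ('nx, 'nu) lq_data) N. bounded_data p N C \<Longrightarrow>
      uniform_controllability p N t \<gamma>C \<Longrightarrow> steerable p N t K"
    using steerable_exists[OF C(1) assms(1), of t, where ?'nx = 'nx and ?'nu = 'nu] by blast
  have \<mu>bar: "0 < 2 * (C * K + C)" using C K by (simp add: add_pos_pos)
  show ?thesis
  proof (rule exI[of _ "2 * (C * K + C)"], intro conjI allI impI \<mu>bar)
    fix \<gamma>H \<mu> :: real assume \<gamma>H: "\<gamma>H > 0" and \<mu>: "2 * (C * K + C) \<le> \<mu>"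
    define D where "D = C + \<mu> / 2"
    have \<mu>0: "0 < \<mu>" using \<mu>bar \<mu> by simp
    have D: "1 \<le> D" using C \<mu>0 by (simp add: D_def)
    obtain \<rho> where \<rho>: "\<rho> \<in> {0<..<1}" "1 - 1 / tail_const K D \<gamma>H \<le> \<rho>\<^sup>2"
      "hole_const K D \<gamma>H / (1 + hole_const K D \<gamma>H) \<le> (\<rho>\<^sup>2) ^ t"
      using decay_rate_exists[OF K D \<gamma>H assms(2)] by blast
    define \<Upsilon> where "\<Upsilon> = max 1 (max (fwd_const K D \<gamma>H) (bwd_const K D \<gamma>H t \<rho> * (3 * C + \<mu>)))"
    have \<Upsilon>: "\<Upsilon> > 0" "fwd_const K D \<gamma>H \<le> \<Upsilon>" "bwd_const K D \<gamma>H t \<rho> * (3 * C + \<mu>) \<le> \<Upsilon>"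
      by (auto simp: \<Upsilon>_def)
    have "(\<lambda>n. 2 * \<Upsilon> * \<rho> ^ n) \<longlonglongrightarrow> 2 * \<Upsilon> * 0"
      using \<rho>(1) by (intro tendsto_mult_left LIMSEQ_realpow_zero) auto
    then have "eventually (\<lambda>n. 2 * \<Upsilon> * \<rho> ^ n < 1) sequentially"
      by (rule order_tendstoD(2)) simp
    \<comment> \<open>With \<Upsilon> and \<rho> fixed, the overlap threshold only has to make the
      contraction factor smaller than 1.\<close>
    then obtain \<tau>0 where \<tau>0: "\<And>n. n \<ge> \<tau>0 \<Longrightarrow> 2 * \<Upsilon> * \<rho> ^ n < 1"
      unfolding eventually_sequentially by blast
    have main: "(\<forall>i<T. \<forall>wb. \<exists>y. unique_global_pd_solution (subproblem p N m \<tau> \<mu> i wb) y) \<and>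
         (\<exists>ws. unique_global_pd_solution (full_problem p N) ws \<and>
            stagewise_estimate p N T m \<tau> \<mu> \<Upsilon> \<rho> ws \<and>
            (\<tau> \<ge> Suc \<tau>0 \<longrightarrow>
               2 * \<Upsilon> * \<rho> ^ \<tau> < 1 \<and>
               (\<forall>w. schwarz_iterates p N T m \<tau> \<mu> w \<longrightarrow>
                  (\<forall>l. w_norm 0 N (pd_diff (w l) ws)
                         \<le> (2 * \<Upsilon> * \<rho> ^ \<tau>) ^ l * w_norm 0 N (pd_diff (w 0) ws)))))"
      if lq: "lq_conditions p N \<gamma>H \<gamma>C t \<Upsilon>upper" and dec: "decomposition N T m"
      for p :: "('nx, 'nu) lq_data" and N T m \<tau>
    proof -
      have "0 < T" using dec by (simp add: decomposition_def)
      then have N: "0 \<le> N" using decomposition_bounds[OF dec] by fastforce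
      have bd: "bounded_data p N C"
        using lq C(2) uniform_bound_bounded_data by (auto simp: lq_conditions_def)
      interpret lq_setting p N t C K \<gamma>H \<mu> \<rho>
      proof
        show "steerable p N t K" using steer[OF bd] lq by (simp add: lq_conditions_def)
        show "coercive p 0 N ((*v) (Qm p N)) \<gamma>H"
          using lq unfolding lq_conditions_def by (intro uniform_sosc_coercive N) blast
      qed (use lq bd C K assms(2) \<gamma>H \<mu> \<rho> in \<open>auto simp: lq_conditions_def D_def\<close>)
      obtain ws where ws: "unique_global_pd_solution (full_problem p N) ws"
        using full_unique_solution[OF N] by blast
      then have kkt: "kkt_point (full_problem p N) ws"
        by (simp add: unique_global_pd_solution_def pd_solution_def)
      have ws0: "st ws 0 = xinit p"
        using kkt by (simp add: kkt_point_def feasible_def full_problem_def)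
      have est: "stagewise_estimate p N T m \<tau> \<mu> \<Upsilon> \<rho> ws"
        using \<Upsilon>(2,3) by (intro stagewise_estimate_holds[OF dec kkt]) (simp_all add: D_def)
      have "\<forall>i<T. \<forall>wb. \<exists>y. unique_global_pd_solution (subproblem p N m \<tau> \<mu> i wb) y"
        using subproblem_unique_solution[OF dec] by blast
      moreover have "2 * \<Upsilon> * \<rho> ^ \<tau> < 1" if "\<tau> \<ge> Suc \<tau>0" using \<tau>0[of \<tau>] that by simp
      ultimately show ?thesis
        using ws est schwarz_linear_convergence[OF dec est ws0] \<rho>(1) \<Upsilon>(1)
        by (smt (verit) greaterThanLessThan_iff)
    qed
    show "\<exists>\<Upsilon>>0. \<exists>\<rho>\<in>{0<..<1}. \<exists>\<tau>bar>0.
       \<forall>(p :: ('nx, 'nu) lq_data) N T m \<tau>.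
         lq_conditions p N \<gamma>H \<gamma>C t \<Upsilon>upper \<longrightarrow> decomposition N T m \<longrightarrow>
         (\<forall>i<T. \<forall>wb. \<exists>y. unique_global_pd_solution (subproblem p N m \<tau> \<mu> i wb) y) \<and>
         (\<exists>ws. unique_global_pd_solution (full_problem p N) ws \<and>
            stagewise_estimate p N T m \<tau> \<mu> \<Upsilon> \<rho> ws \<and>
            (\<tau> \<ge> \<tau>bar \<longrightarrow>
               2 * \<Upsilon> * \<rho> ^ \<tau> < 1 \<and>
               (\<forall>w. schwarz_iterates p N T m \<tau> \<mu> w \<longrightarrow>
                  (\<forall>l. w_norm 0 N (pd_diff (w l) ws)
                         \<le> (2 * \<Upsilon> * \<rho> ^ \<tau>) ^ l * w_norm 0 N (pd_diff (w 0) ws)))))"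
      using main \<Upsilon>(1) \<rho>(1) by (intro exI[of _ \<Upsilon>] bexI[of _ \<rho>] exI[of _ "Suc \<tau>0"] conjI allI impI) auto
  qed
qed

end
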